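(* Let $C_{\phi,w}$ be densely defined in $L^2(\mu)$. Then the following conditions are equivalent: (i) $h_{\phi,w}=E_{\phi,w}(h_{\phi,w})$ a.e. $[\mu_w]$; (ii) $C_{\phi,w}$ is spectrally weakly centered.
   Context: $(X,\mathscr A,\mu)$ is a $\sigma$-finite measure space, $\phi\colon X\to X$ and $w\colon X\to\mathbb C$ are $\mathscr A$-measurable, $\mu_w(\sigma)=\int_\sigma|w|^2\,d\mu$ for $\sigma\in\mathscr A$, and the measure $\mu_w\circ\phi^{-1}$, $\sigma\mapsto\mu_w(\phi^{-1}(\sigma))$, is assumed absolutely continuous with respect to $\mu$. The (possibly unbounded, always closed) weighted composition operator $C_{\phi,w}$ in the complex Hilbert space $L^2(\mu)$ has domain $\{f\in L^2(\mu): w\cdot(f\circ\phi)\in L^2(\mu)\}$ and acts by $C_{\phi,w}f=w\cdot(f\circ\phi)$. The function $h_{\phi,w}\colon X\to[0,\infty]$ is the Radon-Nikodym derivative, i.e. $\mu_w(\phi^{-1}(\Delta))=\int_\Delta h_{\phi,w}\,d\mu$ for all $\Delta\in\mathscr A$. $E_{\phi,w}(f)$ denotes the conditional expectation of an $\mathscr A$-measurable $f\colon X\to[0,\infty]$ with respect to the $\sigma$-algebra $\phi^{-1}(\mathscr A)$ and the measure $\mu_w$: the (up to $\mu_w$-null sets) unique $\phi^{-1}(\mathscr A)$-measurable function with $\int_\Delta f\,d\mu_w=\int_\Delta E_{\phi,w}(f)\,d\mu_w$ for all $\Delta\in\phi^{-1}(\mathscr A)$ (it exists whenever $C_{\phi,w}$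 is densely defined). A closed densely defined operator $T$ in a Hilbert space is spectrally weakly centered if the spectral measures $E_{T^*T}$ and $E_{TT^*}$ of the selfadjoint operators $T^*T$ and $TT^*$ commute: $E_{T^*T}(\sigma)E_{TT^*}(\omega)=E_{TT^*}(\omega)E_{T^*T}(\sigma)$ for all Borel sets $\sigma,\omega\subseteq\mathbb C$. *)

theory Defs
  imports "HOL-Probability.Probability"
begin

section \<open>The Hilbert space of square-integrable functions\<close>

text \<open>
  Elements of the complex Hilbert space $L^2(M)$ are represented by square-integrable functions,
  two functions representing the same element iff they agree almost everywhere.
\<close>

definition L2 :: "'a measure \<Rightarrow> ('a \<Rightarrow> complex) set" where
  "L2 M = {f \<in> borel_measurable M. integrable M (\<lambda>x. (cmod (f x))\<^sup>2)}"

definition L2_inner :: "'a measure \<Rightarrow> ('a \<Rightarrow> complex) \<Rightarrow> ('a \<Rightarrow> complex) \<Rightarrow> complex" where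
  "L2_inner M f g = (LINT x|M. f x * cnj (g x))"

definition L2_norm :: "'a measure \<Rightarrow> ('a \<Rightarrow> complex) \<Rightarrow> real" where
  "L2_norm M f = sqrt (LINT x|M. (cmod (f x))\<^sup>2)"

section \<open>Unbounded operators\<close>

text \<open>
  An operator is given by its graph, a set of pairs of representatives that contains with a pair
  every pair equal to it almost everywhere. Consequently operators are equal iff their
  graphs are, the domain is \<^const>\<open>Domain\<close>, and the composition \<open>S T\<close> (first \<open>T\<close>, then \<open>S\<close>) is
  the relational composition \<open>T O S\<close> with its natural domain.
\<close>

type_synonym 'a L2_op = "(('a \<Rightarrow> complex) \<times> ('a \<Rightarrow> complex)) set"

definition densely_defined :: "'a measure \<Rightarrow> 'a L2_op \<Rightarrow> bool" where
  "densely_defined M T \<longleftrightarrow>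
     (\<forall>f\<in>L2 M. \<forall>\<epsilon>>0. \<exists>g\<in>Domain T. L2_norm M (\<lambda>x. f x - g x) < \<epsilon>)"

definition linear_operator :: "'a measure \<Rightarrow> 'a L2_op \<Rightarrow> bool" where
  "linear_operator M T \<longleftrightarrow>
     T \<noteq> {} \<and> T \<subseteq> L2 M \<times> L2 M \<and>
     (\<forall>f g f' g' a b. (f, g) \<in> T \<longrightarrow> (f', g') \<in> T \<longrightarrow>
        (\<lambda>x. a * f x + b * f' x, \<lambda>x. a * g x + b * g' x) \<in> T) \<and>
     (\<forall>f g g'. (f, g) \<in> T \<longrightarrow> (f, g') \<in> T \<longrightarrow> (AE x in M. g x = g' x))"

text \<open>
  Constant sequences show that a closed graph contains with a pair every pair of
  square-integrable functions equal to it almost everywhere.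
\<close>

definition closed_operator :: "'a measure \<Rightarrow> 'a L2_op \<Rightarrow> bool" where
  "closed_operator M T \<longleftrightarrow>
     linear_operator M T \<and>
     (\<forall>F G f g. (\<forall>n::nat. (F n, G n) \<in> T) \<longrightarrow> f \<in> L2 M \<longrightarrow> g \<in> L2 M \<longrightarrow>
        (\<lambda>n. L2_norm M (\<lambda>x. F n x - f x)) \<longlonglongrightarrow> 0 \<longrightarrow>
        (\<lambda>n. L2_norm M (\<lambda>x. G n x - g x)) \<longlonglongrightarrow> 0 \<longrightarrow>
        (f, g) \<in> T)"

definition L2_adjoint :: "'a measure \<Rightarrow> 'a L2_op \<Rightarrow> 'a L2_op" where
  "L2_adjoint M T =
     {(g, k). g \<in> L2 M \<and> k \<in> L2 M \<and> (\<forall>(f, f')\<in>T. L2_inner M f' g = L2_inner M f k)}"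

section \<open>Spectral measures\<close>

text \<open>
  Projections are everywhere defined and are therefore given as functions on representatives.
  Symmetry makes them respect equality almost everywhere.
\<close>

definition orthogonal_projection :: "'a measure \<Rightarrow> (('a \<Rightarrow> complex) \<Rightarrow> ('a \<Rightarrow> complex)) \<Rightarrow> bool" where
  "orthogonal_projection M P \<longleftrightarrow>
     (\<forall>f\<in>L2 M. P f \<in> L2 M) \<and>
     (\<forall>f\<in>L2 M. \<forall>g\<in>L2 M. \<forall>a b.
        AE x in M. P (\<lambda>x. a * f x + b * g x) x = a * P f x + b * P g x) \<and>
     (\<forall>f\<in>L2 M. AE x in M. P (P f) x = P f x) \<and>
     (\<forall>f\<in>L2 M. \<forall>g\<in>L2 M. L2_inner M (P f) g = L2_inner M f (P g))"

type_synonym 'a L2_pvm = "complex set \<Rightarrow> ('a \<Rightarrow> complex) \<Rightarrow> ('a \<Rightarrow> complex)"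

text \<open>\<open>\<sigma> \<mapsto> \<langle>E(\<sigma>)f, f\<rangle>\<close>, which is real and nonnegative when the \<open>E(\<sigma>)\<close> are orthogonal projections.\<close>

definition pvm_scalar :: "'a measure \<Rightarrow> 'a L2_pvm \<Rightarrow> ('a \<Rightarrow> complex) \<Rightarrow> complex set \<Rightarrow> ennreal" where
  "pvm_scalar M E f \<sigma> = ennreal (Re (L2_inner M (E \<sigma> f) f))"

definition spectral_measure :: "'a measure \<Rightarrow> 'a L2_pvm \<Rightarrow> bool" where
  "spectral_measure M E \<longleftrightarrow>
     (\<forall>\<sigma>\<in>sets borel. orthogonal_projection M (E \<sigma>)) \<and>
     (\<forall>f\<in>L2 M. AE x in M. E UNIV f x = f x) \<and>
     (\<forall>f\<in>L2 M. measure_space UNIV (sets borel) (pvm_scalar M E f))"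

definition pvm_measure :: "'a measure \<Rightarrow> 'a L2_pvm \<Rightarrow> ('a \<Rightarrow> complex) \<Rightarrow> complex measure" where
  "pvm_measure M E f = measure_of UNIV (sets borel) (pvm_scalar M E f)"

text \<open>
  The operator \<open>\<integral> z dE(z)\<close>: its domain consists of the \<open>f\<close> with \<open>\<integral> |z|\<^sup>2 d\<langle>E(z)f, f\<rangle> < \<infinity>\<close>, and
  \<open>\<langle>(\<integral> z dE(z)) f, k\<rangle> = \<integral> z d\<langle>E(z)f, k\<rangle>\<close> for \<open>k\<close> in this (dense) domain. The complex measure
  \<open>\<langle>E(\<cdot>)f, k\<rangle>\<close> is written by polarization as the sum of the measures
  \<open>\<langle>E(\<cdot>)(f + \<i>^j k), f + \<i>^j k\<rangle>\<close> with coefficients \<open>\<i>^j / 4\<close>, for \<open>j < 4\<close>.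
\<close>

definition pvm_domain :: "'a measure \<Rightarrow> 'a L2_pvm \<Rightarrow> ('a \<Rightarrow> complex) set" where
  "pvm_domain M E = {f \<in> L2 M. (\<integral>\<^sup>+z. ennreal ((cmod z)\<^sup>2) \<partial>pvm_measure M E f) < \<infinity>}"

definition pvm_integral :: "'a measure \<Rightarrow> 'a L2_pvm \<Rightarrow> 'a L2_op" where
  "pvm_integral M E =
     {(f, g). f \<in> pvm_domain M E \<and> g \<in> L2 M \<and>
        (\<forall>k\<in>pvm_domain M E. L2_inner M g k =
           (\<Sum>j<4. \<i> ^ j * (LINT z|pvm_measure M E (\<lambda>x. f x + \<i> ^ j * k x). z)) / 4)}"

definition is_spectral_measure_of :: "'a measure \<Rightarrow> 'a L2_pvm \<Rightarrow> 'a L2_op \<Rightarrow> bool" where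
  "is_spectral_measure_of M E A \<longleftrightarrow> spectral_measure M E \<and> pvm_integral M E = A"

text \<open>
  The spectral measures of the selfadjoint operators \<open>T\<^sup>* T\<close> and \<open>T T\<^sup>*\<close> exist and are unique (up
  to equality almost everywhere of the values) by the spectral theorem, so that the
  existential quantifier merely names them.
\<close>

definition spectrally_weakly_centered :: "'a measure \<Rightarrow> 'a L2_op \<Rightarrow> bool" where
  "spectrally_weakly_centered M T \<longleftrightarrow>
     closed_operator M T \<and> densely_defined M T \<and>
     (\<exists>E F. is_spectral_measure_of M E (T O L2_adjoint M T) \<and>
            is_spectral_measure_of M F (L2_adjoint M T O T) \<and>
            (\<forall>\<sigma>\<in>sets borel. \<forall>\<omega>\<in>sets borel. \<forall>f\<in>L2 M.
               AE x in M. E \<sigma> (F \<omega> f) x = F \<omega> (E \<sigma> f) x))"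

section \<open>Weighted composition operators\<close>

definition weighted_measure :: "'a measure \<Rightarrow> ('a \<Rightarrow> complex) \<Rightarrow> 'a measure" where
  "weighted_measure M w = density M (\<lambda>x. ennreal ((cmod (w x))\<^sup>2))"

text \<open>
  If \<open>distr (weighted_measure M w) M \<phi>\<close> is absolutely continuous with respect to \<open>M\<close>, then
  \<open>w (f \<circ> \<phi>)\<close> depends, up to equality almost everywhere, only on the class of \<open>f\<close>.
\<close>

definition weighted_comp_op :: "'a measure \<Rightarrow> ('a \<Rightarrow> 'a) \<Rightarrow> ('a \<Rightarrow> complex) \<Rightarrow> 'a L2_op" where
  "weighted_comp_op M \<phi> w =
     {(f, g). f \<in> L2 M \<and> (\<lambda>x. w x * f (\<phi> x)) \<in> L2 M \<and>
              g \<in> L2 M \<and> (AE x in M. g x = w x * f (\<phi> x))}"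

definition h_wco :: "'a measure \<Rightarrow> ('a \<Rightarrow> 'a) \<Rightarrow> ('a \<Rightarrow> complex) \<Rightarrow> 'a \<Rightarrow> ennreal" where
  "h_wco M \<phi> w = RN_deriv M (distr (weighted_measure M w) M \<phi>)"

text \<open>\<^term>\<open>vimage_algebra (space M) \<phi> M\<close> is the $\sigma$-algebra of preimages of measurable sets under \<open>\<phi>\<close>.\<close>

definition E_wco :: "'a measure \<Rightarrow> ('a \<Rightarrow> 'a) \<Rightarrow> ('a \<Rightarrow> complex) \<Rightarrow> ('a \<Rightarrow> ennreal) \<Rightarrow> 'a \<Rightarrow> ennreal" where
  "E_wco M \<phi> w = nn_cond_exp (weighted_measure M w) (vimage_algebra (space M) \<phi> M)"

end

theory Submission
  imports Defs
begin

text \<open>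
  Write \<open>T\<close> for the operator, \<open>h\<close> for the Radon-Nikodym derivative (finite almost everywhere because
  \<open>T\<close> is densely defined) and \<open>N = |w|\<^sup>2 M\<close>. Since \<open>\<integral> |w|\<^sup>2 (g \<circ> \<phi>) = \<integral> h g\<close>, the operator \<open>T\<^sup>* T\<close> is the
  multiplication by \<open>h\<close>, and its spectral measure consists of the multiplications by \<open>1\<^sub>\<sigma> \<circ> h\<close>. Let \<open>P\<close> be
  the orthogonal projection onto the closed subspace of all square-integrable \<open>w (v \<circ> \<phi>)\<close>. Then
  \<open>T T\<^sup>* = (h \<circ> \<phi>) P\<close>, and since \<open>h \<circ> \<phi> > 0\<close> where \<open>w \<noteq> 0\<close>, the kernel of \<open>T T\<^sup>*\<close> is the range of \<open>1 - P\<close>.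
  Both operators have the form \<open>q P\<close> with a real function \<open>q\<close> whose Borel functions leave the range of
  the projection invariant, and lemma \<open>pvm_integral_compressed\<close> exhibits the spectral measure of such
  an operator: \<open>\<sigma> \<mapsto> (1\<^sub>\<sigma> \<circ> q) P + 1\<^sub>\<sigma>(0) (1 - P)\<close>.

  That \<open>h\<close> is its own conditional expectation means that \<open>h = s \<circ> \<phi>\<close> almost everywhere with respect to \<open>N\<close> for some measurable \<open>s\<close>
  (lemma \<open>h_eq_cond_exp_iff\<close>). In this form the theorem is a statement about \<open>P\<close>.

  If \<open>h = s \<circ> \<phi>\<close>, then multiplication by \<open>1\<^sub>\<sigma> \<circ> h\<close> maps \<open>w (v \<circ> \<phi>)\<close> to \<open>w (((1\<^sub>\<sigma> \<circ> s) v) \<circ> \<phi>)\<close>; it leaves the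
  range of \<open>P\<close> invariant and so commutes with \<open>P\<close>, hence with the whole spectral measure of
  \<open>T T\<^sup>*\<close>.

  Conversely let \<open>E\<close> and \<open>F\<close> be commuting spectral measures of \<open>T\<^sup>* T\<close> and \<open>T T\<^sup>*\<close>. Two facts about them
  give the claim: \<open>F({0})\<close> is the projection onto the kernel of \<open>T T\<^sup>*\<close>, that is \<open>1 - P\<close> (lemma
  \<open>null_projection\<close>), and a projection commuting with all \<open>E(\<sigma>)\<close> commutes with \<open>\<integral> z dE(z)\<close> (lemma
  \<open>pvm_integral_commute\<close>). Hence \<open>P (h f) = h P f\<close> on the domain of \<open>T\<^sup>* T\<close>. For \<open>f = w u\<close> with \<open>u > 0\<close>, both sides
  have the form \<open>w (v \<circ> \<phi>)\<close>: writing \<open>P f = w (v \<circ> \<phi>)\<close> and \<open>P (h f) = w (v' \<circ> \<phi>)\<close> gives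
  \<open>h = (v' / v) \<circ> \<phi>\<close> where \<open>w \<noteq> 0\<close>, since positivity of \<open>u\<close> prevents \<open>v \<circ> \<phi>\<close> from vanishing there.
\<close>

section \<open>Square-integrable functions\<close>


lemma L2_measurable: "f \<in> L2 M \<Longrightarrow> f \<in> borel_measurable M"
  by (simp add: L2_def)

lemma L2_integrable: "f \<in> L2 M \<Longrightarrow> integrable M (\<lambda>x. (cmod (f x))\<^sup>2)"
  by (simp add: L2_def)

lemma L2I: "f \<in> borel_measurable M \<Longrightarrow> integrable M (\<lambda>x. (cmod (f x))\<^sup>2) \<Longrightarrow> f \<in> L2 M"
  by (simp add: L2_def)

lemma L2_iff_nn:
  assumes "f \<in> borel_measurable M"
  shows "f \<in> L2 M \<longleftrightarrow> (\<integral>\<^sup>+x. ennreal ((cmod (f x))\<^sup>2) \<partial>M) < \<infinity>"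
  using assms by (auto simp: L2_def integrable_iff_bounded)

lemma cmod_add_square_le: "(cmod (a + b))\<^sup>2 \<le> 2 * (cmod a)\<^sup>2 + 2 * (cmod b)\<^sup>2"
proof -
  have "(cmod (a + b))\<^sup>2 \<le> (cmod a + cmod b)\<^sup>2"
    by (intro power_mono norm_triangle_ineq) auto
  also have "\<dots> \<le> 2 * (cmod a)\<^sup>2 + 2 * (cmod b)\<^sup>2"
    using sum_squares_bound[of "cmod a" "cmod b"] by (simp add: power2_sum)
  finally show ?thesis .
qed

lemma L2_bound:
  assumes "f \<in> L2 M" "g \<in> borel_measurable M" "AE x in M. cmod (g x) \<le> c * cmod (f x)"
  shows "g \<in> L2 M"
proof (rule L2I)
  have "AE x in M. norm ((cmod (g x))\<^sup>2) \<le> norm (c\<^sup>2 * (cmod (f x))\<^sup>2)"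
    using assms(3)
  proof eventually_elim
    case (elim x)
    then have "(cmod (g x))\<^sup>2 \<le> (c * cmod (f x))\<^sup>2" by (intro power_mono) auto
    then show ?case by (simp add: power_mult_distrib)
  qed
  then show "integrable M (\<lambda>x. (cmod (g x))\<^sup>2)"
  proof (rule Bochner_Integration.integrable_bound[rotated 2])
    show "integrable M (\<lambda>x. c\<^sup>2 * (cmod (f x))\<^sup>2)"
      by (intro integrable_mult_right L2_integrable[OF assms(1)])
    show "(\<lambda>x. (cmod (g x))\<^sup>2) \<in> borel_measurable M"
      using assms(2) by measurable
  qed
qed (use assms in auto)

lemma L2_cong_AE:
  assumes "f \<in> L2 M" "g \<in> borel_measurable M" "AE x in M. g x = f x"
  shows "g \<in> L2 M"
  by (rule L2_bound[OF assms(1,2), of 1]) (use assms(3) in auto)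

lemma L2_add: assumes "f \<in> L2 M" "g \<in> L2 M" shows "(\<lambda>x. f x + g x) \<in> L2 M"
proof (rule L2I)
  have m [measurable]: "f \<in> borel_measurable M" "g \<in> borel_measurable M"
    using assms by (auto simp: L2_def)
  show "integrable M (\<lambda>x. (cmod (f x + g x))\<^sup>2)"
    by (rule Bochner_Integration.integrable_bound[of M "\<lambda>x. 2 * (cmod (f x))\<^sup>2 + 2 * (cmod (g x))\<^sup>2"])
       (use assms cmod_add_square_le in \<open>auto simp: L2_def\<close>)
  show "(\<lambda>x. f x + g x) \<in> borel_measurable M" by measurable
qed

lemma L2_scale: assumes "f \<in> L2 M" shows "(\<lambda>x. a * f x) \<in> L2 M"
  by (rule L2_bound[OF assms, of _ "cmod a"]) (use assms in \<open>auto simp: norm_mult L2_def\<close>)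

lemma L2_diff: assumes "f \<in> L2 M" "g \<in> L2 M" shows "(\<lambda>x. f x - g x) \<in> L2 M"
  using L2_add[OF assms(1) L2_scale[OF assms(2), of "-1"]] by simp

lemma L2_zero [simp]: "(\<lambda>x. 0) \<in> L2 M"
  by (simp add: L2_def)

lemma L2_lin: "f \<in> L2 M \<Longrightarrow> g \<in> L2 M \<Longrightarrow> (\<lambda>x. a * f x + b * g x) \<in> L2 M"
  by (intro L2_add L2_scale)

lemma L2_mult_bounded:
  assumes "f \<in> L2 M" "s \<in> borel_measurable M" "\<And>x. cmod (s x) \<le> c"
  shows "(\<lambda>x. s x * f x) \<in> L2 M"
  by (rule L2_bound[OF assms(1), of _ c])
     (use assms in \<open>auto simp: norm_mult L2_def intro!: mult_right_mono\<close>)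

lemma borel_measurable_cnj [measurable]:
  "f \<in> borel_measurable M \<Longrightarrow> (\<lambda>x. cnj (f x)) \<in> borel_measurable M"
  by (rule measurable_compose[OF _ borel_measurable_continuous_onI]) (auto intro!: continuous_intros)

lemma L2_integrable_inner:
  assumes "f \<in> L2 M" "g \<in> L2 M"
  shows "integrable M (\<lambda>x. f x * cnj (g x))"
proof -
  have m [measurable]: "f \<in> borel_measurable M" "g \<in> borel_measurable M"
    using assms by (auto simp: L2_def)
  have b: "norm (f x * cnj (g x)) \<le> norm ((cmod (f x))\<^sup>2 + (cmod (g x))\<^sup>2)" for x
  proof -
    have "2 * cmod (f x) * cmod (g x) \<le> (cmod (f x))\<^sup>2 + (cmod (g x))\<^sup>2"
      by (rule sum_squares_bound)
    moreover have "0 \<le> cmod (f x) * cmod (g x)" by simp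
    ultimately have "cmod (f x) * cmod (g x) \<le> (cmod (f x))\<^sup>2 + (cmod (g x))\<^sup>2" by linarith
    then show ?thesis by (simp add: norm_mult)
  qed
  show ?thesis
  proof (rule Bochner_Integration.integrable_bound)
    show "integrable M (\<lambda>x. (cmod (f x))\<^sup>2 + (cmod (g x))\<^sup>2)"
      by (intro Bochner_Integration.integrable_add L2_integrable assms)
  qed (use b m in \<open>auto intro!: AE_I2\<close>)
qed

lemma L2_inner_lin_left:
  assumes "f \<in> L2 M" "g \<in> L2 M" "k \<in> L2 M"
  shows "L2_inner M (\<lambda>x. a * f x + b * g x) k = a * L2_inner M f k + b * L2_inner M g k"
  using L2_integrable_inner[OF assms(1,3)] L2_integrable_inner[OF assms(2,3)]
  by (simp add: L2_inner_def ring_distribs mult.assoc)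

lemma L2_inner_cnj: "L2_inner M g f = cnj (L2_inner M f g)"
proof -
  have "cnj (L2_inner M f g) = (LINT x|M. cnj (f x * cnj (g x)))"
    unfolding L2_inner_def by (rule Bochner_Integration.integral_cnj[symmetric])
  then show ?thesis by (simp add: L2_inner_def mult.commute)
qed

lemma L2_inner_lin_right:
  assumes "f \<in> L2 M" "g \<in> L2 M" "k \<in> L2 M"
  shows "L2_inner M k (\<lambda>x. a * f x + b * g x) = cnj a * L2_inner M k f + cnj b * L2_inner M k g"
proof -
  have "L2_inner M k (\<lambda>x. a * f x + b * g x) = cnj (L2_inner M (\<lambda>x. a * f x + b * g x) k)"
    by (rule L2_inner_cnj)
  also have "\<dots> = cnj a * cnj (L2_inner M f k) + cnj b * cnj (L2_inner M g k)"
    by (simp add: L2_inner_lin_left[OF assms])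
  also have "\<dots> = cnj a * L2_inner M k f + cnj b * L2_inner M k g"
    by (simp flip: L2_inner_cnj)
  finally show ?thesis .
qed

lemma L2_inner_diff_left:
  assumes "f \<in> L2 M" "g \<in> L2 M" "k \<in> L2 M"
  shows "L2_inner M (\<lambda>x. f x - g x) k = L2_inner M f k - L2_inner M g k"
  using L2_inner_lin_left[OF assms, of 1 "-1"] by simp

lemma L2_inner_diff_right:
  assumes "f \<in> L2 M" "g \<in> L2 M" "k \<in> L2 M"
  shows "L2_inner M k (\<lambda>x. f x - g x) = L2_inner M k f - L2_inner M k g"
  using L2_inner_lin_right[OF assms, of 1 "-1"] by simp

lemma L2_inner_zero [simp]: "L2_inner M (\<lambda>x. 0) k = 0" "L2_inner M k (\<lambda>x. 0) = 0"
  by (auto simp: L2_inner_def)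

lemma L2_inner_cong:
  assumes "f \<in> borel_measurable M" "f' \<in> borel_measurable M" "g \<in> borel_measurable M"
    "g' \<in> borel_measurable M" "AE x in M. f x = f' x" "AE x in M. g x = g' x"
  shows "L2_inner M f g = L2_inner M f' g'"
  unfolding L2_inner_def
  by (intro integral_cong_AE) (use assms in \<open>auto\<close>)

lemma L2_inner_cong_left:
  assumes "f \<in> L2 M" "f' \<in> L2 M" "g \<in> L2 M" "AE x in M. f x = f' x"
  shows "L2_inner M f g = L2_inner M f' g"
  by (intro L2_inner_cong) (use assms in \<open>auto simp: L2_def\<close>)

lemma L2_inner_cong_right:
  assumes "f \<in> L2 M" "f' \<in> L2 M" "g \<in> L2 M" "AE x in M. f x = f' x"
  shows "L2_inner M g f = L2_inner M g f'"
  by (intro L2_inner_cong) (use assms in \<open>auto simp: L2_def\<close>)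

lemma L2_inner_self: "L2_inner M f f = complex_of_real (LINT x|M. (cmod (f x))\<^sup>2)"
  unfolding L2_inner_def integral_complex_of_real[symmetric] complex_norm_square ..

lemma L2_inner_self_eq_0D:
  assumes "f \<in> L2 M" "L2_inner M f f = 0"
  shows "AE x in M. f x = 0"
proof -
  have "(LINT x|M. (cmod (f x))\<^sup>2) = 0"
    using assms(2) by (simp add: L2_inner_self)
  then have "AE x in M. (cmod (f x))\<^sup>2 = 0"
    using integral_nonneg_eq_0_iff_AE[OF L2_integrable[OF assms(1)]] by simp
  then show ?thesis by simp
qed

text \<open>Equality almost everywhere is tested by inner products; this turns most arguments about
  classes of functions into equational reasoning about complex numbers.\<close>

lemma L2_eqI:
  assumes "f \<in> L2 M" "g \<in> L2 M" "\<And>k. k \<in> L2 M \<Longrightarrow> L2_inner M f k = L2_inner M g k"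
  shows "AE x in M. f x = g x"
proof -
  have d: "(\<lambda>x. f x - g x) \<in> L2 M" using assms by (simp add: L2_diff)
  have "L2_inner M (\<lambda>x. f x - g x) (\<lambda>x. f x - g x) = 0"
    using assms d by (simp add: L2_inner_diff_left)
  from L2_inner_self_eq_0D[OF d this] show ?thesis by simp
qed

section \<open>Orthogonal projections\<close>

lemma orthogonal_projectionD:
  assumes "orthogonal_projection M P"
  shows orthogonal_projection_L2: "f \<in> L2 M \<Longrightarrow> P f \<in> L2 M"
    and orthogonal_projection_lin: "f \<in> L2 M \<Longrightarrow> g \<in> L2 M \<Longrightarrow>
      AE x in M. P (\<lambda>x. a * f x + b * g x) x = a * P f x + b * P g x"
    and orthogonal_projection_idem: "f \<in> L2 M \<Longrightarrow> AE x in M. P (P f) x = P f x"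
    and orthogonal_projection_sym: "f \<in> L2 M \<Longrightarrow> g \<in> L2 M \<Longrightarrow>
      L2_inner M (P f) g = L2_inner M f (P g)"
proof -
  note D = assms[unfolded orthogonal_projection_def]
  show "f \<in> L2 M \<Longrightarrow> P f \<in> L2 M"
    by (rule D[THEN conjunct1, rule_format])
  show "f \<in> L2 M \<Longrightarrow> g \<in> L2 M \<Longrightarrow>
      AE x in M. P (\<lambda>x. a * f x + b * g x) x = a * P f x + b * P g x"
    by (rule D[THEN conjunct2, THEN conjunct1, rule_format])
  show "f \<in> L2 M \<Longrightarrow> AE x in M. P (P f) x = P f x"
    by (rule D[THEN conjunct2, THEN conjunct2, THEN conjunct1, rule_format])
  show "f \<in> L2 M \<Longrightarrow> g \<in> L2 M \<Longrightarrow> L2_inner M (P f) g = L2_inner M f (P g)"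
    by (rule D[THEN conjunct2, THEN conjunct2, THEN conjunct2, rule_format])
qed

lemma orthogonal_projection_inner:
  assumes "orthogonal_projection M P" "f \<in> L2 M" "g \<in> L2 M"
  shows "L2_inner M (P f) (P g) = L2_inner M (P f) g"
proof -
  note L = orthogonal_projection_L2[OF assms(1)]
  have "L2_inner M (P f) (P g) = L2_inner M (P (P f)) g"
    by (rule orthogonal_projection_sym[OF assms(1) L[OF assms(2)] assms(3), symmetric])
  also have "\<dots> = L2_inner M (P f) g"
    by (rule L2_inner_cong_left[OF L[OF L[OF assms(2)]] L[OF assms(2)] assms(3)
          orthogonal_projection_idem[OF assms(1,2)]])
  finally show ?thesis .
qed

lemma orthogonal_projection_diff:
  assumes "orthogonal_projection M P" "f \<in> L2 M" "g \<in> L2 M"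
  shows "AE x in M. P (\<lambda>x. f x - g x) x = P f x - P g x"
  using orthogonal_projection_lin[OF assms, of 1 "-1"] by simp

lemma orthogonal_projection_cong:
  assumes "orthogonal_projection M P" "f \<in> L2 M" "g \<in> L2 M" "AE x in M. f x = g x"
  shows "AE x in M. P f x = P g x"
proof (rule L2_eqI)
  note L = orthogonal_projection_L2[OF assms(1)]
  show "P f \<in> L2 M" "P g \<in> L2 M" by (rule L[OF assms(2)], rule L[OF assms(3)])
  fix k assume k: "k \<in> L2 M"
  show "L2_inner M (P f) k = L2_inner M (P g) k"
    unfolding orthogonal_projection_sym[OF assms(1,2) k] orthogonal_projection_sym[OF assms(1,3) k]
    by (rule L2_inner_cong_left[OF assms(2,3) L[OF k] assms(4)])
qed

section \<open>Integrals against sums of measures\<close>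

text \<open>Sums of measures are handled without forming the sum: setwise inequalities between them pass to
  integrals of simple functions by linearity and to monotone limits because the suprema of
  increasing sequences add up.\<close>

lemma nn_integral_add_measures_mono:
  assumes s [measurable_cong]: "sets \<nu>1 = sets K" "sets \<nu>2 = sets K" "sets \<mu>1 = sets K" "sets \<mu>2 = sets K"
    and le: "\<And>A. A \<in> sets K \<Longrightarrow> emeasure \<nu>1 A + emeasure \<nu>2 A \<le> emeasure \<mu>1 A + emeasure \<mu>2 A"
    and f: "f \<in> borel_measurable K"
  shows "nn_integral \<nu>1 f + nn_integral \<nu>2 f \<le> nn_integral \<mu>1 f + nn_integral \<mu>2 f"
  using f
proof (induction rule: borel_measurable_induct)
  case (cong f g)
  have "nn_integral L f = nn_integral L g" if "sets L = sets K" for L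
    using cong(3) sets_eq_imp_space_eq[OF that] by (intro nn_integral_cong) simp
  then show ?case using cong(4) s by simp
next
  case (set A)
  then show ?case using le s by simp
next
  case (mult u c)
  have "nn_integral L (\<lambda>x. c * u x) = c * nn_integral L u" if "sets L = sets K" for L
    using mult(2) that by (intro nn_integral_cmult) (simp cong: measurable_cong_sets)
  with mult s have "c * (nn_integral \<nu>1 u + nn_integral \<nu>2 u) \<le> c * (nn_integral \<mu>1 u + nn_integral \<mu>2 u)"
    by (intro mult_left_mono) auto
  with \<open>\<And>L. sets L = sets K \<Longrightarrow> nn_integral L (\<lambda>x. c * u x) = c * nn_integral L u\<close> s
  show ?case by (simp add: distrib_left)
next
  case (add u v)
  have *: "nn_integral L (\<lambda>x. v x + u x) = nn_integral L v + nn_integral L u" if "sets L = sets K" for L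
    using add that by (intro nn_integral_add) (simp_all cong: measurable_cong_sets)
  have "nn_integral \<nu>1 v + nn_integral \<nu>1 u + (nn_integral \<nu>2 v + nn_integral \<nu>2 u)
      = (nn_integral \<nu>1 v + nn_integral \<nu>2 v) + (nn_integral \<nu>1 u + nn_integral \<nu>2 u)"
    by (simp add: ac_simps)
  also have "\<dots> \<le> (nn_integral \<mu>1 v + nn_integral \<mu>2 v) + (nn_integral \<mu>1 u + nn_integral \<mu>2 u)"
    by (rule add_mono[OF add.IH(2) add.IH(1)])
  also have "\<dots> = nn_integral \<mu>1 v + nn_integral \<mu>1 u + (nn_integral \<mu>2 v + nn_integral \<mu>2 u)"
    by (simp add: ac_simps)
  finally show ?case using s * by simp
next
  case (seq U)
  have *: "nn_integral L (SUP i. U i) = (SUP i. nn_integral L (U i))" if "sets L = sets K" for L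
  proof -
    have "(SUP i. U i) = (\<lambda>x. SUP i. U i x)" by (simp add: fun_eq_iff image_comp)
    then show ?thesis
      using nn_integral_monotone_convergence_SUP[of U L] seq that
      by (simp add: image_comp cong: measurable_cong_sets)
  qed
  have i: "incseq (\<lambda>i. nn_integral L (U i))" for L
    using seq by (auto simp: incseq_def le_fun_def intro!: nn_integral_mono)
  have "(SUP i. nn_integral \<nu>1 (U i)) + (SUP i. nn_integral \<nu>2 (U i))
      = (SUP i. nn_integral \<nu>1 (U i) + nn_integral \<nu>2 (U i))"
    by (rule ennreal_SUP_add[symmetric]) (rule i)+
  also have "\<dots> \<le> (SUP i. nn_integral \<mu>1 (U i) + nn_integral \<mu>2 (U i))"
    by (rule SUP_mono) (use seq.IH in blast)
  also have "\<dots> = (SUP i. nn_integral \<mu>1 (U i)) + (SUP i. nn_integral \<mu>2 (U i))"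
    by (rule ennreal_SUP_add) (rule i)+
  finally show ?case by (simp only: *[OF s(1)] *[OF s(2)] *[OF s(3)] *[OF s(4)])
qed

lemma nn_integral_add_measures_eq:
  assumes "sets \<nu>1 = sets K" "sets \<nu>2 = sets K" "sets \<mu>1 = sets K" "sets \<mu>2 = sets K"
    and "\<And>A. A \<in> sets K \<Longrightarrow> emeasure \<nu>1 A + emeasure \<nu>2 A = emeasure \<mu>1 A + emeasure \<mu>2 A"
    and "f \<in> borel_measurable K"
  shows "nn_integral \<nu>1 f + nn_integral \<nu>2 f = nn_integral \<mu>1 f + nn_integral \<mu>2 f"
  by (intro antisym nn_integral_add_measures_mono[of _ K]) (use assms in simp_all)

lemma integral_add_measures_eq_real:
  fixes f :: "'a \<Rightarrow> real"
  assumes s: "sets \<nu>1 = sets K" "sets \<nu>2 = sets K" "sets \<mu>1 = sets K" "sets \<mu>2 = sets K"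
    and eq: "\<And>A. A \<in> sets K \<Longrightarrow> emeasure \<nu>1 A + emeasure \<nu>2 A = emeasure \<mu>1 A + emeasure \<mu>2 A"
    and i: "integrable \<nu>1 f" "integrable \<nu>2 f" "integrable \<mu>1 f" "integrable \<mu>2 f"
  shows "integral\<^sup>L \<nu>1 f + integral\<^sup>L \<nu>2 f = integral\<^sup>L \<mu>1 f + integral\<^sup>L \<mu>2 f"
proof -
  have m [measurable]: "f \<in> borel_measurable K"
    using borel_measurable_integrable[OF i(1)] s(1) by (simp cong: measurable_cong_sets)
  have fin: "(\<integral>\<^sup>+x. ennreal (f x) \<partial>L) < \<infinity>" "(\<integral>\<^sup>+x. ennreal (- f x) \<partial>L) < \<infinity>" if "integrable L f" for L
    using that by (auto simp: real_integrable_def less_top)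
  have *: "enn2real (\<integral>\<^sup>+x. ennreal (g x) \<partial>\<nu>1) + enn2real (\<integral>\<^sup>+x. ennreal (g x) \<partial>\<nu>2)
     = enn2real (\<integral>\<^sup>+x. ennreal (g x) \<partial>\<mu>1) + enn2real (\<integral>\<^sup>+x. ennreal (g x) \<partial>\<mu>2)"
    if g: "g = f \<or> g = (\<lambda>x. - f x)" for g
  proof -
    have f: "(\<integral>\<^sup>+x. ennreal (g x) \<partial>L) < top" if "integrable L f" for L
      using fin[OF that] g by auto
    have gm: "(\<lambda>x. ennreal (g x)) \<in> borel_measurable K" using g by auto
    show ?thesis
      using nn_integral_add_measures_eq[OF s eq gm] f[OF i(1)] f[OF i(2)] f[OF i(3)] f[OF i(4)]
      by (metis enn2real_plus)
  qed
  show ?thesis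
    unfolding real_lebesgue_integral_def[OF i(1)] real_lebesgue_integral_def[OF i(2)]
      real_lebesgue_integral_def[OF i(3)] real_lebesgue_integral_def[OF i(4)]
    using *[of f] *[of "\<lambda>x. - f x"] by simp
qed

lemma integral_add_measures_eq:
  fixes f :: "'a \<Rightarrow> complex"
  assumes s: "sets \<nu>1 = sets K" "sets \<nu>2 = sets K" "sets \<mu>1 = sets K" "sets \<mu>2 = sets K"
    and eq: "\<And>A. A \<in> sets K \<Longrightarrow> emeasure \<nu>1 A + emeasure \<nu>2 A = emeasure \<mu>1 A + emeasure \<mu>2 A"
    and i: "integrable \<nu>1 f" "integrable \<nu>2 f" "integrable \<mu>1 f" "integrable \<mu>2 f"
  shows "integral\<^sup>L \<nu>1 f + integral\<^sup>L \<nu>2 f = integral\<^sup>L \<mu>1 f + integral\<^sup>L \<mu>2 f"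
proof (rule complex_eqI)
  show "Re (integral\<^sup>L \<nu>1 f + integral\<^sup>L \<nu>2 f) = Re (integral\<^sup>L \<mu>1 f + integral\<^sup>L \<mu>2 f)"
    using integral_add_measures_eq_real[OF s eq, of "\<lambda>x. Re (f x)"] i by simp
  show "Im (integral\<^sup>L \<nu>1 f + integral\<^sup>L \<nu>2 f) = Im (integral\<^sup>L \<mu>1 f + integral\<^sup>L \<mu>2 f)"
    using integral_add_measures_eq_real[OF s eq, of "\<lambda>x. Im (f x)"] i by simp
qed

section \<open>Spectral measures\<close>

text \<open>\<open>\<integral> z d\<langle>E(z)f, k\<rangle>\<close>, where the complex measure is written by polarization.\<close>

definition pvm_form :: "'a measure \<Rightarrow> 'a L2_pvm \<Rightarrow> ('a \<Rightarrow> complex) \<Rightarrow> ('a \<Rightarrow> complex) \<Rightarrow> complex" where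
  "pvm_form M E f k = (\<Sum>j<4. \<i> ^ j * (LINT z|pvm_measure M E (\<lambda>x. f x + \<i> ^ j * k x). z)) / 4"

lemma pvm_integral_iff:
  "(f, g) \<in> pvm_integral M E \<longleftrightarrow>
     f \<in> pvm_domain M E \<and> g \<in> L2 M \<and> (\<forall>k\<in>pvm_domain M E. L2_inner M g k = pvm_form M E f k)"
  by (simp add: pvm_integral_def pvm_form_def)

lemma sum_below_4: "(\<Sum>j<4. F j) = F 0 + F 1 + F 2 + F (3::nat)"
  by (simp add: eval_nat_numeral)

lemma i_power_3: "\<i> ^ 3 = - \<i>"
  by (simp add: eval_nat_numeral)

lemma projection_polarization:
  assumes Q: "orthogonal_projection M Q" and f: "f \<in> L2 M" and k: "k \<in> L2 M"
  shows "4 * L2_inner M (Q f) k =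
    (\<Sum>j<4. \<i> ^ j * L2_inner M (Q (\<lambda>x. f x + \<i> ^ j * k x)) (\<lambda>x. f x + \<i> ^ j * k x))"
proof -
  note L = orthogonal_projection_L2[OF Q]
  have e: "L2_inner M (Q (\<lambda>x. f x + c * k x)) (\<lambda>x. f x + c * k x) =
     L2_inner M (Q f) f + cnj c * L2_inner M (Q f) k + c * L2_inner M (Q k) f + c * cnj c * L2_inner M (Q k) k" for c
  proof -
    have fk: "(\<lambda>x. f x + c * k x) \<in> L2 M" using L2_lin[OF f k, of 1 c] by simp
    have "L2_inner M (Q (\<lambda>x. f x + c * k x)) (\<lambda>x. f x + c * k x) =
        L2_inner M (\<lambda>x. f x + c * k x) (Q (\<lambda>x. f x + c * k x))"
      by (rule orthogonal_projection_sym[OF Q fk fk])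
    also have "\<dots> = L2_inner M f (Q (\<lambda>x. f x + c * k x)) + c * L2_inner M k (Q (\<lambda>x. f x + c * k x))"
      using L2_inner_lin_left[OF f k L[OF fk], of 1 c] by simp
    also have "\<dots> = L2_inner M (Q f) (\<lambda>x. f x + c * k x) + c * L2_inner M (Q k) (\<lambda>x. f x + c * k x)"
      by (simp only: orthogonal_projection_sym[OF Q f fk] orthogonal_projection_sym[OF Q k fk])
    also have "L2_inner M (Q f) (\<lambda>x. f x + c * k x) = L2_inner M (Q f) f + cnj c * L2_inner M (Q f) k"
      using L2_inner_lin_right[OF f k L[OF f], of 1 c] by simp
    also have "L2_inner M (Q k) (\<lambda>x. f x + c * k x) = L2_inner M (Q k) f + cnj c * L2_inner M (Q k) k"
      using L2_inner_lin_right[OF f k L[OF k], of 1 c] by simp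
    finally show ?thesis by (simp add: algebra_simps)
  qed
  show ?thesis
    unfolding e sum_below_4 i_power_3 by (simp add: algebra_simps)
qed

lemma projection_inner_self:
  assumes Q: "orthogonal_projection M Q" and f: "f \<in> L2 M"
  shows "L2_inner M (Q f) f = complex_of_real (LINT x|M. (cmod (Q f x))\<^sup>2)"
  using orthogonal_projection_inner[OF Q f f] by (simp add: L2_inner_self)

lemma projection_residual:
  assumes Q: "orthogonal_projection M Q" and f: "f \<in> L2 M"
  shows "(LINT x|M. (cmod (f x - Q f x))\<^sup>2) = (LINT x|M. (cmod (f x))\<^sup>2) - (LINT x|M. (cmod (Q f x))\<^sup>2)"
proof -
  note Qf = orthogonal_projection_L2[OF Q f]
  have d: "(\<lambda>x. f x - Q f x) \<in> L2 M" by (rule L2_diff[OF f Qf])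
  have "L2_inner M (\<lambda>x. f x - Q f x) (\<lambda>x. f x - Q f x) = L2_inner M f f - L2_inner M f (Q f)
      - (L2_inner M (Q f) f - L2_inner M (Q f) (Q f))"
    by (simp only: L2_inner_diff_left[OF f Qf d] L2_inner_diff_right[OF f Qf f] L2_inner_diff_right[OF f Qf Qf])
  also have "L2_inner M f (Q f) = L2_inner M (Q f) f"
    by (rule orthogonal_projection_sym[OF Q f f, symmetric])
  also have "L2_inner M (Q f) f = L2_inner M (Q f) (Q f)"
    by (rule orthogonal_projection_inner[OF Q f f, symmetric])
  finally have "complex_of_real (LINT x|M. (cmod (f x - Q f x))\<^sup>2) =
     complex_of_real ((LINT x|M. (cmod (f x))\<^sup>2) - (LINT x|M. (cmod (Q f x))\<^sup>2))"
    by (simp add: L2_inner_self)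
  then show ?thesis by (simp only: of_real_eq_iff)
qed

lemma projection_norm_le:
  assumes Q: "orthogonal_projection M Q" and f: "f \<in> L2 M"
  shows "(LINT x|M. (cmod (Q f x))\<^sup>2) \<le> (LINT x|M. (cmod (f x))\<^sup>2)"
proof -
  have "0 \<le> (LINT x|M. (cmod (f x - Q f x))\<^sup>2)" by simp
  with projection_residual[OF Q f] show ?thesis by linarith
qed

lemma projection_fixed_if_norm_eq:
  assumes Q: "orthogonal_projection M Q" and f: "f \<in> L2 M"
    and "(LINT x|M. (cmod (Q f x))\<^sup>2) = (LINT x|M. (cmod (f x))\<^sup>2)"
  shows "AE x in M. Q f x = f x"
proof -
  have d: "(\<lambda>x. f x - Q f x) \<in> L2 M" by (rule L2_diff[OF f orthogonal_projection_L2[OF Q f]])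
  have "L2_inner M (\<lambda>x. f x - Q f x) (\<lambda>x. f x - Q f x) = 0"
    using projection_residual[OF Q f] assms(3) by (simp add: L2_inner_self)
  from L2_inner_self_eq_0D[OF d this] show ?thesis by eventually_elim simp
qed

lemma norm_square_integral_cong:
  assumes "f \<in> L2 M" "g \<in> L2 M" "AE x in M. f x = g x"
  shows "(LINT x|M. (cmod (f x))\<^sup>2) = (LINT x|M. (cmod (g x))\<^sup>2)"
proof -
  have [measurable]: "f \<in> borel_measurable M" "g \<in> borel_measurable M"
    using assms by (auto simp: L2_def)
  show ?thesis
    by (rule integral_cong_AE) (use assms(3) in auto)
qed

lemma norm_square_integral_eq_0D:
  assumes "f \<in> L2 M" "(LINT x|M. (cmod (f x))\<^sup>2) = 0"
  shows "AE x in M. f x = 0"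
  by (rule L2_inner_self_eq_0D[OF assms(1)]) (simp add: L2_inner_self assms(2))

lemma borel_singleton_zero: "{0::complex} \<in> sets borel"
  by simp

locale L2_spectral_measure =
  fixes M :: "'a measure" and E :: "'a L2_pvm"
  assumes spectral: "spectral_measure M E"
begin

lemma proj: "\<sigma> \<in> sets borel \<Longrightarrow> orthogonal_projection M (E \<sigma>)"
  using spectral unfolding spectral_measure_def by blast

lemma E_UNIV: "f \<in> L2 M \<Longrightarrow> AE x in M. E UNIV f x = f x"
  by (rule spectral[unfolded spectral_measure_def, THEN conjunct2, THEN conjunct1, rule_format])

lemma E_L2: "\<sigma> \<in> sets borel \<Longrightarrow> f \<in> L2 M \<Longrightarrow> E \<sigma> f \<in> L2 M"
  by (rule orthogonal_projection_L2[OF proj])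

text \<open>By symmetry and idempotence \<open>\<parallel>E(\<sigma>)f\<parallel>\<^sup>2 = \<langle>E(\<sigma>)f, f\<rangle>\<close>, so that the energy is the mass of \<open>\<sigma>\<close> under the
  scalar measure of \<open>f\<close>. The norm makes visible that it vanishes only if \<open>E(\<sigma>)f\<close> does.\<close>

definition energy :: "complex set \<Rightarrow> ('a \<Rightarrow> complex) \<Rightarrow> real" where
  "energy \<sigma> f = (LINT x|M. (cmod (E \<sigma> f x))\<^sup>2)"

lemma energy_nonneg [simp]: "0 \<le> energy \<sigma> f"
  by (simp add: energy_def)

lemma inner_energy:
  "\<sigma> \<in> sets borel \<Longrightarrow> f \<in> L2 M \<Longrightarrow> L2_inner M (E \<sigma> f) f = complex_of_real (energy \<sigma> f)"
  unfolding energy_def by (rule projection_inner_self[OF proj])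

abbreviation \<nu> :: "('a \<Rightarrow> complex) \<Rightarrow> complex measure" where
  "\<nu> f \<equiv> pvm_measure M E f"

lemma sets_nu [simp, measurable_cong]: "sets (\<nu> f) = sets borel"
  unfolding pvm_measure_def using sets.sigma_sets_eq[of borel]
  by (simp add: sets_measure_of_conv)

lemma space_nu [simp]: "space (\<nu> f) = UNIV"
  using sets_eq_imp_space_eq[OF sets_nu] by simp

lemma emeasure_nu:
  assumes "f \<in> L2 M" "\<sigma> \<in> sets borel"
  shows "emeasure (\<nu> f) \<sigma> = ennreal (energy \<sigma> f)"
proof -
  have "measure_space UNIV (sets borel) (pvm_scalar M E f)"
    by (rule spectral[unfolded spectral_measure_def, THEN conjunct2, THEN conjunct2, rule_format, OF assms(1)])
  then have "emeasure (\<nu> f) \<sigma> = pvm_scalar M E f \<sigma>"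
    unfolding pvm_measure_def measure_space_def
    by (intro emeasure_measure_of_sigma) (use assms in auto)
  then show ?thesis by (simp add: pvm_scalar_def inner_energy assms)
qed

lemma energy_UNIV: "f \<in> L2 M \<Longrightarrow> energy UNIV f = (LINT x|M. (cmod (f x))\<^sup>2)"
  unfolding energy_def by (intro norm_square_integral_cong E_L2 E_UNIV) auto

lemma finite_nu: "f \<in> L2 M \<Longrightarrow> finite_measure (\<nu> f)"
  by (rule finite_measureI) (simp add: emeasure_nu)

lemma measure_nu: "f \<in> L2 M \<Longrightarrow> \<sigma> \<in> sets borel \<Longrightarrow> measure (\<nu> f) \<sigma> = energy \<sigma> f"
  by (simp add: measure_def emeasure_nu)

lemma energy_mono:
  assumes "f \<in> L2 M" "\<sigma> \<in> sets borel" "\<tau> \<in> sets borel" "\<sigma> \<subseteq> \<tau>"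
  shows "energy \<sigma> f \<le> energy \<tau> f"
proof -
  interpret finite_measure "\<nu> f" by (rule finite_nu[OF assms(1)])
  show ?thesis using finite_measure_mono[of \<sigma> \<tau>] assms by (simp add: measure_nu)
qed

lemma energy_split:
  assumes "f \<in> L2 M" "\<sigma> \<in> sets borel" "\<tau> \<in> sets borel"
  shows "energy \<tau> f = energy (\<tau> \<inter> \<sigma>) f + energy (\<tau> - \<sigma>) f"
proof -
  interpret finite_measure "\<nu> f" by (rule finite_nu[OF assms(1)])
  have "measure (\<nu> f) ((\<tau> \<inter> \<sigma>) \<union> (\<tau> - \<sigma>)) = measure (\<nu> f) (\<tau> \<inter> \<sigma>) + measure (\<nu> f) (\<tau> - \<sigma>)"
    using assms by (intro finite_measure_Union) auto
  moreover have "(\<tau> \<inter> \<sigma>) \<union> (\<tau> - \<sigma>) = \<tau>" by blast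
  ultimately show ?thesis using assms by (simp add: measure_nu)
qed

lemma polarization:
  assumes "f \<in> L2 M" "k \<in> L2 M" "\<sigma> \<in> sets borel"
  shows "4 * L2_inner M (E \<sigma> f) k =
    (\<Sum>j<4. \<i> ^ j * complex_of_real (energy \<sigma> (\<lambda>x. f x + \<i> ^ j * k x)))"
  unfolding projection_polarization[OF proj[OF assms(3)] assms(1,2)]
  using L2_lin[OF assms(1,2), of 1] assms(3)
  by (intro sum.cong refl) (simp add: inner_energy)

lemma polarization_Re_Im:
  assumes "f \<in> L2 M" "k \<in> L2 M" "\<sigma> \<in> sets borel"
  shows "4 * Re (L2_inner M (E \<sigma> f) k) =
      energy \<sigma> (\<lambda>x. f x + \<i> ^ 0 * k x) - energy \<sigma> (\<lambda>x. f x + \<i> ^ 2 * k x)"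
    and "4 * Im (L2_inner M (E \<sigma> f) k) =
      energy \<sigma> (\<lambda>x. f x + \<i> ^ 1 * k x) - energy \<sigma> (\<lambda>x. f x + \<i> ^ 3 * k x)"
proof -
  note p = polarization[OF assms, unfolded sum_below_4]
  show "4 * Re (L2_inner M (E \<sigma> f) k) =
      energy \<sigma> (\<lambda>x. f x + \<i> ^ 0 * k x) - energy \<sigma> (\<lambda>x. f x + \<i> ^ 2 * k x)"
    using arg_cong[OF p, of Re] by (simp add: i_power_3)
  show "4 * Im (L2_inner M (E \<sigma> f) k) =
      energy \<sigma> (\<lambda>x. f x + \<i> ^ 1 * k x) - energy \<sigma> (\<lambda>x. f x + \<i> ^ 3 * k x)"
    using arg_cong[OF p, of Im] by (simp add: i_power_3)
qed

text \<open>Additivity of the scalar measures carries over to \<open>\<langle>E(\<cdot>)f, k\<rangle>\<close> by polarization.\<close>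

lemma inner_split:
  assumes "f \<in> L2 M" "k \<in> L2 M" "\<sigma> \<in> sets borel" "\<tau> \<in> sets borel"
  shows "L2_inner M (E \<tau> f) k = L2_inner M (E (\<tau> \<inter> \<sigma>) f) k + L2_inner M (E (\<tau> - \<sigma>) f) k"
proof -
  have "energy \<tau> (\<lambda>x. f x + c * k x) = energy (\<tau> \<inter> \<sigma>) (\<lambda>x. f x + c * k x)
     + energy (\<tau> - \<sigma>) (\<lambda>x. f x + c * k x)" for c
    using L2_lin[OF assms(1,2), of 1 c] assms(3,4) by (intro energy_split) auto
  then have "4 * L2_inner M (E \<tau> f) k = 4 * L2_inner M (E (\<tau> \<inter> \<sigma>) f) k + 4 * L2_inner M (E (\<tau> - \<sigma>) f) k"
    using assms by (simp add: polarization sum.distrib distrib_left)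
  then have "4 * L2_inner M (E \<tau> f) k = 4 * (L2_inner M (E (\<tau> \<inter> \<sigma>) f) k + L2_inner M (E (\<tau> - \<sigma>) f) k)"
    by (simp only: distrib_left)
  then show ?thesis by (simp only: mult_cancel_left) simp
qed

lemma E_eq_0_if_energy:
  "f \<in> L2 M \<Longrightarrow> \<sigma> \<in> sets borel \<Longrightarrow> energy \<sigma> f = 0 \<Longrightarrow> AE x in M. E \<sigma> f x = 0"
  unfolding energy_def by (intro norm_square_integral_eq_0D E_L2)

text \<open>If \<open>E(\<sigma>)\<close> fixes \<open>f\<close>, then \<open>\<sigma>\<close> carries the whole mass \<open>\<parallel>f\<parallel>\<^sup>2\<close> of the scalar measure of \<open>f\<close>. This is the
  source of the multiplicativity of \<open>E\<close> below.\<close>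

lemma energy_Compl:
  assumes "f \<in> L2 M" "\<sigma> \<in> sets borel" "AE x in M. E \<sigma> f x = f x"
  shows "energy (- \<sigma>) f = 0"
proof -
  have "energy \<sigma> f = energy UNIV f"
    unfolding energy_UNIV[OF assms(1)] unfolding energy_def
    by (intro norm_square_integral_cong E_L2 assms)
  with energy_split[of f \<sigma> UNIV] assms show ?thesis by (simp add: Compl_eq_Diff_UNIV)
qed

lemma AE_nu_if_fixed:
  assumes "f \<in> L2 M" "\<sigma> \<in> sets borel" "AE x in M. E \<sigma> f x = f x"
  shows "AE z in \<nu> f. z \<in> \<sigma>"
  by (rule AE_I'[of "- \<sigma>"]) (use assms in \<open>auto simp: null_sets_def emeasure_nu energy_Compl borel_comp\<close>)

lemma E_idem: "\<sigma> \<in> sets borel \<Longrightarrow> f \<in> L2 M \<Longrightarrow> AE x in M. E \<sigma> (E \<sigma> f) x = E \<sigma> f x"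
  by (rule orthogonal_projection_idem[OF proj])

text \<open>\<open>E(\<tau>) E(\<sigma>) = E(\<tau> \<inter> \<sigma>)\<close>: the scalar measure of \<open>E(\<sigma>)f\<close> lives on \<open>\<sigma>\<close>, which kills the contribution of
  \<open>\<tau> - \<sigma>\<close>; that of \<open>f - E(\<sigma>)f\<close> does not charge \<open>\<sigma>\<close>, so that on \<open>\<tau> \<inter> \<sigma>\<close> the vector \<open>E(\<sigma>)f\<close> may be replaced by \<open>f\<close>.\<close>

lemma inner_E_E:
  assumes f: "f \<in> L2 M" and k: "k \<in> L2 M" and s: "\<sigma> \<in> sets borel" and t: "\<tau> \<in> sets borel"
  shows "L2_inner M (E \<tau> (E \<sigma> f)) k = L2_inner M (E (\<tau> \<inter> \<sigma>) f) k"
proof -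
  note Ef = E_L2[OF s f]
  have ts: "\<tau> \<inter> \<sigma> \<in> sets borel" "\<tau> - \<sigma> \<in> sets borel" "- \<sigma> \<in> sets borel" using s t by auto
  have "energy (\<tau> - \<sigma>) (E \<sigma> f) \<le> energy (- \<sigma>) (E \<sigma> f)"
    by (rule energy_mono[OF Ef ts(2,3)]) auto
  also have "\<dots> = 0" by (rule energy_Compl[OF Ef s E_idem[OF s f]])
  finally have "energy (\<tau> - \<sigma>) (E \<sigma> f) = 0" using energy_nonneg[of "\<tau> - \<sigma>" "E \<sigma> f"] by linarith
  then have 1: "AE x in M. E (\<tau> - \<sigma>) (E \<sigma> f) x = 0" by (rule E_eq_0_if_energy[OF Ef ts(2)])
  have 1: "L2_inner M (E (\<tau> - \<sigma>) (E \<sigma> f)) k = 0"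
    using L2_inner_cong_left[OF E_L2[OF ts(2) Ef] L2_zero k 1] by simp
  let ?y = "\<lambda>x. f x - E \<sigma> f x"
  have y: "?y \<in> L2 M" by (rule L2_diff[OF f Ef])
  have "AE x in M. E \<sigma> ?y x = 0"
    using orthogonal_projection_diff[OF proj[OF s] f Ef] E_idem[OF s f] by eventually_elim simp
  then have "energy \<sigma> ?y = (LINT x|M. (cmod 0)\<^sup>2)"
    unfolding energy_def by (intro norm_square_integral_cong E_L2 s y L2_zero)
  moreover have "energy (\<tau> \<inter> \<sigma>) ?y \<le> energy \<sigma> ?y"
    by (rule energy_mono[OF y ts(1) s]) auto
  ultimately have "energy (\<tau> \<inter> \<sigma>) ?y = 0" using energy_nonneg[of "\<tau> \<inter> \<sigma>" ?y] by simp
  then have "AE x in M. E (\<tau> \<inter> \<sigma>) ?y x = 0" by (rule E_eq_0_if_energy[OF y ts(1)])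
  then have "AE x in M. E (\<tau> \<inter> \<sigma>) (E \<sigma> f) x = E (\<tau> \<inter> \<sigma>) f x"
    using orthogonal_projection_diff[OF proj[OF ts(1)] f Ef] by eventually_elim simp
  then have 2: "L2_inner M (E (\<tau> \<inter> \<sigma>) (E \<sigma> f)) k = L2_inner M (E (\<tau> \<inter> \<sigma>) f) k"
    by (rule L2_inner_cong_left[OF E_L2[OF ts(1) Ef] E_L2[OF ts(1) f] k])
  show ?thesis
    using inner_split[OF Ef k s t] 1 2 by simp
qed

lemma pvm_domain_iff:
  "f \<in> pvm_domain M E \<longleftrightarrow> f \<in> L2 M \<and> (\<integral>\<^sup>+z. ennreal ((cmod z)\<^sup>2) \<partial>\<nu> f) < \<infinity>"
  by (simp add: pvm_domain_def)

lemma pvm_domain_L2: "f \<in> pvm_domain M E \<Longrightarrow> f \<in> L2 M"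
  by (simp add: pvm_domain_def)

text \<open>A vector inherits membership in the domain from two others when its scalar measure is dominated
  by a combination of theirs; this covers sums, projections and restrictions.\<close>

lemma pvm_domain_le:
  assumes f: "f \<in> pvm_domain M E" and k: "k \<in> pvm_domain M E" and g: "g \<in> L2 M"
    and a: "a \<ge> 0" and b: "b \<ge> 0"
    and le: "\<And>\<sigma>. \<sigma> \<in> sets borel \<Longrightarrow> energy \<sigma> g \<le> a * energy \<sigma> f + b * energy \<sigma> k"
  shows "g \<in> pvm_domain M E"
proof -
  let ?q = "\<lambda>z. ennreal ((cmod z)\<^sup>2)"
  have "nn_integral (\<nu> g) ?q + nn_integral (null_measure borel) ?q
      \<le> nn_integral (scale_measure (ennreal a) (\<nu> f)) ?q + nn_integral (scale_measure (ennreal b) (\<nu> k)) ?q"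
  proof (rule nn_integral_add_measures_mono[where K = borel])
    fix A :: "complex set" assume A: "A \<in> sets borel"
    have "ennreal (energy A g) \<le> ennreal (a * energy A f + b * energy A k)"
      by (intro ennreal_leI le A)
    then show "emeasure (\<nu> g) A + emeasure (null_measure borel) A
        \<le> emeasure (scale_measure (ennreal a) (\<nu> f)) A + emeasure (scale_measure (ennreal b) (\<nu> k)) A"
      using A a b by (simp add: emeasure_nu g pvm_domain_L2[OF f] pvm_domain_L2[OF k] ennreal_plus ennreal_mult)
  qed auto
  also have "\<dots> = ennreal a * nn_integral (\<nu> f) ?q + ennreal b * nn_integral (\<nu> k) ?q"
    by (simp add: nn_integral_scale_measure)
  also have "\<dots> < \<infinity>"
    using f k by (auto simp: pvm_domain_iff ennreal_mult_less_top)
  finally show ?thesis using g by (simp add: pvm_domain_iff)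
qed

lemma energy_lin_le:
  assumes f: "f \<in> L2 M" and k: "k \<in> L2 M" and s: "\<sigma> \<in> sets borel"
  shows "energy \<sigma> (\<lambda>x. a * f x + c * k x) \<le> 2 * (cmod a)\<^sup>2 * energy \<sigma> f + 2 * (cmod c)\<^sup>2 * energy \<sigma> k"
proof -
  note Ef = E_L2[OF s f] note Ek = E_L2[OF s k]
  have "energy \<sigma> (\<lambda>x. a * f x + c * k x) = (LINT x|M. (cmod (a * E \<sigma> f x + c * E \<sigma> k x))\<^sup>2)"
    unfolding energy_def
    by (intro norm_square_integral_cong E_L2 s L2_lin f k Ef Ek orthogonal_projection_lin[OF proj])
  also have "\<dots> \<le> (LINT x|M. 2 * (cmod a)\<^sup>2 * (cmod (E \<sigma> f x))\<^sup>2 + 2 * (cmod c)\<^sup>2 * (cmod (E \<sigma> k x))\<^sup>2)"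
  proof (rule integral_mono)
    show "integrable M (\<lambda>x. (cmod (a * E \<sigma> f x + c * E \<sigma> k x))\<^sup>2)"
      by (rule L2_integrable[OF L2_lin[OF Ef Ek]])
    show "integrable M (\<lambda>x. 2 * (cmod a)\<^sup>2 * (cmod (E \<sigma> f x))\<^sup>2 + 2 * (cmod c)\<^sup>2 * (cmod (E \<sigma> k x))\<^sup>2)"
      using L2_integrable[OF Ef] L2_integrable[OF Ek] by simp
    show "(cmod (a * E \<sigma> f x + c * E \<sigma> k x))\<^sup>2
        \<le> 2 * (cmod a)\<^sup>2 * (cmod (E \<sigma> f x))\<^sup>2 + 2 * (cmod c)\<^sup>2 * (cmod (E \<sigma> k x))\<^sup>2" for x
      using cmod_add_square_le[of "a * E \<sigma> f x" "c * E \<sigma> k x"]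
      by (simp add: norm_mult power_mult_distrib mult.assoc)
  qed
  also have "\<dots> = 2 * (cmod a)\<^sup>2 * energy \<sigma> f + 2 * (cmod c)\<^sup>2 * energy \<sigma> k"
    using L2_integrable[OF Ef] L2_integrable[OF Ek] by (simp add: energy_def)
  finally show ?thesis .
qed

lemma pvm_domain_lin:
  assumes f: "f \<in> pvm_domain M E" and k: "k \<in> pvm_domain M E"
  shows "(\<lambda>x. a * f x + c * k x) \<in> pvm_domain M E"
proof (rule pvm_domain_le[OF f k])
  show "(\<lambda>x. a * f x + c * k x) \<in> L2 M"
    by (intro L2_lin pvm_domain_L2 f k)
  show "energy \<sigma> (\<lambda>x. a * f x + c * k x) \<le> 2 * (cmod a)\<^sup>2 * energy \<sigma> f + 2 * (cmod c)\<^sup>2 * energy \<sigma> k"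
    if "\<sigma> \<in> sets borel" for \<sigma>
    by (rule energy_lin_le[OF pvm_domain_L2[OF f] pvm_domain_L2[OF k] that])
qed auto

lemma pvm_domain_add_scaled:
  assumes f: "f \<in> pvm_domain M E" and k: "k \<in> pvm_domain M E"
  shows "(\<lambda>x. f x + c * k x) \<in> pvm_domain M E"
  using pvm_domain_lin[OF assms, of 1 c] by simp

lemma integrable_nu:
  assumes f: "f \<in> pvm_domain M E"
  shows "integrable (\<nu> f) (\<lambda>z. z)"
proof -
  interpret finite_measure "\<nu> f" by (rule finite_nu[OF pvm_domain_L2[OF f]])
  have "integrable (\<nu> f) (\<lambda>z. (cmod z)\<^sup>2)"
    using f by (simp add: integrable_iff_bounded pvm_domain_iff)
  then have i: "integrable (\<nu> f) (\<lambda>z. 1 + (cmod z)\<^sup>2)" by simp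
  have "cmod z \<le> 1 + (cmod z)\<^sup>2" for z
    using sum_squares_bound[of "cmod z" 1] norm_ge_zero[of z] unfolding power_one by linarith
  then have "norm z \<le> norm (1 + (cmod z)\<^sup>2)" for z :: complex
    by (simp add: abs_of_nonneg)
  then show ?thesis
    by (intro Bochner_Integration.integrable_bound[OF i]) auto
qed

text \<open>The polarized integral only depends on the complex measure \<open>\<langle>E(\<cdot>)f, k\<rangle>\<close>. Up to the factor \<open>4\<close>, its real part
  is the difference of the first and the third, its imaginary part that of the second and the fourth
  of the four polarizing measures; bringing the negative terms to the other side makes the equality
  one between sums of finite measures.\<close>

lemma pvm_form_cong:
  assumes f: "f \<in> pvm_domain M E" and k: "k \<in> pvm_domain M E"
    and f': "f' \<in> pvm_domain M E" and k': "k' \<in> pvm_domain M E"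
    and eq: "\<And>\<sigma>. \<sigma> \<in> sets borel \<Longrightarrow> L2_inner M (E \<sigma> f) k = L2_inner M (E \<sigma> f') k'"
  shows "pvm_form M E f k = pvm_form M E f' k'"
proof -
  let ?g = "\<lambda>j::nat. \<lambda>x. f x + \<i> ^ j * k x" and ?g' = "\<lambda>j::nat. \<lambda>x. f' x + \<i> ^ j * k' x"
  have d: "?g j \<in> pvm_domain M E" "?g' j \<in> pvm_domain M E" for j
    by (intro pvm_domain_add_scaled f k f' k')+
  note dL = pvm_domain_L2[OF d(1)] pvm_domain_L2[OF d(2)]
  note fL = pvm_domain_L2[OF f] pvm_domain_L2[OF k] note fL' = pvm_domain_L2[OF f'] pvm_domain_L2[OF k']
  have *: "integral\<^sup>L (\<nu> (?g i)) (\<lambda>z. z) + integral\<^sup>L (\<nu> (?g' j)) (\<lambda>z. z) =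
      integral\<^sup>L (\<nu> (?g j)) (\<lambda>z. z) + integral\<^sup>L (\<nu> (?g' i)) (\<lambda>z. z)"
    if e: "\<And>\<sigma>. \<sigma> \<in> sets borel \<Longrightarrow> energy \<sigma> (?g i) + energy \<sigma> (?g' j) = energy \<sigma> (?g j) + energy \<sigma> (?g' i)" for i j
  proof (rule integral_add_measures_eq[where K = borel])
    fix A :: "complex set" assume A: "A \<in> sets borel"
    show "emeasure (\<nu> (?g i)) A + emeasure (\<nu> (?g' j)) A = emeasure (\<nu> (?g j)) A + emeasure (\<nu> (?g' i)) A"
      using e[OF A] A by (simp add: emeasure_nu dL flip: ennreal_plus)
  qed (auto intro!: integrable_nu d)
  have 1: "energy \<sigma> (?g 0) + energy \<sigma> (?g' 2) = energy \<sigma> (?g 2) + energy \<sigma> (?g' 0)"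
    if "\<sigma> \<in> sets borel" for \<sigma>
    using polarization_Re_Im(1)[OF fL that] polarization_Re_Im(1)[OF fL' that] eq[OF that] by simp
  have 2: "energy \<sigma> (?g 1) + energy \<sigma> (?g' 3) = energy \<sigma> (?g 3) + energy \<sigma> (?g' 1)"
    if "\<sigma> \<in> sets borel" for \<sigma>
    using polarization_Re_Im(2)[OF fL that] polarization_Re_Im(2)[OF fL' that] eq[OF that] by simp
  have "(\<Sum>j<4. \<i> ^ j * integral\<^sup>L (\<nu> (?g j)) (\<lambda>z. z)) = (\<Sum>j<4. \<i> ^ j * integral\<^sup>L (\<nu> (?g' j)) (\<lambda>z. z))"
  proof -
    have a: "integral\<^sup>L (\<nu> (?g 0)) (\<lambda>z. z) - integral\<^sup>L (\<nu> (?g 2)) (\<lambda>z. z) =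
        integral\<^sup>L (\<nu> (?g' 0)) (\<lambda>z. z) - integral\<^sup>L (\<nu> (?g' 2)) (\<lambda>z. z)"
      using *[of 0 2, OF 1] by (simp only: algebra_simps)
    have b: "integral\<^sup>L (\<nu> (?g 1)) (\<lambda>z. z) - integral\<^sup>L (\<nu> (?g 3)) (\<lambda>z. z) =
        integral\<^sup>L (\<nu> (?g' 1)) (\<lambda>z. z) - integral\<^sup>L (\<nu> (?g' 3)) (\<lambda>z. z)"
      using *[of 1 3, OF 2] by (simp only: algebra_simps)
    have s: "(\<Sum>j<4. \<i> ^ j * F j) = (F 0 - F 2) + \<i> * (F 1 - F 3)" for F :: "nat \<Rightarrow> complex"
      unfolding sum_below_4 i_power_3 by (simp add: algebra_simps)
    show ?thesis unfolding s a b ..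
  qed
  then show ?thesis by (simp add: pvm_form_def)
qed

lemma energy_scale:
  assumes "f \<in> L2 M" "\<sigma> \<in> sets borel"
  shows "energy \<sigma> (\<lambda>x. c * f x) = (cmod c)\<^sup>2 * energy \<sigma> f"
proof -
  have "energy \<sigma> (\<lambda>x. c * f x) = (LINT x|M. (cmod (c * E \<sigma> f x))\<^sup>2)"
    unfolding energy_def
    using orthogonal_projection_lin[OF proj[OF assms(2)] assms(1) assms(1), of c 0]
    by (intro norm_square_integral_cong E_L2 L2_scale assms) simp
  then show ?thesis by (simp add: energy_def norm_mult power_mult_distrib)
qed

lemma integral_nu_scale:
  assumes f: "f \<in> pvm_domain M E"
  shows "(LINT z|\<nu> (\<lambda>x. c * f x). z) = of_real ((cmod c)\<^sup>2) * (LINT z|\<nu> f. z)"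
proof -
  note fL = pvm_domain_L2[OF f]
  have "\<nu> (\<lambda>x. c * f x) = density (\<nu> f) (\<lambda>_. ennreal ((cmod c)\<^sup>2))"
    by (rule measure_eqI)
       (use fL in \<open>simp_all add: emeasure_nu L2_scale emeasure_density_const energy_scale ennreal_mult\<close>)
  then show ?thesis
    by (simp add: integral_density scaleR_conv_of_real)
qed

text \<open>The four polarizing vectors are the multiples of \<open>f\<close> by \<open>2\<close>, \<open>1 + \<i>\<close>, \<open>0\<close> and \<open>1 - \<i>\<close>; the two
  imaginary contributions cancel.\<close>

lemma pvm_form_self:
  assumes f: "f \<in> pvm_domain M E"
  shows "pvm_form M E f f = (LINT z|\<nu> f. z)"
proof -
  have *: "(\<lambda>x. f x + c * f x) = (\<lambda>x. (1 + c) * f x)" for c by (simp add: distrib_right)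
  have "cmod (1 + \<i>) ^ 2 = 2" "cmod (1 - \<i>) ^ 2 = 2" "cmod 2 ^ 2 = 4" by (simp_all add: cmod_power2)
  then show ?thesis
    unfolding pvm_form_def * integral_nu_scale[OF f] sum_below_4 i_power_3
    by (simp add: algebra_simps)
qed

lemma inner_E_E_right:
  assumes f: "f \<in> L2 M" and k: "k \<in> L2 M" and s: "\<sigma> \<in> sets borel" and t: "\<tau> \<in> sets borel"
  shows "L2_inner M (E \<tau> f) (E \<sigma> k) = L2_inner M (E (\<tau> \<inter> \<sigma>) f) k"
proof -
  have ts: "\<tau> \<inter> \<sigma> \<in> sets borel" using s t by auto
  have "L2_inner M (E \<tau> f) (E \<sigma> k) = cnj (L2_inner M (E \<sigma> k) (E \<tau> f))" by (rule L2_inner_cnj)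
  also have "L2_inner M (E \<sigma> k) (E \<tau> f) = L2_inner M (E \<tau> (E \<sigma> k)) f"
    by (rule orthogonal_projection_sym[OF proj[OF t] E_L2[OF s k] f, symmetric])
  also have "\<dots> = L2_inner M (E (\<tau> \<inter> \<sigma>) k) f" by (rule inner_E_E[OF k f s t])
  also have "\<dots> = L2_inner M k (E (\<tau> \<inter> \<sigma>) f)" by (rule orthogonal_projection_sym[OF proj[OF ts] k f])
  also have "cnj \<dots> = L2_inner M (E (\<tau> \<inter> \<sigma>) f) k" by (rule L2_inner_cnj[symmetric])
  finally show ?thesis .
qed

lemma pvm_domain_E:
  assumes f: "f \<in> pvm_domain M E" and s: "\<sigma> \<in> sets borel"
  shows "E \<sigma> f \<in> pvm_domain M E"
proof (rule pvm_domain_le[OF f f, of _ 1 0])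
  note fL = pvm_domain_L2[OF f]
  note Ef = E_L2[OF s fL]
  show "E \<sigma> f \<in> L2 M" by (rule Ef)
  fix \<tau> :: "complex set" assume t: "\<tau> \<in> sets borel"
  have ts: "\<tau> \<inter> \<sigma> \<in> sets borel" using s t by auto
  have "complex_of_real (energy \<tau> (E \<sigma> f)) = L2_inner M (E \<tau> (E \<sigma> f)) (E \<sigma> f)"
    by (rule inner_energy[OF t Ef, symmetric])
  also have "\<dots> = L2_inner M (E (\<tau> \<inter> \<sigma>) f) (E \<sigma> f)" by (rule inner_E_E[OF fL Ef s t])
  also have "\<dots> = L2_inner M (E (\<tau> \<inter> \<sigma> \<inter> \<sigma>) f) f" by (rule inner_E_E_right[OF fL fL s ts])
  also have "\<dots> = complex_of_real (energy (\<tau> \<inter> \<sigma>) f)"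
    using inner_energy[OF ts fL] by (simp add: Int_assoc)
  finally have "energy \<tau> (E \<sigma> f) = energy (\<tau> \<inter> \<sigma>) f" by (simp only: of_real_eq_iff)
  also have "\<dots> \<le> energy \<tau> f" by (rule energy_mono[OF fL ts t]) auto
  finally show "energy \<tau> (E \<sigma> f) \<le> 1 * energy \<tau> f + 0 * energy \<tau> f" by simp
qed auto

lemma integral_nu_if_fixed:
  assumes g: "g \<in> L2 M" "AE x in M. E {0} g x = g x"
  shows "(LINT z|\<nu> g. z) = 0"
proof -
  have "(LINT z|\<nu> g. z) = (LINT z|\<nu> g. 0)"
    using AE_nu_if_fixed[OF g(1) borel_singleton_zero g(2)] by (intro integral_cong_AE) auto
  then show ?thesis by simp
qed

text \<open>If \<open>E({0})\<close> fixes \<open>f\<close>, then \<open>\<langle>E(\<cdot>)f, k\<rangle> = \<langle>E(\<cdot>)f, E({0})k\<rangle>\<close> for all \<open>k\<close>, and all polarizing vectors of the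
  right-hand side have scalar measures concentrated at the origin.\<close>

lemma kernel_if_fixed:
  assumes f: "f \<in> L2 M" "AE x in M. E {0} f x = f x"
  shows "(f, \<lambda>x. 0) \<in> pvm_integral M E"
proof -
  note z = borel_singleton_zero
  have dom: "f \<in> pvm_domain M E"
  proof -
    have "(\<integral>\<^sup>+z. ennreal ((cmod z)\<^sup>2) \<partial>\<nu> f) = (\<integral>\<^sup>+z. 0 \<partial>\<nu> f)"
      using AE_nu_if_fixed[OF f(1) z f(2)] by (intro nn_integral_cong_AE) auto
    then show ?thesis using f(1) by (simp add: pvm_domain_iff)
  qed
  have "pvm_form M E f k = 0" if k: "k \<in> pvm_domain M E" for k
  proof -
    note kL = pvm_domain_L2[OF k] note Ek = E_L2[OF z kL]
    have "pvm_form M E f k = pvm_form M E f (E {0} k)"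
    proof (rule pvm_form_cong[OF dom k dom pvm_domain_E[OF k z]])
      fix \<tau> :: "complex set" assume t: "\<tau> \<in> sets borel"
      have "L2_inner M (E \<tau> f) k = L2_inner M (E \<tau> (E {0} f)) k"
        by (rule L2_inner_cong_left[OF E_L2[OF t f(1)] E_L2[OF t E_L2[OF z f(1)]] kL
              orthogonal_projection_cong[OF proj[OF t] f(1) E_L2[OF z f(1)]]])
           (use f(2) in \<open>eventually_elim, simp\<close>)
      also have "\<dots> = L2_inner M (E \<tau> f) (E {0} k)"
        unfolding inner_E_E[OF f(1) kL z t] inner_E_E_right[OF f(1) kL z t] ..
      finally show "L2_inner M (E \<tau> f) k = L2_inner M (E \<tau> f) (E {0} k)" .
    qed
    also have "\<dots> = 0"
    proof -
      have "(LINT z|\<nu> (\<lambda>x. f x + c * E {0} k x). z) = 0" for c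
      proof (rule integral_nu_if_fixed)
        show "(\<lambda>x. f x + c * E {0} k x) \<in> L2 M" using L2_lin[OF f(1) Ek, of 1 c] by simp
        show "AE x in M. E {0} (\<lambda>x. f x + c * E {0} k x) x = f x + c * E {0} k x"
          using orthogonal_projection_lin[OF proj[OF z] f(1) Ek, of 1 c] f(2) E_idem[OF z kL]
          by eventually_elim simp
      qed
      then show ?thesis by (simp add: pvm_form_def)
    qed
    finally show ?thesis .
  qed
  then show ?thesis by (simp add: pvm_integral_iff dom)
qed

text \<open>Testing a kernel vector \<open>f\<close> against \<open>E(\<sigma>)f\<close> for an open half plane \<open>\<sigma>\<close> with the origin on its
  boundary shows that \<open>\<langle>E(\<cdot>)f, f\<rangle>\<close> does not charge \<open>\<sigma>\<close>. Four half planes cover the complement of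
  the origin.\<close>

lemma fixed_if_kernel:
  assumes "(f, \<lambda>x. 0) \<in> pvm_integral M E"
  shows "AE x in M. E {0} f x = f x"
proof -
  have dom: "f \<in> pvm_domain M E" and form: "\<And>k. k \<in> pvm_domain M E \<Longrightarrow> pvm_form M E f k = 0"
    using assms by (auto simp: pvm_integral_iff)
  note f = pvm_domain_L2[OF dom]
  have half: "AE z in \<nu> f. Re (a * z) \<le> 0" for a :: complex
  proof -
    define \<sigma> where "\<sigma> = {z. 0 < Re (a * z)}"
    have s: "\<sigma> \<in> sets borel"
      unfolding \<sigma>_def by (intro borel_open open_Collect_less continuous_intros)
    note Ed = pvm_domain_E[OF dom s] note Ef = E_L2[OF s f]
    have "0 = pvm_form M E f (E \<sigma> f)" by (rule form[OF Ed, symmetric])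
    also have "\<dots> = pvm_form M E (E \<sigma> f) (E \<sigma> f)"
    proof (rule pvm_form_cong[OF dom Ed Ed Ed])
      fix \<tau> :: "complex set" assume t: "\<tau> \<in> sets borel"
      have ts: "\<tau> \<inter> \<sigma> \<in> sets borel" using s t by auto
      show "L2_inner M (E \<tau> f) (E \<sigma> f) = L2_inner M (E \<tau> (E \<sigma> f)) (E \<sigma> f)"
        unfolding inner_E_E[OF f Ef s t] inner_E_E_right[OF f f s t] inner_E_E_right[OF f f s ts]
        by (simp add: Int_assoc)
    qed
    also have "\<dots> = (LINT z|\<nu> (E \<sigma> f). z)" by (rule pvm_form_self[OF Ed])
    finally have int0: "(LINT z|\<nu> (E \<sigma> f). z) = 0" by simp
    have i: "integrable (\<nu> (E \<sigma> f)) (\<lambda>z. Re (a * z))"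
      using integrable_nu[OF Ed] by simp
    have "(LINT z|\<nu> (E \<sigma> f). Re (a * z)) = Re (LINT z|\<nu> (E \<sigma> f). a * z)"
      using integrable_nu[OF Ed] by (intro integral_Re) simp
    also have "\<dots> = 0" using int0 by simp
    finally have z: "(LINT z|\<nu> (E \<sigma> f). Re (a * z)) = 0" .
    have conc: "AE z in \<nu> (E \<sigma> f). z \<in> \<sigma>" by (rule AE_nu_if_fixed[OF Ef s E_idem[OF s f]])
    then have "AE z in \<nu> (E \<sigma> f). 0 \<le> Re (a * z)" by eventually_elim (simp add: \<sigma>_def)
    from integral_nonneg_eq_0_iff_AE[OF i this] z have "AE z in \<nu> (E \<sigma> f). Re (a * z) = 0" by simp
    with conc have "AE z in \<nu> (E \<sigma> f). False" by eventually_elim (simp add: \<sigma>_def)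
    then have "emeasure (\<nu> (E \<sigma> f)) (space (\<nu> (E \<sigma> f))) = 0"
      using AE_iff_null[of "\<nu> (E \<sigma> f)" "\<lambda>_. False"] by (simp add: null_sets_def)
    then have "energy UNIV (E \<sigma> f) = 0"
      by (simp add: emeasure_nu Ef antisym)
    then have "energy \<sigma> f = 0"
      unfolding energy_UNIV[OF Ef] by (simp add: energy_def)
    then have "emeasure (\<nu> f) \<sigma> = 0" by (simp add: emeasure_nu f s)
    then show ?thesis
      by (intro AE_I[of _ _ \<sigma>]) (auto simp: \<sigma>_def s[unfolded \<sigma>_def])
  qed
  have "AE z in \<nu> f. z \<in> {0}"
    using half[of 1] half[of "-1"] half[of \<i>] half[of "-\<i>"]
    by eventually_elim (auto simp: complex_eq_iff)
  then have "AE z in \<nu> f. (z \<in> {0}) = (z \<in> UNIV)" by eventually_elim simp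
  then have "emeasure (\<nu> f) {0} = emeasure (\<nu> f) UNIV"
    by (intro emeasure_eq_AE) auto
  then have "energy {0} f = energy UNIV f" by (simp add: emeasure_nu f)
  then show ?thesis
    unfolding energy_UNIV[OF f] unfolding energy_def
    by (intro projection_fixed_if_norm_eq[OF proj f]) auto
qed

text \<open>A projection commuting with the spectral measure can be moved across \<open>\<langle>E(\<cdot>)f, k\<rangle>\<close>, and it does
  not increase energies, so that it preserves the domain.\<close>

lemma pvm_integral_commute:
  assumes Q: "orthogonal_projection M Q"
    and comm: "\<And>\<sigma> f. \<sigma> \<in> sets borel \<Longrightarrow> f \<in> L2 M \<Longrightarrow> AE x in M. E \<sigma> (Q f) x = Q (E \<sigma> f) x"
    and fg: "(f, g) \<in> pvm_integral M E"
  shows "(Q f, Q g) \<in> pvm_integral M E"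
proof -
  note L = orthogonal_projection_L2[OF Q]
  have dom: "Q f \<in> pvm_domain M E" if d: "f \<in> pvm_domain M E" for f
  proof (rule pvm_domain_le[OF d d, of _ 1 0])
    note f = pvm_domain_L2[OF d]
    show "Q f \<in> L2 M" by (rule L[OF f])
    fix \<sigma> :: "complex set" assume s: "\<sigma> \<in> sets borel"
    note Ef = E_L2[OF s f]
    have "energy \<sigma> (Q f) = (LINT x|M. (cmod (Q (E \<sigma> f) x))\<^sup>2)"
      unfolding energy_def
      by (rule norm_square_integral_cong[OF E_L2[OF s L[OF f]] L[OF Ef] comm[OF s f]])
    also have "\<dots> \<le> energy \<sigma> f"
      unfolding energy_def by (rule projection_norm_le[OF Q Ef])
    finally show "energy \<sigma> (Q f) \<le> 1 * energy \<sigma> f + 0 * energy \<sigma> f" by simp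
  qed auto
  have d: "f \<in> pvm_domain M E" and g: "g \<in> L2 M"
    and form: "\<And>k. k \<in> pvm_domain M E \<Longrightarrow> L2_inner M g k = pvm_form M E f k"
    using fg by (auto simp: pvm_integral_iff)
  note f = pvm_domain_L2[OF d]
  have "L2_inner M (Q g) k = pvm_form M E (Q f) k" if k: "k \<in> pvm_domain M E" for k
  proof -
    note kL = pvm_domain_L2[OF k]
    have "L2_inner M (Q g) k = L2_inner M g (Q k)" by (rule orthogonal_projection_sym[OF Q g kL])
    also have "\<dots> = pvm_form M E f (Q k)" by (rule form[OF dom[OF k]])
    also have "\<dots> = pvm_form M E (Q f) k"
    proof (rule pvm_form_cong[OF d dom[OF k] dom[OF d] k])
      fix \<sigma> :: "complex set" assume s: "\<sigma> \<in> sets borel"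
      note Ef = E_L2[OF s f]
      have "L2_inner M (E \<sigma> f) (Q k) = L2_inner M (Q (E \<sigma> f)) k"
        by (rule orthogonal_projection_sym[OF Q Ef kL, symmetric])
      also have "\<dots> = L2_inner M (E \<sigma> (Q f)) k"
        by (rule L2_inner_cong_left[OF E_L2[OF s L[OF f]] L[OF Ef] kL comm[OF s f], symmetric])
      finally show "L2_inner M (E \<sigma> f) (Q k) = L2_inner M (E \<sigma> (Q f)) k" .
    qed
    finally show ?thesis .
  qed
  then show ?thesis using dom[OF d] L[OF g] by (simp add: pvm_integral_iff)
qed

end

section \<open>Multiplication compressed to the range of a projection\<close>

text \<open>The spectral measure of \<open>q P\<close>: on the range of \<open>P\<close> it is that of the multiplication by \<open>q\<close>, and the
  orthogonal complement of the range belongs to the spectral value \<open>0\<close>.\<close>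

definition compressed_pvm :: "(('a \<Rightarrow> complex) \<Rightarrow> ('a \<Rightarrow> complex)) \<Rightarrow> ('a \<Rightarrow> real) \<Rightarrow> 'a L2_pvm" where
  "compressed_pvm P q \<sigma> f =
     (\<lambda>x. indicator \<sigma> (complex_of_real (q x)) * P f x + indicator \<sigma> 0 * (f x - P f x))"

lemma L2_inner_mult_real:
  "L2_inner M (\<lambda>x. complex_of_real (s x) * f x) g = L2_inner M f (\<lambda>x. complex_of_real (s x) * g x)"
  by (simp add: L2_inner_def algebra_simps)

text \<open>Invariance is required for all Borel functions of \<open>q\<close> and not only for the bounded ones: applied
  to the identity, it says that \<open>q P f\<close> lies in the range of \<open>P\<close>.\<close>

locale compressed_multiplication =
  fixes M :: "'a measure" and P :: "('a \<Rightarrow> complex) \<Rightarrow> ('a \<Rightarrow> complex)" and q :: "'a \<Rightarrow> real"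
  assumes P: "orthogonal_projection M P"
    and q [measurable]: "q \<in> borel_measurable M"
    and range_invariant: "\<And>s f. s \<in> borel_measurable borel \<Longrightarrow> f \<in> L2 M \<Longrightarrow>
      (\<lambda>x. complex_of_real (s (q x)) * P f x) \<in> L2 M \<Longrightarrow>
      AE x in M. P (\<lambda>x. complex_of_real (s (q x)) * P f x) x = complex_of_real (s (q x)) * P f x"
begin

lemma P_L2: "f \<in> L2 M \<Longrightarrow> P f \<in> L2 M"
  by (rule orthogonal_projection_L2[OF P])

text \<open>A bounded real multiplication is symmetric, and an invariant subspace of a symmetric operator
  reduces it.\<close>

lemma P_mult:
  assumes s [measurable]: "s \<in> borel_measurable borel" and b: "\<And>t. \<bar>s t\<bar> \<le> 1" and f: "f \<in> L2 M"
  shows "AE x in M. P (\<lambda>x. complex_of_real (s (q x)) * f x) x = complex_of_real (s (q x)) * P f x"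
proof (rule L2_eqI)
  have mult: "(\<lambda>x. complex_of_real (s (q x)) * g x) \<in> L2 M" if "g \<in> L2 M" for g
    by (rule L2_mult_bounded[OF that, of _ 1]) (auto simp: b)
  show "P (\<lambda>x. complex_of_real (s (q x)) * f x) \<in> L2 M" by (rule P_L2[OF mult[OF f]])
  show "(\<lambda>x. complex_of_real (s (q x)) * P f x) \<in> L2 M" by (rule mult[OF P_L2[OF f]])
  fix k assume k: "k \<in> L2 M"
  note Pf = P_L2[OF f] note Pk = P_L2[OF k]
  note sPf = mult[OF Pf] note sPk = mult[OF Pk]
  have "L2_inner M (P (\<lambda>x. complex_of_real (s (q x)) * f x)) k
      = L2_inner M (\<lambda>x. complex_of_real (s (q x)) * f x) (P k)"
    by (rule orthogonal_projection_sym[OF P mult[OF f] k])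
  also have "\<dots> = L2_inner M f (\<lambda>x. complex_of_real (s (q x)) * P k x)"
    by (rule L2_inner_mult_real)
  also have "\<dots> = L2_inner M f (P (\<lambda>x. complex_of_real (s (q x)) * P k x))"
    by (rule L2_inner_cong_right[OF P_L2[OF sPk] sPk f range_invariant[OF s k sPk], symmetric])
  also have "\<dots> = L2_inner M (P f) (\<lambda>x. complex_of_real (s (q x)) * P k x)"
    by (rule orthogonal_projection_sym[OF P f sPk, symmetric])
  also have "\<dots> = L2_inner M (\<lambda>x. complex_of_real (s (q x)) * P f x) (P k)"
    by (rule L2_inner_mult_real[symmetric])
  also have "\<dots> = L2_inner M (P (\<lambda>x. complex_of_real (s (q x)) * P f x)) k"
    by (rule orthogonal_projection_sym[OF P sPf k, symmetric])
  also have "\<dots> = L2_inner M (\<lambda>x. complex_of_real (s (q x)) * P f x) k"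
    by (rule L2_inner_cong_left[OF P_L2[OF sPf] sPf k range_invariant[OF s f sPf]])
  finally show "L2_inner M (P (\<lambda>x. complex_of_real (s (q x)) * f x)) k
      = L2_inner M (\<lambda>x. complex_of_real (s (q x)) * P f x) k" .
qed

abbreviation cut :: "complex set \<Rightarrow> 'a \<Rightarrow> complex" where
  "cut \<sigma> x \<equiv> indicator \<sigma> (complex_of_real (q x))"

lemma cut_of_real: "cut \<sigma> x = complex_of_real (indicator \<sigma> (complex_of_real (q x)))"
  by (simp add: indicator_def)

lemma cut_measurable [measurable]:
  assumes "\<sigma> \<in> sets borel"
  shows "cut \<sigma> \<in> borel_measurable M"
proof -
  have "(\<lambda>x. complex_of_real (q x)) \<in> borel_measurable M" by measurable
  from measurable_compose[OF this borel_measurable_indicator[OF assms]] show ?thesis .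
qed

lemma cut_L2: "\<sigma> \<in> sets borel \<Longrightarrow> f \<in> L2 M \<Longrightarrow> (\<lambda>x. cut \<sigma> x * f x) \<in> L2 M"
  by (rule L2_mult_bounded[of f M _ 1]) (auto simp: indicator_def)

lemma P_cut:
  assumes s: "\<sigma> \<in> sets borel" and f: "f \<in> L2 M"
  shows "AE x in M. P (\<lambda>x. cut \<sigma> x * f x) x = cut \<sigma> x * P f x"
proof -
  have "(\<lambda>t. indicator \<sigma> (complex_of_real t) :: real) \<in> borel_measurable borel"
    using s by measurable
  moreover have "\<bar>indicator \<sigma> (complex_of_real t) :: real\<bar> \<le> 1" for t
    by (simp add: indicator_def)
  ultimately show ?thesis unfolding cut_of_real by (rule P_mult[OF _ _ f])
qed

lemma compressed_pvm_L2: "\<sigma> \<in> sets borel \<Longrightarrow> f \<in> L2 M \<Longrightarrow> compressed_pvm P q \<sigma> f \<in> L2 M"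
  unfolding compressed_pvm_def by (intro L2_add cut_L2 L2_scale L2_diff P_L2)

lemma P_compressed_pvm:
  assumes s: "\<sigma> \<in> sets borel" and f: "f \<in> L2 M"
  shows "AE x in M. P (compressed_pvm P q \<sigma> f) x = cut \<sigma> x * P f x"
proof -
  note Pf = P_L2[OF f]
  have "AE x in M. P (\<lambda>x. 1 * (cut \<sigma> x * P f x) + indicator \<sigma> 0 * (f x - P f x)) x
      = 1 * P (\<lambda>x. cut \<sigma> x * P f x) x + indicator \<sigma> 0 * P (\<lambda>x. f x - P f x) x"
    by (rule orthogonal_projection_lin[OF P cut_L2[OF s Pf] L2_diff[OF f Pf]])
  then show ?thesis
    using P_cut[OF s Pf] orthogonal_projection_diff[OF P f Pf] orthogonal_projection_idem[OF P f]
    by eventually_elim (simp add: compressed_pvm_def)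
qed

lemma inner_compressed_pvm:
  assumes s: "\<sigma> \<in> sets borel" and f: "f \<in> L2 M" and g: "g \<in> L2 M"
  shows "L2_inner M (compressed_pvm P q \<sigma> f) g =
    L2_inner M (\<lambda>x. cut \<sigma> x * P f x) (P g) + indicator \<sigma> 0 * (L2_inner M f g - L2_inner M (P f) g)"
proof -
  note Pf = P_L2[OF f] note cPf = cut_L2[OF s Pf]
  have "L2_inner M (compressed_pvm P q \<sigma> f) g =
      L2_inner M (\<lambda>x. cut \<sigma> x * P f x) g + indicator \<sigma> 0 * L2_inner M (\<lambda>x. f x - P f x) g"
    using L2_inner_lin_left[OF cPf L2_diff[OF f Pf] g, of 1 "indicator \<sigma> 0"]
    by (simp add: compressed_pvm_def)
  also have "L2_inner M (\<lambda>x. f x - P f x) g = L2_inner M f g - L2_inner M (P f) g"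
    by (rule L2_inner_diff_left[OF f Pf g])
  also have "L2_inner M (\<lambda>x. cut \<sigma> x * P f x) g = L2_inner M (P (\<lambda>x. cut \<sigma> x * P f x)) g"
  proof (rule L2_inner_cong_left[OF cPf P_L2[OF cPf] g])
    show "AE x in M. cut \<sigma> x * P f x = P (\<lambda>x. cut \<sigma> x * P f x) x"
      using P_cut[OF s Pf] orthogonal_projection_idem[OF P f] by eventually_elim simp
  qed
  also have "\<dots> = L2_inner M (\<lambda>x. cut \<sigma> x * P f x) (P g)"
    by (rule orthogonal_projection_sym[OF P cPf g])
  finally show ?thesis .
qed

lemma compressed_pvm_projection:
  assumes s: "\<sigma> \<in> sets borel"
  shows "orthogonal_projection M (compressed_pvm P q \<sigma>)"
  unfolding orthogonal_projection_def
proof (intro conjI ballI allI)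
  fix f assume f: "f \<in> L2 M"
  show "compressed_pvm P q \<sigma> f \<in> L2 M" by (rule compressed_pvm_L2[OF s f])
  have "AE x in M. compressed_pvm P q \<sigma> (compressed_pvm P q \<sigma> f) x =
      cut \<sigma> x * P (compressed_pvm P q \<sigma> f) x
        + indicator \<sigma> 0 * (compressed_pvm P q \<sigma> f x - P (compressed_pvm P q \<sigma> f) x)"
    by (simp add: compressed_pvm_def[of P q \<sigma> "compressed_pvm P q \<sigma> f"])
  then show "AE x in M. compressed_pvm P q \<sigma> (compressed_pvm P q \<sigma> f) x = compressed_pvm P q \<sigma> f x"
    using P_compressed_pvm[OF s f] by eventually_elim (simp add: compressed_pvm_def indicator_def)
  fix g assume g: "g \<in> L2 M"
  show "AE x in M. compressed_pvm P q \<sigma> (\<lambda>x. a * f x + b * g x) x =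
      a * compressed_pvm P q \<sigma> f x + b * compressed_pvm P q \<sigma> g x" for a b
    using orthogonal_projection_lin[OF P f g, of a b]
    by eventually_elim (simp add: compressed_pvm_def algebra_simps)
  have "L2_inner M f (compressed_pvm P q \<sigma> g) = cnj (L2_inner M (compressed_pvm P q \<sigma> g) f)"
    by (rule L2_inner_cnj)
  also have "\<dots> = L2_inner M (P f) (\<lambda>x. cut \<sigma> x * P g x) + indicator \<sigma> 0 * (L2_inner M f g - L2_inner M f (P g))"
    unfolding inner_compressed_pvm[OF s g f] by (simp add: indicator_def flip: L2_inner_cnj)
  also have "L2_inner M (P f) (\<lambda>x. cut \<sigma> x * P g x) = L2_inner M (\<lambda>x. cut \<sigma> x * P f x) (P g)"
    unfolding cut_of_real by (rule L2_inner_mult_real[symmetric])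
  also have "L2_inner M f (P g) = L2_inner M (P f) g"
    by (rule orthogonal_projection_sym[OF P f g, symmetric])
  finally show "L2_inner M (compressed_pvm P q \<sigma> f) g = L2_inner M f (compressed_pvm P q \<sigma> g)"
    by (simp add: inner_compressed_pvm[OF s f g])
qed

text \<open>The scalar measure of \<open>f\<close> is the image of \<open>|P f|\<^sup>2 M\<close> under \<open>q\<close> plus a point mass \<open>\<parallel>f - P f\<parallel>\<^sup>2\<close> at the
  origin. The point mass is also written as an image measure, so that the same rules compute
  both integrals.\<close>

definition range_part :: "('a \<Rightarrow> complex) \<Rightarrow> complex measure" where
  "range_part f = distr (density M (\<lambda>x. ennreal ((cmod (P f x))\<^sup>2))) borel (\<lambda>x. complex_of_real (q x))"

definition kernel_part :: "('a \<Rightarrow> complex) \<Rightarrow> complex measure" where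
  "kernel_part f = distr (density M (\<lambda>x. ennreal ((cmod (f x - P f x))\<^sup>2))) borel (\<lambda>_. 0)"

lemma sets_parts [simp, measurable_cong]:
  "sets (range_part f) = sets borel" "sets (kernel_part f) = sets borel"
  by (simp_all add: range_part_def kernel_part_def)

lemma emeasure_range_part:
  assumes f: "f \<in> L2 M" and s: "\<sigma> \<in> sets borel"
  shows "emeasure (range_part f) \<sigma> = ennreal (Re (L2_inner M (\<lambda>x. cut \<sigma> x * P f x) (P f)))"
proof -
  note Pf = P_L2[OF f]
  have m [measurable]: "P f \<in> borel_measurable M" by (rule L2_measurable[OF Pf])
  let ?S = "(\<lambda>x. complex_of_real (q x)) -` \<sigma> \<inter> space M"
  have S: "?S \<in> sets M" using s by measurable
  have "emeasure (range_part f) \<sigma> = (\<integral>\<^sup>+x. ennreal ((cmod (P f x))\<^sup>2) * indicator ?S x \<partial>M)"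
    unfolding range_part_def using s S by (simp add: emeasure_distr emeasure_density)
  also have "\<dots> = (\<integral>\<^sup>+x. ennreal (Re (cut \<sigma> x * P f x * cnj (P f x))) \<partial>M)"
  proof (intro nn_integral_cong)
    fix x assume x: "x \<in> space M"
    have "cut \<sigma> x * P f x * cnj (P f x) = complex_of_real (indicator \<sigma> (complex_of_real (q x)) * (cmod (P f x))\<^sup>2)"
      by (simp only: mult.assoc complex_norm_square[symmetric] cut_of_real of_real_mult)
    then have "Re (cut \<sigma> x * P f x * cnj (P f x)) = indicator \<sigma> (complex_of_real (q x)) * (cmod (P f x))\<^sup>2"
      by (simp only: Re_complex_of_real)
    with x show "ennreal ((cmod (P f x))\<^sup>2) * indicator ?S x = ennreal (Re (cut \<sigma> x * P f x * cnj (P f x)))"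
      by (simp only:) (simp add: indicator_def)
  qed
  also have "\<dots> = ennreal (LINT x|M. Re (cut \<sigma> x * P f x * cnj (P f x)))"
  proof (rule nn_integral_eq_integral)
    show "integrable M (\<lambda>x. Re (cut \<sigma> x * P f x * cnj (P f x)))"
      by (rule integrable_Re[OF L2_integrable_inner[OF cut_L2[OF s Pf] Pf]])
    have "0 \<le> Re (cut \<sigma> x * P f x * cnj (P f x))" for x
      by (simp add: indicator_def)
    then show "AE x in M. 0 \<le> Re (cut \<sigma> x * P f x * cnj (P f x))" by simp
  qed
  also have "(LINT x|M. Re (cut \<sigma> x * P f x * cnj (P f x))) = Re (L2_inner M (\<lambda>x. cut \<sigma> x * P f x) (P f))"
    unfolding L2_inner_def by (rule integral_Re[OF L2_integrable_inner[OF cut_L2[OF s Pf] Pf]])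
  finally show ?thesis .
qed

lemma emeasure_kernel_part:
  assumes f: "f \<in> L2 M" and s: "\<sigma> \<in> sets borel"
  shows "emeasure (kernel_part f) \<sigma> = ennreal (indicator \<sigma> 0 * (LINT x|M. (cmod (f x - P f x))\<^sup>2))"
proof -
  have d: "(\<lambda>x. f x - P f x) \<in> L2 M" by (rule L2_diff[OF f P_L2[OF f]])
  have [measurable]: "(\<lambda>x. f x - P f x) \<in> borel_measurable M" by (rule L2_measurable[OF d])
  have e: "(\<integral>\<^sup>+x. ennreal ((cmod (f x - P f x))\<^sup>2) \<partial>M) = ennreal (LINT x|M. (cmod (f x - P f x))\<^sup>2)"
    by (rule nn_integral_eq_integral[OF L2_integrable[OF d]]) simp
  have "emeasure (kernel_part f) \<sigma> =
      emeasure (density M (\<lambda>x. ennreal ((cmod (f x - P f x))\<^sup>2))) ((\<lambda>_. 0) -` \<sigma> \<inter> space M)"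
    unfolding kernel_part_def using s by (simp add: emeasure_distr)
  also have "\<dots> = (\<integral>\<^sup>+x. indicator \<sigma> (0::complex) * ennreal ((cmod (f x - P f x))\<^sup>2) \<partial>M)"
    using s by (subst emeasure_density) (auto intro!: nn_integral_cong simp: indicator_def)
  also have "\<dots> = indicator \<sigma> (0::complex) * ennreal (LINT x|M. (cmod (f x - P f x))\<^sup>2)"
    by (subst nn_integral_cmult) (auto simp: e)
  finally show ?thesis by (simp add: indicator_def)
qed

lemma compressed_pvm_scalar:
  assumes f: "f \<in> L2 M" and s: "\<sigma> \<in> sets borel"
  shows "pvm_scalar M (compressed_pvm P q) f \<sigma> = emeasure (range_part f) \<sigma> + emeasure (kernel_part f) \<sigma>"
proof -
  note Pf = P_L2[OF f]
  have 1: "L2_inner M f f - L2_inner M (P f) f = complex_of_real (LINT x|M. (cmod (f x - P f x))\<^sup>2)"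
    unfolding projection_residual[OF P f] projection_inner_self[OF P f] L2_inner_self by simp
  have "Re (L2_inner M (compressed_pvm P q \<sigma> f) f) = Re (L2_inner M (\<lambda>x. cut \<sigma> x * P f x) (P f))
      + indicator \<sigma> 0 * (LINT x|M. (cmod (f x - P f x))\<^sup>2)"
    unfolding inner_compressed_pvm[OF s f f] 1 by (simp add: indicator_def)
  moreover have "0 \<le> Re (L2_inner M (\<lambda>x. cut \<sigma> x * P f x) (P f))"
  proof -
    have "Re (L2_inner M (\<lambda>x. cut \<sigma> x * P f x) (P f)) = (LINT x|M. Re (cut \<sigma> x * P f x * cnj (P f x)))"
      unfolding L2_inner_def by (rule integral_Re[OF L2_integrable_inner[OF cut_L2[OF s Pf] Pf], symmetric])
    also have "\<dots> \<ge> 0"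
    proof (rule integral_nonneg_AE)
      have "0 \<le> Re (cut \<sigma> x * P f x * cnj (P f x))" for x
        by (simp add: indicator_def)
      then show "AE x in M. 0 \<le> Re (cut \<sigma> x * P f x * cnj (P f x))" by simp
    qed
    finally show ?thesis .
  qed
  moreover have "0 \<le> indicator \<sigma> 0 * (LINT x|M. (cmod (f x - P f x))\<^sup>2)" by simp
  ultimately show ?thesis
    unfolding pvm_scalar_def emeasure_range_part[OF f s] emeasure_kernel_part[OF f s]
    by (simp only: ennreal_plus)
qed

lemma spectral_measure_compressed_pvm: "spectral_measure M (compressed_pvm P q)"
  unfolding spectral_measure_def
proof (intro conjI ballI)
  show "orthogonal_projection M (compressed_pvm P q \<sigma>)" if "\<sigma> \<in> sets borel" for \<sigma>
    by (rule compressed_pvm_projection[OF that])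
  show "AE x in M. compressed_pvm P q UNIV f x = f x" for f
    by (simp add: compressed_pvm_def)
  fix f assume f: "f \<in> L2 M"
  show "measure_space UNIV (sets borel) (pvm_scalar M (compressed_pvm P q) f)"
    unfolding measure_space_def
  proof (intro conjI)
    show "sigma_algebra UNIV (sets (borel :: complex measure))"
      using sets.sigma_algebra_axioms[of borel] by simp
    show "positive (sets borel) (pvm_scalar M (compressed_pvm P q) f)"
      by (simp add: positive_def compressed_pvm_scalar[OF f])
    show "countably_additive (sets borel) (pvm_scalar M (compressed_pvm P q) f)"
      unfolding countably_additive_def
    proof (intro allI impI)
      fix A :: "nat \<Rightarrow> complex set"
      assume A: "range A \<subseteq> sets borel" "disjoint_family A" "\<Union> (range A) \<in> sets borel"
      have Ai: "A i \<in> sets borel" for i using A(1) by auto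
      have "(\<Sum>i. pvm_scalar M (compressed_pvm P q) f (A i)) =
          (\<Sum>i. emeasure (range_part f) (A i) + emeasure (kernel_part f) (A i))"
        by (simp add: compressed_pvm_scalar[OF f Ai])
      also have "\<dots> = (\<Sum>i. emeasure (range_part f) (A i)) + (\<Sum>i. emeasure (kernel_part f) (A i))"
        by (rule suminf_add[symmetric]) (rule summableI)+
      also have "\<dots> = emeasure (range_part f) (\<Union> (range A)) + emeasure (kernel_part f) (\<Union> (range A))"
        using A by (simp add: suminf_emeasure)
      also have "\<dots> = pvm_scalar M (compressed_pvm P q) f (\<Union> (range A))"
        by (rule compressed_pvm_scalar[OF f A(3), symmetric])
      finally show "(\<Sum>i. pvm_scalar M (compressed_pvm P q) f (A i)) =
        pvm_scalar M (compressed_pvm P q) f (\<Union> (range A))" .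
    qed
  qed
qed

sublocale L2_spectral_measure M "compressed_pvm P q"
  by unfold_locales (rule spectral_measure_compressed_pvm)

lemma emeasure_nu_compressed:
  assumes f: "f \<in> L2 M" and s: "\<sigma> \<in> sets borel"
  shows "emeasure (\<nu> f) \<sigma> = emeasure (range_part f) \<sigma> + emeasure (kernel_part f) \<sigma>"
  unfolding compressed_pvm_scalar[OF f s, symmetric] pvm_scalar_def inner_energy[OF s f] emeasure_nu[OF f s] by simp

lemma nn_integral_nu_compressed:
  assumes f: "f \<in> L2 M" and g [measurable]: "g \<in> borel_measurable borel"
  shows "nn_integral (\<nu> f) g = (\<integral>\<^sup>+x. ennreal ((cmod (P f x))\<^sup>2) * g (complex_of_real (q x)) \<partial>M)
    + (\<integral>\<^sup>+x. ennreal ((cmod (f x - P f x))\<^sup>2) * g 0 \<partial>M)"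
proof -
  have [measurable]: "P f \<in> borel_measurable M" "(\<lambda>x. f x - P f x) \<in> borel_measurable M"
    by (rule L2_measurable[OF P_L2[OF f]], rule L2_measurable[OF L2_diff[OF f P_L2[OF f]]])
  have "nn_integral (\<nu> f) g + nn_integral (null_measure borel) g =
      nn_integral (range_part f) g + nn_integral (kernel_part f) g"
    by (rule nn_integral_add_measures_eq[where K = borel]) (auto simp: emeasure_nu_compressed[OF f])
  also have "nn_integral (range_part f) g = (\<integral>\<^sup>+x. ennreal ((cmod (P f x))\<^sup>2) * g (complex_of_real (q x)) \<partial>M)"
    unfolding range_part_def by (simp add: nn_integral_distr nn_integral_density)
  also have "nn_integral (kernel_part f) g = (\<integral>\<^sup>+x. ennreal ((cmod (f x - P f x))\<^sup>2) * g 0 \<partial>M)"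
    unfolding kernel_part_def
    by (subst nn_integral_distr) (simp_all add: nn_integral_density del: nn_integral_const)
  finally show ?thesis by simp
qed

lemma pvm_domain_compressed:
  "f \<in> pvm_domain M (compressed_pvm P q) \<longleftrightarrow> f \<in> L2 M \<and> (\<lambda>x. complex_of_real (q x) * P f x) \<in> L2 M"
proof (cases "f \<in> L2 M")
  case True
  have [measurable]: "P f \<in> borel_measurable M" by (rule L2_measurable[OF P_L2[OF True]])
  have m: "(\<lambda>x. complex_of_real (q x) * P f x) \<in> borel_measurable M" by measurable
  have "(\<integral>\<^sup>+z. ennreal ((cmod z)\<^sup>2) \<partial>\<nu> f) = (\<integral>\<^sup>+x. ennreal ((cmod (complex_of_real (q x) * P f x))\<^sup>2) \<partial>M)"
    using nn_integral_nu_compressed[OF True, of "\<lambda>z. ennreal ((cmod z)\<^sup>2)"]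
    by (simp add: norm_mult power_mult_distrib ennreal_mult mult.commute)
  then show ?thesis using True by (simp add: pvm_domain_iff L2_iff_nn[OF m])
qed (simp add: pvm_domain_iff)

lemma integral_nu_compressed:
  assumes d: "f \<in> pvm_domain M (compressed_pvm P q)"
  shows "(LINT z|\<nu> f. z) = L2_inner M (\<lambda>x. complex_of_real (q x) * P f x) (P f)"
proof -
  have f: "f \<in> L2 M" and qPf: "(\<lambda>x. complex_of_real (q x) * P f x) \<in> L2 M"
    using d by (auto simp: pvm_domain_compressed)
  have [measurable]: "P f \<in> borel_measurable M" "(\<lambda>x. f x - P f x) \<in> borel_measurable M"
    by (rule L2_measurable[OF P_L2[OF f]], rule L2_measurable[OF L2_diff[OF f P_L2[OF f]]])
  have e: "complex_of_real (q x) * P f x * cnj (P f x) = (cmod (P f x))\<^sup>2 *\<^sub>R complex_of_real (q x)" for x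
    using complex_norm_square[of "P f x"] by (simp add: scaleR_conv_of_real mult.assoc mult.commute)
  have i1: "integrable (range_part f) (\<lambda>z. z)"
    using L2_integrable_inner[OF qPf P_L2[OF f]] unfolding range_part_def e
    by (simp add: integrable_distr_eq integrable_density)
  have i0: "integrable (null_measure borel) (\<lambda>z::complex. z)"
    by (simp add: integrable_iff_bounded)
  have i2: "integrable (kernel_part f) (\<lambda>z. z)"
    unfolding kernel_part_def by (simp add: integrable_distr_eq)
  have "integral\<^sup>L (\<nu> f) (\<lambda>z. z) + integral\<^sup>L (null_measure borel) (\<lambda>z. z) =
      integral\<^sup>L (range_part f) (\<lambda>z. z) + integral\<^sup>L (kernel_part f) (\<lambda>z. z)"
    by (rule integral_add_measures_eq[where K = borel])
       (simp_all add: emeasure_nu_compressed[OF f] i0 i1 i2 integrable_nu[OF d])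
  also have "integral\<^sup>L (range_part f) (\<lambda>z. z) = L2_inner M (\<lambda>x. complex_of_real (q x) * P f x) (P f)"
    unfolding range_part_def L2_inner_def e
    by (simp add: integral_distr integral_density scaleR_conv_of_real
        flip: of_real_mult of_real_power)
  also have "integral\<^sup>L (kernel_part f) (\<lambda>z. z) = 0"
    unfolding kernel_part_def by (simp add: integral_distr)
  finally show ?thesis by simp
qed

lemma pvm_form_compressed:
  assumes f: "f \<in> pvm_domain M (compressed_pvm P q)" and k: "k \<in> pvm_domain M (compressed_pvm P q)"
  shows "pvm_form M (compressed_pvm P q) f k = L2_inner M (\<lambda>x. complex_of_real (q x) * P f x) (P k)"
proof -
  have fL: "f \<in> L2 M" and qf: "(\<lambda>x. complex_of_real (q x) * P f x) \<in> L2 M" (is "?qf \<in> _")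
    and kL: "k \<in> L2 M" and qk: "(\<lambda>x. complex_of_real (q x) * P k x) \<in> L2 M" (is "?qk \<in> _")
    using f k by (auto simp: pvm_domain_compressed)
  note Pf = P_L2[OF fL] note Pk = P_L2[OF kL]
  have e: "(LINT z|\<nu> (\<lambda>x. f x + c * k x). z) =
     L2_inner M ?qf (P f) + cnj c * L2_inner M ?qf (P k) + c * L2_inner M ?qk (P f) + c * cnj c * L2_inner M ?qk (P k)" for c
  proof -
    let ?g = "\<lambda>x. f x + c * k x"
    have g: "?g \<in> pvm_domain M (compressed_pvm P q)" by (rule pvm_domain_add_scaled[OF f k])
    then have gL: "?g \<in> L2 M" and qg: "(\<lambda>x. complex_of_real (q x) * P ?g x) \<in> L2 M" by (auto simp: pvm_domain_compressed)
    have l: "AE x in M. P ?g x = 1 * P f x + c * P k x"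
      using orthogonal_projection_lin[OF P fL kL, of 1 c] by simp
    have ql: "AE x in M. complex_of_real (q x) * P ?g x = 1 * ?qf x + c * ?qk x"
      using l by eventually_elim (simp add: algebra_simps)
    have "(LINT z|\<nu> ?g. z) = L2_inner M (\<lambda>x. complex_of_real (q x) * P ?g x) (P ?g)"
      by (rule integral_nu_compressed[OF g])
    also have "\<dots> = L2_inner M (\<lambda>x. 1 * ?qf x + c * ?qk x) (P ?g)"
      by (rule L2_inner_cong_left[OF qg L2_lin[OF qf qk] P_L2[OF gL] ql])
    also have "\<dots> = L2_inner M (\<lambda>x. 1 * ?qf x + c * ?qk x) (\<lambda>x. 1 * P f x + c * P k x)"
      by (rule L2_inner_cong_right[OF P_L2[OF gL] L2_lin[OF Pf Pk] L2_lin[OF qf qk] l])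
    also have "\<dots> = L2_inner M ?qf (\<lambda>x. 1 * P f x + c * P k x) + c * L2_inner M ?qk (\<lambda>x. 1 * P f x + c * P k x)"
      using L2_inner_lin_left[OF qf qk L2_lin[OF Pf Pk, of 1 c], of 1 c] by simp
    also have "L2_inner M ?qf (\<lambda>x. 1 * P f x + c * P k x) = L2_inner M ?qf (P f) + cnj c * L2_inner M ?qf (P k)"
      using L2_inner_lin_right[OF Pf Pk qf, of 1 c] by simp
    also have "L2_inner M ?qk (\<lambda>x. 1 * P f x + c * P k x) = L2_inner M ?qk (P f) + cnj c * L2_inner M ?qk (P k)"
      using L2_inner_lin_right[OF Pf Pk qk, of 1 c] by simp
    finally show ?thesis by (simp add: algebra_simps)
  qed
  show ?thesis
    unfolding pvm_form_def e sum_below_4 i_power_3 by (simp add: algebra_simps)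
qed

text \<open>On the domain the polarized integral is \<open>k \<mapsto> \<langle>q P f, k\<rangle>\<close>. To conclude \<open>g = q P f\<close>, the difference \<open>a\<close>
  is tested against its own truncations \<open>F(\<sigma>)a\<close> to balls \<open>\<sigma>\<close>, which belong to the domain since \<open>q\<close> is bounded
  where \<open>P F(\<sigma>)a\<close> does not vanish.\<close>

lemma pvm_integral_compressed:
  "pvm_integral M (compressed_pvm P q) =
    {(f, g). f \<in> L2 M \<and> (\<lambda>x. complex_of_real (q x) * P f x) \<in> L2 M \<and> g \<in> L2 M \<and>
       (AE x in M. g x = complex_of_real (q x) * P f x)}"
proof -
  have *: "(\<forall>k\<in>pvm_domain M (compressed_pvm P q). L2_inner M g k = pvm_form M (compressed_pvm P q) f k)
      \<longleftrightarrow> (AE x in M. g x = complex_of_real (q x) * P f x)"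
    if d: "f \<in> pvm_domain M (compressed_pvm P q)" and g: "g \<in> L2 M" for f g
  proof -
    have f: "f \<in> L2 M" and qf: "(\<lambda>x. complex_of_real (q x) * P f x) \<in> L2 M" (is "?qf \<in> _")
      using d by (auto simp: pvm_domain_compressed)
    have form: "pvm_form M (compressed_pvm P q) f k = L2_inner M ?qf k"
      if k: "k \<in> pvm_domain M (compressed_pvm P q)" for k
    proof -
      have kL: "k \<in> L2 M" using k by (simp add: pvm_domain_compressed)
      have "L2_inner M ?qf (P k) = L2_inner M (P ?qf) k"
        by (rule orthogonal_projection_sym[OF P qf kL, symmetric])
      also have "\<dots> = L2_inner M ?qf k"
        by (rule L2_inner_cong_left[OF P_L2[OF qf] qf kL range_invariant[of "\<lambda>t. t", OF _ f qf]]) simp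
      finally show ?thesis by (simp add: pvm_form_compressed[OF d k])
    qed
    show ?thesis
    proof
      assume "AE x in M. g x = ?qf x"
      then show "\<forall>k\<in>pvm_domain M (compressed_pvm P q). L2_inner M g k = pvm_form M (compressed_pvm P q) f k"
        by (auto simp: form intro!: L2_inner_cong_left[OF g qf] pvm_domain_L2)
    next
      assume eq: "\<forall>k\<in>pvm_domain M (compressed_pvm P q). L2_inner M g k = pvm_form M (compressed_pvm P q) f k"
      let ?a = "\<lambda>x. g x - ?qf x"
      have a: "?a \<in> L2 M" by (rule L2_diff[OF g qf])
      have "emeasure (\<nu> ?a) (cball 0 (real n)) = 0" for n
      proof -
        let ?k = "compressed_pvm P q (cball 0 (real n)) ?a"
        have s: "cball 0 (real n) \<in> sets (borel :: complex measure)" by simp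
        have kL: "?k \<in> L2 M" by (rule compressed_pvm_L2[OF s a])
        have [measurable]: "P ?k \<in> borel_measurable M" by (rule L2_measurable[OF P_L2[OF kL]])
        have "(\<lambda>x. complex_of_real (q x) * P ?k x) \<in> L2 M"
        proof (rule L2_bound[OF P_L2[OF kL]])
          show "AE x in M. cmod (complex_of_real (q x) * P ?k x) \<le> real n * cmod (P ?k x)"
            using P_compressed_pvm[OF s a]
            by eventually_elim (auto simp: norm_mult indicator_def intro!: mult_right_mono)
        qed measurable
        with kL have k: "?k \<in> pvm_domain M (compressed_pvm P q)" by (simp add: pvm_domain_compressed)
        have "L2_inner M ?a ?k = 0"
          using eq k by (simp add: form L2_inner_diff_left[OF g qf kL])
        then have "L2_inner M ?k ?a = 0" by (subst L2_inner_cnj) simp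
        then have "energy (cball 0 (real n)) ?a = 0" using inner_energy[OF s a] by simp
        then show ?thesis by (simp add: emeasure_nu[OF a s])
      qed
      then have "emeasure (\<nu> ?a) (\<Union>n. cball 0 (real n)) = 0"
        by (intro emeasure_UN_eq_0) auto
      moreover have "(\<Union>n. cball 0 (real n)) = (UNIV :: complex set)"
        using real_arch_simple by (auto simp: dist_norm)
      ultimately have "energy UNIV ?a = 0"
        by (simp add: emeasure_nu[OF a] antisym)
      then have "AE x in M. ?a x = 0"
        unfolding energy_UNIV[OF a] by (rule norm_square_integral_eq_0D[OF a])
      then show "AE x in M. g x = ?qf x" by eventually_elim simp
    qed
  qed
  show ?thesis
  proof (intro set_eqI)
    fix p
    show "p \<in> pvm_integral M (compressed_pvm P q) \<longleftrightarrow> p \<in> {(f, g). f \<in> L2 M \<and>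
       (\<lambda>x. complex_of_real (q x) * P f x) \<in> L2 M \<and> g \<in> L2 M \<and> (AE x in M. g x = complex_of_real (q x) * P f x)}"
      using *[of "fst p" "snd p"] pvm_domain_compressed[of "fst p"]
      by (cases p) (auto simp: pvm_integral_iff)
  qed
qed

end

section \<open>Weighted composition operators\<close>

lemma L2_norm_AE_subseq:
  assumes F: "\<And>n. F n \<in> L2 M" and f: "f \<in> L2 M"
    and lim: "(\<lambda>n. L2_norm M (\<lambda>x. F n x - f x)) \<longlonglongrightarrow> 0"
  shows "\<exists>r::nat \<Rightarrow> nat. strict_mono r \<and> (AE x in M. (\<lambda>n. F (r n) x) \<longlonglongrightarrow> f x)"
proof -
  have "(\<lambda>n. (L2_norm M (\<lambda>x. F n x - f x))\<^sup>2) \<longlonglongrightarrow> 0\<^sup>2"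
    by (intro tendsto_power lim)
  then have "(\<lambda>n. LINT x|M. norm ((cmod (F n x - f x))\<^sup>2)) \<longlonglongrightarrow> 0"
    by (simp add: L2_norm_def)
  from tendsto_L1_AE_subseq[OF L2_integrable[OF L2_diff[OF F f]] this]
  obtain r where r: "strict_mono r" "AE x in M. (\<lambda>n. (cmod (F (r n) x - f x))\<^sup>2) \<longlonglongrightarrow> 0" by auto
  have "AE x in M. (\<lambda>n. F (r n) x) \<longlonglongrightarrow> f x"
    using r(2)
  proof eventually_elim
    case (elim x)
    then have "(\<lambda>n. sqrt ((cmod (F (r n) x - f x))\<^sup>2)) \<longlonglongrightarrow> sqrt 0" by (intro tendsto_real_sqrt)
    then have "(\<lambda>n. F (r n) x - f x) \<longlonglongrightarrow> 0" by (simp add: tendsto_norm_zero_iff)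
    then show ?case by (simp add: LIM_zero_iff)
  qed
  with r(1) show ?thesis by blast
qed

locale weighted_composition = sigma_finite_measure M
  for M :: "'a measure" +
  fixes \<phi> :: "'a \<Rightarrow> 'a" and w :: "'a \<Rightarrow> complex"
  assumes phi [measurable]: "\<phi> \<in> M \<rightarrow>\<^sub>M M"
    and w [measurable]: "w \<in> borel_measurable M"
    and ac: "absolutely_continuous M (distr (weighted_measure M w) M \<phi>)"
    and dense: "densely_defined M (weighted_comp_op M \<phi> w)"
begin

abbreviation N :: "'a measure" where "N \<equiv> weighted_measure M w"
abbreviation T :: "'a L2_op" where "T \<equiv> weighted_comp_op M \<phi> w"
abbreviation h :: "'a \<Rightarrow> ennreal" where "h \<equiv> h_wco M \<phi> w"

text \<open>A real-valued version of \<open>h\<close>, equal to it almost everywhere by lemma \<open>h_eq_r\<close> below.\<close>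

definition r :: "'a \<Rightarrow> real" where "r x = enn2real (h x)"

lemma sets_N [simp, measurable_cong]: "sets N = sets M"
  by (simp add: weighted_measure_def)

lemma space_N [simp]: "space N = space M"
  by (simp add: weighted_measure_def)

lemma h_measurable [measurable]: "h \<in> borel_measurable M"
  by (simp add: h_wco_def)

lemma r_measurable [measurable]: "r \<in> borel_measurable M"
  unfolding r_def[abs_def] by measurable

lemma r_nonneg [simp]: "0 \<le> r x"
  by (simp add: r_def)

lemma density_h: "density M h = distr N M \<phi>"
  unfolding h_wco_def by (rule density_RN_deriv[OF ac]) simp

lemma AE_N_iff: "(AE x in N. Q x) \<longleftrightarrow> (AE x in M. w x \<noteq> 0 \<longrightarrow> Q x)"
  unfolding weighted_measure_def by (simp add: AE_density)

text \<open>Absolute continuity lets statements that hold almost everywhere be composed with \<open>\<phi>\<close>, at the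
  price of a restriction to the set where \<open>w \<noteq> 0\<close>.\<close>

lemma AE_phi:
  assumes "AE y in M. Q y"
  shows "AE x in M. w x \<noteq> 0 \<longrightarrow> Q (\<phi> x)"
proof -
  have "AE y in distr N M \<phi>. Q y"
    by (rule absolutely_continuous_AE[OF _ ac assms]) simp
  then have "AE x in N. Q (\<phi> x)"
    by (rule AE_distrD[rotated]) simp
  then show ?thesis by (simp add: AE_N_iff)
qed

lemma nn_integral_N: "g \<in> borel_measurable M \<Longrightarrow>
    (\<integral>\<^sup>+x. g x \<partial>N) = (\<integral>\<^sup>+x. ennreal ((cmod (w x))\<^sup>2) * g x \<partial>M)"
  unfolding weighted_measure_def by (simp add: nn_integral_density)

lemma nn_integral_phi_h:
  assumes [measurable]: "g \<in> borel_measurable M"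
  shows "(\<integral>\<^sup>+x. ennreal ((cmod (w x))\<^sup>2) * g (\<phi> x) \<partial>M) = (\<integral>\<^sup>+x. h x * g x \<partial>M)"
proof -
  have "(\<integral>\<^sup>+x. h x * g x \<partial>M) = nn_integral (density M h) g" by (simp add: nn_integral_density)
  also have "\<dots> = (\<integral>\<^sup>+x. g (\<phi> x) \<partial>N)" unfolding density_h by (simp add: nn_integral_distr)
  finally show ?thesis by (simp add: nn_integral_N)
qed

lemma T_domain_zero_on_infinite:
  assumes "(f, g) \<in> T"
  shows "AE x in M. h x = \<infinity> \<longrightarrow> f x = 0"
proof -
  have f: "f \<in> L2 M" and wf: "(\<lambda>x. w x * f (\<phi> x)) \<in> L2 M"
    using assms by (auto simp: weighted_comp_op_def)
  have m [measurable]: "f \<in> borel_measurable M" by (rule L2_measurable[OF f])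
  have "(\<integral>\<^sup>+x. h x * ennreal ((cmod (f x))\<^sup>2) \<partial>M) = (\<integral>\<^sup>+x. ennreal ((cmod (w x * f (\<phi> x)))\<^sup>2) \<partial>M)"
    by (subst nn_integral_phi_h[symmetric]) (simp_all add: norm_mult power_mult_distrib ennreal_mult)
  also have "\<dots> < \<infinity>"
    using wf L2_iff_nn[OF L2_measurable[OF wf]] by simp
  finally have "AE x in M. h x * ennreal ((cmod (f x))\<^sup>2) \<noteq> \<infinity>"
    by (intro nn_integral_PInf_AE) auto
  then show ?thesis
    by eventually_elim (auto simp: ennreal_top_mult split: if_splits)
qed

text \<open>A vector of the domain vanishes where \<open>h = \<infinity>\<close>, so that it stays at distance at least
  \<open>\<parallel>1\<^sub>A\<parallel>\<close> from the indicator of any subset \<open>A\<close> of this set.\<close>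

lemma h_finite: "AE x in M. h x \<noteq> \<infinity>"
proof -
  let ?S = "{x \<in> space M. h x = \<infinity>}"
  have S: "?S \<in> sets M" by measurable
  obtain A :: "nat \<Rightarrow> 'a set" where A: "range A \<subseteq> sets M" "(\<Union>i. A i) = space M" "\<And>i. emeasure M (A i) \<noteq> \<infinity>"
    using sigma_finite_incseq by metis
  have Ai: "A i \<in> sets M" for i using A(1) by auto
  have null: "emeasure M (?S \<inter> A i) = 0" for i
  proof (rule ccontr)
    let ?B = "?S \<inter> A i"
    assume nz: "emeasure M ?B \<noteq> 0"
    have B: "?B \<in> sets M" using S Ai by blast
    have "emeasure M ?B \<le> emeasure M (A i)" by (rule emeasure_mono) (use Ai in auto)
    then have fin: "emeasure M ?B < \<infinity>" using A(3)[of i] by (auto simp: less_top top_unique)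
    have pos: "0 < measure M ?B"
      using nz fin by (simp add: measure_def enn2real_positive_iff less_top zero_less_iff_neq_zero)
    let ?f = "indicator ?B :: 'a \<Rightarrow> complex"
    have nf: "(cmod (?f x))\<^sup>2 = indicator ?B x" for x by (simp add: indicator_def)
    have f: "?f \<in> L2 M"
    proof (rule L2I)
      show "?f \<in> borel_measurable M" using B by measurable
      show "integrable M (\<lambda>x. (cmod (?f x))\<^sup>2)"
        unfolding nf using B fin by (simp add: integrable_indicator_iff)
    qed
    obtain g where g: "g \<in> Domain T" "L2_norm M (\<lambda>x. ?f x - g x) < sqrt (measure M ?B)"
      using dense f pos unfolding densely_defined_def by (meson real_sqrt_gt_zero)
    then obtain g' where gg: "(g, g') \<in> T" by auto
    then have gL: "g \<in> L2 M" by (simp add: weighted_comp_op_def)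
    have "measure M ?B = (LINT x|M. indicator ?B x)"
      using B by (simp add: fin)
    also have "\<dots> \<le> (LINT x|M. (cmod (?f x - g x))\<^sup>2)"
    proof (rule integral_mono_AE)
      show "integrable M (indicator ?B :: 'a \<Rightarrow> real)" using B fin by (simp add: integrable_indicator_iff)
      show "integrable M (\<lambda>x. (cmod (?f x - g x))\<^sup>2)" by (rule L2_integrable[OF L2_diff[OF f gL]])
      show "AE x in M. indicator ?B x \<le> (cmod (?f x - g x))\<^sup>2"
        using T_domain_zero_on_infinite[OF gg] by eventually_elim (auto simp: indicator_def)
    qed
    finally have "sqrt (measure M ?B) \<le> L2_norm M (\<lambda>x. ?f x - g x)"
      unfolding L2_norm_def by simp
    with g(2) show False by simp
  qed
  have "emeasure M (\<Union>i. ?S \<inter> A i) = 0"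
    by (rule emeasure_UN_eq_0) (use null S Ai in auto)
  moreover have "(\<Union>i. ?S \<inter> A i) = ?S" using A(2) by blast
  ultimately have "?S \<in> null_sets M" using S by (simp add: null_sets_def)
  from AE_I'[OF this, of "\<lambda>x. h x \<noteq> \<infinity>"] show ?thesis by auto
qed

lemma h_eq_r: "AE x in M. h x = ennreal (r x)"
  using h_finite by eventually_elim (simp add: r_def less_top)

lemma density_r: "density M (\<lambda>x. ennreal (r x)) = distr N M \<phi>"
  unfolding density_h[symmetric]
  using h_eq_r by (intro density_cong) auto

lemma nn_integral_phi:
  assumes [measurable]: "g \<in> borel_measurable M"
  shows "(\<integral>\<^sup>+x. ennreal ((cmod (w x))\<^sup>2) * g (\<phi> x) \<partial>M) = (\<integral>\<^sup>+x. ennreal (r x) * g x \<partial>M)"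
  unfolding nn_integral_phi_h[OF assms]
  by (rule nn_integral_cong_AE) (use h_eq_r in auto)

lemma integral_phi:
  fixes g :: "'a \<Rightarrow> complex"
  assumes [measurable]: "g \<in> borel_measurable M"
  shows "(LINT x|M. of_real ((cmod (w x))\<^sup>2) * g (\<phi> x)) = (LINT x|M. of_real (r x) * g x)"
proof -
  have "(LINT x|M. of_real (r x) * g x) = integral\<^sup>L (density M (\<lambda>x. ennreal (r x))) g"
    by (subst integral_density) (auto simp: scaleR_conv_of_real)
  also have "\<dots> = (LINT x|N. g (\<phi> x))"
    unfolding density_r by (rule integral_distr) auto
  also have "\<dots> = (LINT x|M. of_real ((cmod (w x))\<^sup>2) * g (\<phi> x))"
    unfolding weighted_measure_def by (subst integral_density) (auto simp: scaleR_conv_of_real)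
  finally show ?thesis by simp
qed

lemma distr_sigma_finite: "sigma_finite_measure (distr N M \<phi>)"
  unfolding density_h[symmetric]
  using h_finite by (subst sigma_finite_iff_density_finite) auto

text \<open>The image of \<open>N\<close> under \<open>\<phi>\<close> has density \<open>r\<close> and therefore does not charge the zeros of \<open>r\<close>.\<close>

lemma r_phi_pos: "AE x in M. w x \<noteq> 0 \<longrightarrow> 0 < r (\<phi> x)"
proof -
  have "AE y in density M (\<lambda>x. ennreal (r x)). 0 < r y"
    by (subst AE_density) auto
  then have "AE x in N. 0 < r (\<phi> x)"
    unfolding density_r by (rule AE_distrD[rotated]) simp
  then show ?thesis by (simp add: AE_N_iff)
qed

text \<open>The weighted composition as a total function. Its square-integrable values form the closed
  subspace that plays the role of the closure of the range of \<open>T\<close>; here \<open>v\<close> itself may fail to be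
  square-integrable.\<close>

definition pull :: "('a \<Rightarrow> complex) \<Rightarrow> 'a \<Rightarrow> complex" where
  "pull v x = w x * v (\<phi> x)"

lemma pull_measurable [measurable]:
  assumes [measurable]: "v \<in> borel_measurable M"
  shows "pull v \<in> borel_measurable M"
  unfolding pull_def[abs_def] by measurable

lemma pull_cong_AE:
  assumes "AE y in M. u y = v y" shows "AE x in M. pull u x = pull v x"
  using AE_phi[OF assms] by eventually_elim (auto simp: pull_def)

lemma pull_L2_iff:
  assumes [measurable]: "v \<in> borel_measurable M"
  shows "pull v \<in> L2 M \<longleftrightarrow> (\<integral>\<^sup>+x. ennreal (r x * (cmod (v x))\<^sup>2) \<partial>M) < \<infinity>"
proof -
  have "(\<integral>\<^sup>+x. ennreal ((cmod (pull v x))\<^sup>2) \<partial>M) = (\<integral>\<^sup>+x. ennreal ((cmod (w x))\<^sup>2) * ennreal ((cmod (v (\<phi> x)))\<^sup>2) \<partial>M)"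
    by (simp add: pull_def norm_mult power_mult_distrib ennreal_mult)
  also have "\<dots> = (\<integral>\<^sup>+x. ennreal (r x) * ennreal ((cmod (v x))\<^sup>2) \<partial>M)"
    by (rule nn_integral_phi) measurable
  finally show ?thesis
    by (subst L2_iff_nn) (auto simp: ennreal_mult)
qed

lemma pull_L2_iff_integrable:
  assumes [measurable]: "v \<in> borel_measurable M"
  shows "pull v \<in> L2 M \<longleftrightarrow> integrable M (\<lambda>x. r x * (cmod (v x))\<^sup>2)"
  unfolding pull_L2_iff[OF assms] by (simp add: integrable_iff_bounded)

lemma inner_pull:
  assumes [measurable]: "u \<in> borel_measurable M" "v \<in> borel_measurable M"
  shows "L2_inner M (pull u) (pull v) = L2_inner M u (\<lambda>x. of_real (r x) * v x)"
proof -
  have "L2_inner M (pull u) (pull v) = (LINT x|M. of_real ((cmod (w x))\<^sup>2) * (u (\<phi> x) * cnj (v (\<phi> x))))"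
    unfolding L2_inner_def complex_norm_square by (simp add: pull_def algebra_simps)
  also have "\<dots> = (LINT x|M. of_real (r x) * (u x * cnj (v x)))"
    by (rule integral_phi) measurable
  finally show ?thesis by (simp add: L2_inner_def algebra_simps)
qed

lemma T_iff: "(f, g) \<in> T \<longleftrightarrow> f \<in> L2 M \<and> pull f \<in> L2 M \<and> g \<in> L2 M \<and> (AE x in M. g x = pull f x)"
  by (simp add: weighted_comp_op_def pull_def[abs_def])

lemma pull_lin: "pull (\<lambda>x. a * f x + b * g x) = (\<lambda>x. a * pull f x + b * pull g x)"
  by (simp add: pull_def fun_eq_iff algebra_simps)

text \<open>Along a common subsequence both convergences hold almost everywhere, and pointwise limits are
  compatible with composition.\<close>

lemma T_closed: "closed_operator M T"
  unfolding closed_operator_def linear_operator_def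
proof (intro conjI allI impI)
  have "((\<lambda>x. 0), (\<lambda>x. 0)) \<in> T" by (simp add: weighted_comp_op_def)
  then show "T \<noteq> {}" by blast
  show "T \<subseteq> L2 M \<times> L2 M" by (auto simp: weighted_comp_op_def)
next
  fix f g f' g' and a b :: complex
  assume fg: "(f, g) \<in> T" "(f', g') \<in> T"
  have ae: "AE x in M. g x = pull f x" "AE x in M. g' x = pull f' x" using fg by (simp_all add: T_iff)
  have "AE x in M. a * g x + b * g' x = a * pull f x + b * pull f' x"
    using ae by eventually_elim simp
  with fg show "(\<lambda>x. a * f x + b * f' x, \<lambda>x. a * g x + b * g' x) \<in> T"
    by (simp add: T_iff pull_lin L2_lin)
next
  fix f g g' assume fg: "(f, g) \<in> T" "(f, g') \<in> T"
  have ae: "AE x in M. g x = pull f x" "AE x in M. g' x = pull f x" using fg by (simp_all add: T_iff)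
  show "AE x in M. g x = g' x" using ae by eventually_elim simp
next
  fix F G f g
  assume FG: "\<forall>n::nat. (F n, G n) \<in> T" and f: "f \<in> L2 M" and g: "g \<in> L2 M"
    and F: "(\<lambda>n. L2_norm M (\<lambda>x. F n x - f x)) \<longlonglongrightarrow> 0"
    and G: "(\<lambda>n. L2_norm M (\<lambda>x. G n x - g x)) \<longlonglongrightarrow> 0"
  have FL: "F n \<in> L2 M" and GL: "G n \<in> L2 M" and ae: "AE x in M. G n x = pull (F n) x" for n
    using FG by (simp_all add: T_iff)
  have [measurable]: "f \<in> borel_measurable M" by (rule L2_measurable[OF f])
  obtain r1 :: "nat \<Rightarrow> nat" where r1: "strict_mono r1" "AE x in M. (\<lambda>n. F (r1 n) x) \<longlonglongrightarrow> f x"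
    using L2_norm_AE_subseq[OF FL f F] by blast
  have "(\<lambda>n. L2_norm M (\<lambda>x. G (r1 n) x - g x)) \<longlonglongrightarrow> 0"
    using LIMSEQ_subseq_LIMSEQ[OF G r1(1)] by (simp add: comp_def)
  then obtain r2 :: "nat \<Rightarrow> nat" where r2: "strict_mono r2" "AE x in M. (\<lambda>n. G (r1 (r2 n)) x) \<longlonglongrightarrow> g x"
    using L2_norm_AE_subseq[of "\<lambda>n. G (r1 n)", OF GL g] by blast
  have "AE x in M. \<forall>n. G n x = pull (F n) x" by (subst AE_all_countable) (use ae in blast)
  then have "AE x in M. g x = pull f x"
    using AE_phi[OF r1(2)] r2(2)
  proof eventually_elim
    case (elim x)
    have "(\<lambda>n. w x * F (r1 n) (\<phi> x)) \<longlonglongrightarrow> w x * f (\<phi> x)"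
      using elim(2) by (cases "w x = 0") (auto intro: tendsto_mult)
    then have "(\<lambda>n. w x * F (r1 (r2 n)) (\<phi> x)) \<longlonglongrightarrow> w x * f (\<phi> x)"
      using LIMSEQ_subseq_LIMSEQ[OF _ r2(1), of "\<lambda>n. w x * F (r1 n) (\<phi> x)"] by (simp add: comp_def)
    then have "(\<lambda>n. G (r1 (r2 n)) x) \<longlonglongrightarrow> pull f x" using elim(1) by (simp add: pull_def)
    from LIMSEQ_unique[OF elim(3) this] show ?case .
  qed
  moreover have "pull f \<in> L2 M"
    by (rule L2_cong_AE[OF g]) (use calculation in auto)
  ultimately show "(f, g) \<in> T" using f g by (simp add: T_iff)
qed

text \<open>Test functions are cut off to sets where \<open>r\<close> is bounded, which puts them into the domain of
  \<open>T\<close>.\<close>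

lemma pull_truncated_L2:
  assumes v: "v \<in> L2 M" and z: "\<And>x. c < r x \<Longrightarrow> v x = 0"
  shows "pull v \<in> L2 M"
proof -
  have [measurable]: "v \<in> borel_measurable M" by (rule L2_measurable[OF v])
  have "integrable M (\<lambda>x. r x * (cmod (v x))\<^sup>2)"
  proof (rule Bochner_Integration.integrable_bound)
    show "integrable M (\<lambda>x. c * (cmod (v x))\<^sup>2)" using L2_integrable[OF v] by simp
    have "norm (r x * (cmod (v x))\<^sup>2) \<le> norm (c * (cmod (v x))\<^sup>2)" for x
    proof (cases "c < r x")
      case True then show ?thesis using z[of x] by simp
    next
      case False
      then have "r x * (cmod (v x))\<^sup>2 \<le> c * (cmod (v x))\<^sup>2" by (intro mult_right_mono) auto
      then show ?thesis by simp
    qed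
    then show "AE x in M. norm (r x * (cmod (v x))\<^sup>2) \<le> norm (c * (cmod (v x))\<^sup>2)" by simp
  qed measurable
  then show ?thesis by (simp add: pull_L2_iff_integrable)
qed

lemma eq_0_if_tested:
  assumes [measurable]: "d \<in> borel_measurable M"
    and d: "\<And>n::nat. (\<lambda>x. of_bool (r x \<le> n) * d x) \<in> L2 M"
    and test: "\<And>v. v \<in> L2 M \<Longrightarrow> pull v \<in> L2 M \<Longrightarrow> L2_inner M v d = 0"
  shows "AE x in M. d x = 0"
proof -
  have "AE x in M. of_bool (r x \<le> n) * d x = 0" for n :: nat
  proof (rule L2_inner_self_eq_0D[OF d])
    let ?v = "\<lambda>x. of_bool (r x \<le> n) * d x"
    have "L2_inner M ?v ?v = L2_inner M ?v d"
      by (auto simp: L2_inner_def intro!: Bochner_Integration.integral_cong)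
    also have "\<dots> = 0"
      by (intro test d pull_truncated_L2[where c = "real n"]) auto
    finally show "L2_inner M ?v ?v = 0" .
  qed
  then have "AE x in M. \<forall>n::nat. of_bool (r x \<le> n) * d x = 0"
    unfolding AE_all_countable by blast
  then show ?thesis
  proof eventually_elim
    case (elim x)
    obtain n :: nat where "r x \<le> n" using real_arch_simple by blast
    with elim[rule_format, of n] show ?case by simp
  qed
qed

text \<open>\<open>T\<^sup>*\<close> maps \<open>w (y \<circ> \<phi>)\<close> to \<open>r y\<close>, because \<open>\<langle>w (v \<circ> \<phi>), w (y \<circ> \<phi>)\<rangle> = \<integral> r v cnj(y)\<close>. The vector \<open>f\<close> may differ
  from \<open>w (y \<circ> \<phi>)\<close> by one orthogonal to the range of \<open>T\<close>: with \<open>y = f\<^sub>0\<close> this gives \<open>T\<^sup>* T f\<^sub>0\<close>, and with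
  \<open>w (y \<circ> \<phi>) = P f\<close> it gives \<open>T\<^sup>* f\<close> for every \<open>f\<close>.\<close>

lemma adjoint_iff:
  assumes f: "f \<in> L2 M" and y [measurable]: "y \<in> borel_measurable M" and py: "pull y \<in> L2 M"
    and fy: "\<And>v. v \<in> L2 M \<Longrightarrow> pull v \<in> L2 M \<Longrightarrow> L2_inner M (pull v) f = L2_inner M (pull v) (pull y)"
  shows "(f, k) \<in> L2_adjoint M T \<longleftrightarrow> k \<in> L2 M \<and> (AE x in M. k x = of_real (r x) * y x)"
proof -
  have "(f, k) \<in> L2_adjoint M T \<longleftrightarrow> k \<in> L2 M \<and> (\<forall>v. v \<in> L2 M \<longrightarrow> pull v \<in> L2 M \<longrightarrow>
      L2_inner M v (\<lambda>x. of_real (r x) * y x) = L2_inner M v k)" (is "_ \<longleftrightarrow> _ \<and> ?R")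
  proof -
    have "(\<forall>(v, v')\<in>T. L2_inner M v' f = L2_inner M v k) \<longleftrightarrow> ?R"
    proof safe
      fix v assume *: "\<forall>(v, v')\<in>T. L2_inner M v' f = L2_inner M v k" and v: "v \<in> L2 M" "pull v \<in> L2 M"
      then have "(v, pull v) \<in> T" by (simp add: T_iff)
      with * have "L2_inner M (pull v) f = L2_inner M v k" by blast
      then show "L2_inner M v (\<lambda>x. of_real (r x) * y x) = L2_inner M v k"
        using fy[OF v] inner_pull[OF L2_measurable[OF v(1)] y] by simp
    next
      fix v v' assume R: ?R and v': "(v, v') \<in> T"
      then have v: "v \<in> L2 M" "pull v \<in> L2 M" and v'L: "v' \<in> L2 M" and ae: "AE x in M. v' x = pull v x"
        by (simp_all add: T_iff)
      have "L2_inner M v' f = L2_inner M (pull v) f" by (rule L2_inner_cong_left[OF v'L v(2) f ae])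
      also have "\<dots> = L2_inner M v (\<lambda>x. of_real (r x) * y x)"
        using fy[OF v] inner_pull[OF L2_measurable[OF v(1)] y] by simp
      also have "\<dots> = L2_inner M v k" using R v by blast
      finally show "L2_inner M v' f = L2_inner M v k" .
    qed
    then show ?thesis using f by (auto simp: L2_adjoint_def)
  qed
  also have "\<dots> \<longleftrightarrow> k \<in> L2 M \<and> (AE x in M. k x = of_real (r x) * y x)"
  proof (intro conj_cong refl)
    assume k: "k \<in> L2 M"
    have [measurable]: "k \<in> borel_measurable M" by (rule L2_measurable[OF k])
    have iy: "integrable M (\<lambda>x. r x * (cmod (y x))\<^sup>2)" using py by (simp add: pull_L2_iff_integrable)
    show "?R \<longleftrightarrow> (AE x in M. k x = of_real (r x) * y x)"
    proof
      assume ae: "AE x in M. k x = of_real (r x) * y x"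
      show ?R
      proof (intro allI impI)
        fix v assume v: "v \<in> L2 M"
        have [measurable]: "v \<in> borel_measurable M" by (rule L2_measurable[OF v])
        show "L2_inner M v (\<lambda>x. of_real (r x) * y x) = L2_inner M v k"
          by (rule L2_inner_cong) (use ae in auto)
      qed
    next
      assume R: ?R
      let ?d = "\<lambda>x. k x - of_real (r x) * y x"
      have "AE x in M. ?d x = 0"
      proof (rule eq_0_if_tested)
        fix n :: nat
        have ry: "(\<lambda>x. of_bool (r x \<le> n) * (of_real (r x) * y x)) \<in> L2 M"
        proof (rule L2I)
          show "integrable M (\<lambda>x. (cmod (of_bool (r x \<le> n) * (of_real (r x) * y x)))\<^sup>2)"
          proof (rule Bochner_Integration.integrable_bound)
            show "integrable M (\<lambda>x. real n * (r x * (cmod (y x))\<^sup>2))" using iy by simp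
            have "(r x)\<^sup>2 * (cmod (y x))\<^sup>2 \<le> real n * (r x * (cmod (y x))\<^sup>2)" if "r x \<le> n" for x
            proof -
              have "r x * (r x * (cmod (y x))\<^sup>2) \<le> real n * (r x * (cmod (y x))\<^sup>2)"
                by (rule mult_right_mono[OF that]) simp
              then show ?thesis by (simp add: power2_eq_square mult.assoc)
            qed
            then show "AE x in M. norm ((cmod (of_bool (r x \<le> n) * (of_real (r x) * y x)))\<^sup>2)
                \<le> norm (real n * (r x * (cmod (y x))\<^sup>2))"
              by (auto simp: norm_mult power_mult_distrib abs_mult)
          qed measurable
        qed measurable
        have kn: "(\<lambda>x. of_bool (r x \<le> n) * k x) \<in> L2 M"
          by (rule L2_mult_bounded[OF k, of _ 1]) auto
        show "(\<lambda>x. of_bool (r x \<le> n) * ?d x) \<in> L2 M"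
          using L2_diff[OF kn ry] by (simp add: right_diff_distrib)
      next
        fix v assume v: "v \<in> L2 M" "pull v \<in> L2 M"
        have [measurable]: "v \<in> borel_measurable M" by (rule L2_measurable[OF v(1)])
        have iv: "integrable M (\<lambda>x. r x * (cmod (v x))\<^sup>2)" using v(2) by (simp add: pull_L2_iff_integrable)
        have "integrable M (\<lambda>x. v x * cnj (of_real (r x) * y x))"
        proof (rule Bochner_Integration.integrable_bound)
          show "integrable M (\<lambda>x. r x * (cmod (v x))\<^sup>2 + r x * (cmod (y x))\<^sup>2)" using iv iy by simp
          have "norm (v x * cnj (of_real (r x) * y x)) \<le> norm (r x * (cmod (v x))\<^sup>2 + r x * (cmod (y x))\<^sup>2)" for x
          proof -
            have "2 * cmod (v x) * cmod (y x) \<le> (cmod (v x))\<^sup>2 + (cmod (y x))\<^sup>2" by (rule sum_squares_bound)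
            moreover have "0 \<le> cmod (v x) * cmod (y x)" by simp
            ultimately have "cmod (v x) * cmod (y x) \<le> (cmod (v x))\<^sup>2 + (cmod (y x))\<^sup>2" by linarith
            then have "r x * (cmod (v x) * cmod (y x)) \<le> r x * ((cmod (v x))\<^sup>2 + (cmod (y x))\<^sup>2)"
              by (rule mult_left_mono) simp
            moreover have "0 \<le> r x * (cmod (v x))\<^sup>2 + r x * (cmod (y x))\<^sup>2" by simp
            ultimately show ?thesis by (simp add: norm_mult algebra_simps)
          qed
          then show "AE x in M. norm (v x * cnj (of_real (r x) * y x)) \<le> norm (r x * (cmod (v x))\<^sup>2 + r x * (cmod (y x))\<^sup>2)"
            by simp
        qed measurable
        then have "L2_inner M v ?d = L2_inner M v k - L2_inner M v (\<lambda>x. of_real (r x) * y x)"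
          using L2_integrable_inner[OF v(1) k] by (simp add: L2_inner_def right_diff_distrib)
        then show "L2_inner M v ?d = 0" using R v by simp
      qed measurable
      then show "AE x in M. k x = of_real (r x) * y x" by eventually_elim simp
    qed
  qed
  finally show ?thesis .
qed

text \<open>The domain of \<open>T\<close> imposes no further condition on \<open>f\<close> in the domain of the multiplication by \<open>r\<close>,
  since \<open>r \<le> 1 + r\<^sup>2\<close>.\<close>

lemma T_adjoint_T:
  "T O L2_adjoint M T = {(f, g). f \<in> L2 M \<and> (\<lambda>x. complex_of_real (r x) * f x) \<in> L2 M \<and> g \<in> L2 M \<and>
     (AE x in M. g x = complex_of_real (r x) * f x)}"
proof (intro set_eqI, clarify)
  fix f g
  have adj: "(u, g) \<in> L2_adjoint M T \<longleftrightarrow> g \<in> L2 M \<and> (AE x in M. g x = of_real (r x) * f x)"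
    if "(f, u) \<in> T" for u
  proof (rule adjoint_iff)
    have f: "f \<in> L2 M" "pull f \<in> L2 M" and u: "u \<in> L2 M" "AE x in M. u x = pull f x"
      using that by (simp_all add: T_iff)
    show "u \<in> L2 M" "pull f \<in> L2 M" "f \<in> borel_measurable M" using u f L2_measurable by auto
    show "L2_inner M (pull v) u = L2_inner M (pull v) (pull f)" if "pull v \<in> L2 M" for v
      by (rule L2_inner_cong_right[OF u(1) f(2) that u(2)])
  qed
  show "(f, g) \<in> T O L2_adjoint M T \<longleftrightarrow> (f, g) \<in> {(f, g). f \<in> L2 M \<and> (\<lambda>x. complex_of_real (r x) * f x) \<in> L2 M \<and> g \<in> L2 M \<and>
     (AE x in M. g x = complex_of_real (r x) * f x)}"
  proof
    assume "(f, g) \<in> T O L2_adjoint M T"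
    then obtain u where u: "(f, u) \<in> T" "(u, g) \<in> L2_adjoint M T" by blast
    then have f: "f \<in> L2 M" and g: "g \<in> L2 M" and ae: "AE x in M. g x = of_real (r x) * f x"
      using adj[OF u(1)] by (auto simp: T_iff)
    have [measurable]: "f \<in> borel_measurable M" by (rule L2_measurable[OF f])
    have "(\<lambda>x. of_real (r x) * f x) \<in> L2 M"
      by (rule L2_cong_AE[OF g]) (use ae in auto)
    with f g ae show "(f, g) \<in> {(f, g). f \<in> L2 M \<and> (\<lambda>x. complex_of_real (r x) * f x) \<in> L2 M \<and> g \<in> L2 M \<and>
     (AE x in M. g x = complex_of_real (r x) * f x)}" by simp
  next
    assume "(f, g) \<in> {(f, g). f \<in> L2 M \<and> (\<lambda>x. complex_of_real (r x) * f x) \<in> L2 M \<and> g \<in> L2 M \<and>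
     (AE x in M. g x = complex_of_real (r x) * f x)}"
    then have f: "f \<in> L2 M" and rf: "(\<lambda>x. of_real (r x) * f x) \<in> L2 M" and g: "g \<in> L2 M"
      and ae: "AE x in M. g x = of_real (r x) * f x" by simp_all
    have [measurable]: "f \<in> borel_measurable M" by (rule L2_measurable[OF f])
    have "integrable M (\<lambda>x. r x * (cmod (f x))\<^sup>2)"
    proof (rule Bochner_Integration.integrable_bound)
      show "integrable M (\<lambda>x. (cmod (f x))\<^sup>2 + (cmod (of_real (r x) * f x))\<^sup>2)"
        using L2_integrable[OF f] L2_integrable[OF rf] by simp
      have "norm (r x * (cmod (f x))\<^sup>2) \<le> norm ((cmod (f x))\<^sup>2 + (cmod (of_real (r x) * f x))\<^sup>2)" for x
      proof -
        have "r x \<le> 1 + (r x)\<^sup>2"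
          using sum_squares_bound[of "r x" 1] r_nonneg[of x] unfolding power_one by linarith
        then have "r x * (cmod (f x))\<^sup>2 \<le> (1 + (r x)\<^sup>2) * (cmod (f x))\<^sup>2" by (intro mult_right_mono) auto
        then show ?thesis by (simp add: norm_mult power_mult_distrib algebra_simps)
      qed
      then show "AE x in M. norm (r x * (cmod (f x))\<^sup>2) \<le> norm ((cmod (f x))\<^sup>2 + (cmod (of_real (r x) * f x))\<^sup>2)" by simp
    qed measurable
    then have "pull f \<in> L2 M" by (simp add: pull_L2_iff_integrable)
    with f have T: "(f, pull f) \<in> T" by (simp add: T_iff)
    with adj[OF T] g ae show "(f, g) \<in> T O L2_adjoint M T" by blast
  qed
qed

end

section \<open>The projection onto the closure of the range\<close>

context weighted_composition
begin

abbreviation \<nu>\<phi> :: "'a measure" where "\<nu>\<phi> \<equiv> distr N M \<phi>"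

text \<open>The composition \<open>v \<circ> \<phi>\<close> is the conditional expectation of \<open>g\<close> with respect to \<open>N\<close> and the
  preimages under \<open>\<phi>\<close>; as a Radon-Nikodym derivative on the image space it comes in factored form.
  The density \<open>v\<close> is square-integrable: for functions \<open>a \<le> v\<close> of finite energy,
  \<open>\<integral> a\<^sup>2 \<le> \<integral> a v = \<integral> (a \<circ> \<phi>) g \<le> (\<integral> a\<^sup>2 + \<integral> g\<^sup>2) / 2\<close>, and the first term on the right can be absorbed.\<close>

lemma push_forward_density:
  assumes g [measurable]: "g \<in> borel_measurable M" and g0: "\<And>x. 0 \<le> g x"
    and gL: "(\<lambda>x. w x * complex_of_real (g x)) \<in> L2 M"
  obtains v :: "'a \<Rightarrow> real" where "v \<in> borel_measurable M" "\<And>x. 0 \<le> v x"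
    "distr (density N (\<lambda>x. ennreal (g x))) M \<phi> = density \<nu>\<phi> (\<lambda>x. ennreal (v x))"
    "(\<integral>\<^sup>+x. ennreal ((v x)\<^sup>2) \<partial>\<nu>\<phi>) < \<infinity>"
proof -
  interpret \<nu>: sigma_finite_measure \<nu>\<phi> by (rule distr_sigma_finite)
  let ?\<rho> = "distr (density N (\<lambda>x. ennreal (g x))) M \<phi>"
  define G where "G = (\<integral>\<^sup>+x. ennreal ((g x)\<^sup>2) \<partial>N)"
  have "G = (\<integral>\<^sup>+x. ennreal ((cmod (w x * complex_of_real (g x)))\<^sup>2) \<partial>M)"
    unfolding G_def by (subst nn_integral_N) (auto simp: norm_mult power_mult_distrib ennreal_mult)
  also have "\<dots> < \<infinity>" using gL L2_iff_nn[OF L2_measurable[OF gL]] by simp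
  finally have Gfin: "G < \<infinity>" .
  have rho: "nn_integral ?\<rho> a = (\<integral>\<^sup>+x. ennreal (g x) * a (\<phi> x) \<partial>N)" if [measurable]: "a \<in> borel_measurable M" for a
    by (subst nn_integral_distr) (auto simp: nn_integral_density)
  have ac': "absolutely_continuous \<nu>\<phi> ?\<rho>"
    unfolding absolutely_continuous_def
  proof
    fix A assume A: "A \<in> null_sets \<nu>\<phi>"
    then have As [measurable]: "A \<in> sets M" and z: "emeasure \<nu>\<phi> A = 0" by auto
    have "AE x in N. \<phi> x \<notin> A"
      by (rule AE_distrD[of \<phi> N M "\<lambda>y. y \<notin> A"]) (use AE_not_in[OF A] in auto)
    then have "(\<integral>\<^sup>+x. ennreal (g x) * indicator A (\<phi> x) \<partial>N) = (\<integral>\<^sup>+x. 0 \<partial>N)"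
      by (intro nn_integral_cong_AE) auto
    then have "emeasure ?\<rho> A = 0" using rho[of "indicator A"] by simp
    then show "A \<in> null_sets ?\<rho>" by (simp add: null_sets_def)
  qed
  obtain B :: "nat \<Rightarrow> 'a set" where B: "range B \<subseteq> sets \<nu>\<phi>" "(\<Union>i. B i) = space \<nu>\<phi>" "\<And>i. emeasure \<nu>\<phi> (B i) \<noteq> \<infinity>" "incseq B"
    using \<nu>.sigma_finite_incseq by metis
  have Bs [measurable]: "B i \<in> sets M" for i using B(1) by auto
  have young: "2 * (ennreal a * ennreal b) \<le> ennreal (a\<^sup>2) + ennreal (b\<^sup>2)" if "0 \<le> a" "0 \<le> b" for a b
  proof -
    have "2 * a * b \<le> a\<^sup>2 + b\<^sup>2" by (rule sum_squares_bound)
    then have "ennreal (2 * (a * b)) \<le> ennreal (a\<^sup>2 + b\<^sup>2)" by (intro ennreal_leI) simp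
    then show ?thesis using that by (simp add: ennreal_mult ennreal_plus)
  qed
  have rho_bound: "2 * nn_integral ?\<rho> (\<lambda>x. ennreal (a x)) \<le> (\<integral>\<^sup>+x. ennreal ((a x)\<^sup>2) \<partial>\<nu>\<phi>) + G"
    if [measurable]: "a \<in> borel_measurable M" and a0: "\<And>x. 0 \<le> a x" for a
  proof -
    have "2 * nn_integral ?\<rho> (\<lambda>x. ennreal (a x)) = (\<integral>\<^sup>+x. 2 * (ennreal (a (\<phi> x)) * ennreal (g x)) \<partial>N)"
      by (subst rho) (auto simp: nn_integral_cmult mult.commute)
    also have "\<dots> \<le> (\<integral>\<^sup>+x. ennreal ((a (\<phi> x))\<^sup>2) + ennreal ((g x)\<^sup>2) \<partial>N)"
      by (intro nn_integral_mono young a0 g0)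
    also have "\<dots> = (\<integral>\<^sup>+x. ennreal ((a (\<phi> x))\<^sup>2) \<partial>N) + G"
      unfolding G_def by (rule nn_integral_add) auto
    also have "(\<integral>\<^sup>+x. ennreal ((a (\<phi> x))\<^sup>2) \<partial>N) = (\<integral>\<^sup>+x. ennreal ((a x)\<^sup>2) \<partial>\<nu>\<phi>)"
      by (subst nn_integral_distr) auto
    finally show ?thesis .
  qed
  have "sigma_finite_measure ?\<rho>"
  proof
    show "\<exists>A. countable A \<and> A \<subseteq> sets ?\<rho> \<and> \<Union> A = space ?\<rho> \<and> (\<forall>a\<in>A. emeasure ?\<rho> a \<noteq> \<infinity>)"
    proof (intro exI[of _ "range B"] conjI ballI)
      fix b assume "b \<in> range B"
      then obtain i where b: "b = B i" by auto
      have sq: "(indicator (B i) x :: real)\<^sup>2 = indicator (B i) x" for x by (simp add: indicator_def)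
      have "2 * emeasure ?\<rho> (B i) \<le> emeasure \<nu>\<phi> (B i) + G"
        using rho_bound[of "indicator (B i)"] by (simp add: sq ennreal_indicator)
      also have "\<dots> < \<infinity>" using B(3)[of i] Gfin by (simp add: less_top)
      finally show "emeasure ?\<rho> b \<noteq> \<infinity>" unfolding b
        by (auto simp: ennreal_mult_less_top ennreal_mult_eq_top_iff)
    qed (use B in auto)
  qed
  define v0 where "v0 = RN_deriv \<nu>\<phi> ?\<rho>"
  have v0m [measurable]: "v0 \<in> borel_measurable M"
    unfolding v0_def using borel_measurable_RN_deriv[of \<nu>\<phi> ?\<rho>] by simp
  have fin: "AE x in \<nu>\<phi>. v0 x \<noteq> \<infinity>"
    unfolding v0_def by (rule \<nu>.RN_deriv_finite[OF \<open>sigma_finite_measure ?\<rho>\<close> ac']) simp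
  define v where "v x = enn2real (v0 x)" for x
  have vm [measurable]: "v \<in> borel_measurable M" unfolding v_def[abs_def] by measurable
  have v0: "0 \<le> v x" for x by (simp add: v_def)
  have dens: "?\<rho> = density \<nu>\<phi> (\<lambda>x. ennreal (v x))"
  proof -
    have "?\<rho> = density \<nu>\<phi> v0" unfolding v0_def by (rule \<nu>.density_RN_deriv[symmetric, OF ac']) simp
    also have "\<dots> = density \<nu>\<phi> (\<lambda>x. ennreal (v x))"
      using fin by (intro density_cong) (auto simp: v_def less_top)
    finally show ?thesis .
  qed
  let ?C = "\<lambda>n. {x \<in> B n. v x \<le> real n}"
  have Cs [measurable]: "?C n \<in> sets M" for n
  proof -
    have "?C n = {x \<in> space M. x \<in> B n \<and> v x \<le> real n}" using sets.sets_into_space[OF Bs] by auto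
    then show ?thesis by simp
  qed
  let ?D = "density \<nu>\<phi> (\<lambda>x. ennreal ((v x)\<^sup>2))"
  have "emeasure ?D (?C n) \<le> G" for n
  proof -
    define a where "a x = v x * indicator (?C n) x" for x
    have [measurable]: "a \<in> borel_measurable M" unfolding a_def[abs_def] by measurable
    have a0: "0 \<le> a x" for x by (simp add: a_def v0)
    define I where "I = (\<integral>\<^sup>+x. ennreal ((a x)\<^sup>2) \<partial>\<nu>\<phi>)"
    have "I \<le> (\<integral>\<^sup>+x. ennreal ((real n)\<^sup>2) * indicator (B n) x \<partial>\<nu>\<phi>)"
      unfolding I_def a_def
      by (intro nn_integral_mono) (auto simp: indicator_def intro!: ennreal_leI power_mono v0)
    also have "\<dots> = ennreal ((real n)\<^sup>2) * emeasure \<nu>\<phi> (B n)" by (rule nn_integral_cmult_indicator) simp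
    also have "\<dots> < \<infinity>" using B(3)[of n] by (simp add: ennreal_mult_less_top less_top)
    finally have Ifin: "I < \<infinity>" .
    have "I = nn_integral ?\<rho> (\<lambda>x. ennreal (a x))"
      unfolding dens I_def
      by (subst nn_integral_density)
         (auto simp: a_def indicator_def power2_eq_square v0 ennreal_mult intro!: nn_integral_cong)
    with rho_bound[of a] a0 have "I + I \<le> I + G" by (simp add: I_def mult_2)
    then have "I \<le> G" using Ifin by (auto simp: ennreal_add_left_cancel_le)
    moreover have "emeasure ?D (?C n) = I"
      unfolding I_def by (subst emeasure_density) (auto simp: a_def indicator_def intro!: nn_integral_cong)
    ultimately show ?thesis by simp
  qed
  moreover have "(SUP n. emeasure ?D (?C n)) = emeasure ?D (\<Union>n. ?C n)"
  proof (rule SUP_emeasure_incseq)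
    show "range ?C \<subseteq> sets ?D" using Cs by auto
    show "incseq ?C" using B(4) by (fastforce simp: incseq_def)
  qed
  moreover have "(\<Union>n. ?C n) = space M"
  proof (intro equalityI subsetI)
    fix x assume "x \<in> space M"
    then obtain i where i: "x \<in> B i" using B(2) by auto
    obtain m :: nat where m: "v x \<le> real m" using real_arch_simple by blast
    have "x \<in> ?C (max i m)" using i m incseqD[OF B(4), of i "max i m"] by (auto intro: order_trans)
    then show "x \<in> (\<Union>n. ?C n)" by blast
  qed (use sets.sets_into_space[OF Bs] in auto)
  ultimately have "emeasure ?D (space M) \<le> G" by (metis (mono_tags, lifting) SUP_least)
  moreover have "emeasure ?D (space M) = (\<integral>\<^sup>+x. ennreal ((v x)\<^sup>2) \<partial>\<nu>\<phi>)"
    by (subst emeasure_density) (auto intro!: nn_integral_cong)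
  ultimately have "(\<integral>\<^sup>+x. ennreal ((v x)\<^sup>2) \<partial>\<nu>\<phi>) < \<infinity>" using Gfin by simp
  with that[OF vm v0 dens] show thesis by blast
qed

text \<open>In terms of \<open>v\<close> the projection of \<open>w g\<close> is \<open>w (v \<circ> \<phi>)\<close>: the inner products of both with \<open>w (u \<circ> \<phi>)\<close> are
  the integral of \<open>cnj u\<close> against the same image measure.\<close>

lemma nonneg_projection:
  assumes g [measurable]: "g \<in> borel_measurable M" and g0: "\<And>x. 0 \<le> g x"
    and gL: "(\<lambda>x. w x * complex_of_real (g x)) \<in> L2 M"
  obtains v where "v \<in> borel_measurable M" "pull v \<in> L2 M"
    "\<And>u. u \<in> borel_measurable M \<Longrightarrow>
      L2_inner M (\<lambda>x. w x * complex_of_real (g x)) (pull u) = L2_inner M (pull v) (pull u)"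
proof -
  obtain v :: "'a \<Rightarrow> real" where v [measurable]: "v \<in> borel_measurable M" and v0: "\<And>x. 0 \<le> v x"
    and dens: "distr (density N (\<lambda>x. ennreal (g x))) M \<phi> = density \<nu>\<phi> (\<lambda>x. ennreal (v x))"
    and fin: "(\<integral>\<^sup>+x. ennreal ((v x)\<^sup>2) \<partial>\<nu>\<phi>) < \<infinity>"
    by (rule push_forward_density[OF assms]) blast
  show thesis
  proof (rule that[of "\<lambda>x. complex_of_real (v x)"])
    show "(\<lambda>x. complex_of_real (v x)) \<in> borel_measurable M" by measurable
    have "(\<integral>\<^sup>+x. ennreal ((v x)\<^sup>2) \<partial>\<nu>\<phi>) = (\<integral>\<^sup>+x. ennreal (r x * (v x)\<^sup>2) \<partial>M)"
      unfolding density_r[symmetric] by (subst nn_integral_density) (auto simp: ennreal_mult)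
    with fin show "pull (\<lambda>x. complex_of_real (v x)) \<in> L2 M" by (simp add: pull_L2_iff)
    fix u :: "'a \<Rightarrow> complex" assume u [measurable]: "u \<in> borel_measurable M"
    have "L2_inner M (\<lambda>x. w x * complex_of_real (g x)) (pull u)
        = (LINT x|M. (cmod (w x))\<^sup>2 *\<^sub>R (g x *\<^sub>R cnj (u (\<phi> x))))"
      unfolding L2_inner_def pull_def scaleR_conv_of_real complex_norm_square by (simp add: algebra_simps)
    also have "\<dots> = (LINT x|N. g x *\<^sub>R cnj (u (\<phi> x)))"
      unfolding weighted_measure_def by (subst integral_density) auto
    also have "\<dots> = integral\<^sup>L (distr (density N (\<lambda>x. ennreal (g x))) M \<phi>) (\<lambda>x. cnj (u x))"
      by (subst integral_distr) (auto simp: integral_density g0 simp del: Bochner_Integration.integral_cnj)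
    also have "\<dots> = (LINT x|\<nu>\<phi>. v x *\<^sub>R cnj (u x))"
      unfolding dens by (subst integral_density) (auto simp: v0)
    also have "\<dots> = (LINT x|N. v (\<phi> x) *\<^sub>R cnj (u (\<phi> x)))"
      by (subst integral_distr) auto
    also have "\<dots> = (LINT x|M. (cmod (w x))\<^sup>2 *\<^sub>R (v (\<phi> x) *\<^sub>R cnj (u (\<phi> x))))"
      unfolding weighted_measure_def by (subst integral_density) auto
    also have "\<dots> = L2_inner M (pull (\<lambda>x. complex_of_real (v x))) (pull u)"
      unfolding L2_inner_def pull_def scaleR_conv_of_real complex_norm_square by (simp add: algebra_simps)
    finally show "L2_inner M (\<lambda>x. w x * complex_of_real (g x)) (pull u)
        = L2_inner M (pull (\<lambda>x. complex_of_real (v x))) (pull u)" .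
  qed
qed

text \<open>Where \<open>w = 0\<close> every function of the subspace vanishes, so that only \<open>f = w (f / w)\<close> on the rest
  matters, and \<open>f / w\<close> is split into positive and negative parts of its real and imaginary part.\<close>

lemma projection_exists:
  assumes f: "f \<in> L2 M"
  shows "\<exists>v. v \<in> borel_measurable M \<and> pull v \<in> L2 M \<and>
    (\<forall>u. u \<in> borel_measurable M \<longrightarrow> pull u \<in> L2 M \<longrightarrow> L2_inner M f (pull u) = L2_inner M (pull v) (pull u))"
proof -
  have fm [measurable]: "f \<in> borel_measurable M" by (rule L2_measurable[OF f])
  define q where "q x = f x / w x" for x
  have [measurable]: "q \<in> borel_measurable M" unfolding q_def[abs_def] by measurable
  have part: "\<exists>v. v \<in> borel_measurable M \<and> pull v \<in> L2 M \<and> (\<forall>u. u \<in> borel_measurable M \<longrightarrow>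
      L2_inner M (\<lambda>x. w x * complex_of_real (g x)) (pull u) = L2_inner M (pull v) (pull u)) \<and>
      (\<lambda>x. w x * complex_of_real (g x)) \<in> L2 M"
    if g: "g \<in> borel_measurable M" "\<And>x. 0 \<le> g x" "\<And>x. g x \<le> cmod (q x)" for g
  proof -
    have "(\<lambda>x. w x * complex_of_real (g x)) \<in> L2 M"
    proof (rule L2_bound[OF f, of _ 1])
      show "(\<lambda>x. w x * complex_of_real (g x)) \<in> borel_measurable M" using g(1) by measurable
      have "cmod (w x * complex_of_real (g x)) \<le> 1 * cmod (f x)" for x
      proof (cases "w x = 0")
        case False
        have "cmod (w x) * g x \<le> cmod (w x) * cmod (q x)" by (intro mult_left_mono g) auto
        also have "\<dots> = cmod (f x)" using False by (simp add: q_def norm_divide)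
        finally show ?thesis using g(2)[of x] by (simp add: norm_mult)
      qed simp
      then show "AE x in M. cmod (w x * complex_of_real (g x)) \<le> 1 * cmod (f x)" by simp
    qed
    with nonneg_projection[OF g(1,2) this] show ?thesis by metis
  qed
  define g where "g i x = (if i = (0::nat) then max 0 (Re (q x)) else if i = 1 then max 0 (- Re (q x))
     else if i = 2 then max 0 (Im (q x)) else max 0 (- Im (q x)))" for i x
  have gm [measurable]: "g i \<in> borel_measurable M" for i unfolding g_def[abs_def] by (cases "i = 0"; cases "i = 1"; cases "i = 2") auto
  have g0: "0 \<le> g i x" for i x by (simp add: g_def)
  have gq: "g i x \<le> cmod (q x)" for i x
    using abs_Re_le_cmod[of "q x"] abs_Im_le_cmod[of "q x"] by (auto simp: g_def)
  have "\<forall>i. \<exists>v. v \<in> borel_measurable M \<and> pull v \<in> L2 M \<and> (\<forall>u. u \<in> borel_measurable M \<longrightarrow>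
      L2_inner M (\<lambda>x. w x * complex_of_real (g i x)) (pull u) = L2_inner M (pull v) (pull u)) \<and>
      (\<lambda>x. w x * complex_of_real (g i x)) \<in> L2 M"
    using part[OF gm g0 gq] by blast
  from choice[OF this] obtain v where v [measurable]: "\<And>i. v i \<in> borel_measurable M" and pv: "\<And>i. pull (v i) \<in> L2 M"
    and iv: "\<And>i u. u \<in> borel_measurable M \<Longrightarrow> L2_inner M (\<lambda>x. w x * complex_of_real (g i x)) (pull u) = L2_inner M (pull (v i)) (pull u)"
    and wg: "\<And>i. (\<lambda>x. w x * complex_of_real (g i x)) \<in> L2 M" by blast
  let ?G = "\<lambda>i x. w x * complex_of_real (g i x)"
  let ?v = "\<lambda>x. 1 * (1 * v 0 x + (-1) * v 1 x) + \<i> * (1 * v 2 x + (-1) * v 3 x)"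
  let ?s = "\<lambda>x. 1 * (1 * ?G 0 x + (-1) * ?G 1 x) + \<i> * (1 * ?G 2 x + (-1) * ?G 3 x)"
  have s: "?s \<in> L2 M" by (intro L2_lin wg)
  have pull_v: "pull ?v = (\<lambda>x. 1 * (1 * pull (v 0) x + (-1) * pull (v 1) x) + \<i> * (1 * pull (v 2) x + (-1) * pull (v 3) x))"
    by (simp only: pull_lin)
  have pvL: "pull ?v \<in> L2 M" unfolding pull_v by (intro L2_lin pv)
  have sf: "?s x = f x" if "w x \<noteq> 0" for x
  proof -
    have "?s x = w x * Complex (Re (q x)) (Im (q x))"
      by (simp add: g_def complex_eq_iff algebra_simps max_def)
    also have "\<dots> = f x" using that by (simp add: q_def)
    finally show ?thesis .
  qed
  have "L2_inner M f (pull u) = L2_inner M (pull ?v) (pull u)"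
    if u: "u \<in> borel_measurable M" "pull u \<in> L2 M" for u
  proof -
    have "f x * cnj (pull u x) = ?s x * cnj (pull u x)" for x
      using sf[of x] by (cases "w x = 0") (simp_all add: pull_def)
    then have "L2_inner M f (pull u) = L2_inner M ?s (pull u)"
      unfolding L2_inner_def by presburger
    also have "\<dots> = 1 * (1 * L2_inner M (?G 0) (pull u) + (-1) * L2_inner M (?G 1) (pull u))
        + \<i> * (1 * L2_inner M (?G 2) (pull u) + (-1) * L2_inner M (?G 3) (pull u))"
      by (simp only: L2_inner_lin_left[OF L2_lin[OF wg wg] L2_lin[OF wg wg] u(2)] L2_inner_lin_left[OF wg wg u(2)])
    also have "\<dots> = 1 * (1 * L2_inner M (pull (v 0)) (pull u) + (-1) * L2_inner M (pull (v 1)) (pull u))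
        + \<i> * (1 * L2_inner M (pull (v 2)) (pull u) + (-1) * L2_inner M (pull (v 3)) (pull u))"
      by (simp only: iv[OF u(1)])
    also have "\<dots> = L2_inner M (pull ?v) (pull u)"
      unfolding pull_v
      by (simp only: L2_inner_lin_left[OF L2_lin[OF pv pv] L2_lin[OF pv pv] u(2)] L2_inner_lin_left[OF pv pv u(2)])
    finally show ?thesis .
  qed
  moreover have "?v \<in> borel_measurable M" by measurable
  ultimately show ?thesis using pvL by blast
qed

text \<open>\<open>factor f \<circ> \<phi>\<close> is a version of the conditional expectation of \<open>f / w\<close> with respect to \<open>N\<close>.\<close>

definition factor :: "('a \<Rightarrow> complex) \<Rightarrow> 'a \<Rightarrow> complex" where
  "factor f = (SOME v. v \<in> borel_measurable M \<and> pull v \<in> L2 M \<and>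
    (\<forall>u. u \<in> borel_measurable M \<longrightarrow> pull u \<in> L2 M \<longrightarrow> L2_inner M f (pull u) = L2_inner M (pull v) (pull u)))"

definition P :: "('a \<Rightarrow> complex) \<Rightarrow> 'a \<Rightarrow> complex" where
  "P f = pull (factor f)"

lemma
  assumes "f \<in> L2 M"
  shows factor_measurable: "factor f \<in> borel_measurable M"
    and P_in_L2: "P f \<in> L2 M"
    and inner_P_pull: "u \<in> borel_measurable M \<Longrightarrow> pull u \<in> L2 M \<Longrightarrow> L2_inner M (P f) (pull u) = L2_inner M f (pull u)"
proof -
  have "factor f \<in> borel_measurable M \<and> pull (factor f) \<in> L2 M \<and>
    (\<forall>u. u \<in> borel_measurable M \<longrightarrow> pull u \<in> L2 M \<longrightarrow> L2_inner M f (pull u) = L2_inner M (pull (factor f)) (pull u))"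
    unfolding factor_def by (rule someI_ex[OF projection_exists[OF assms]])
  then show "factor f \<in> borel_measurable M" "P f \<in> L2 M"
    "u \<in> borel_measurable M \<Longrightarrow> pull u \<in> L2 M \<Longrightarrow> L2_inner M (P f) (pull u) = L2_inner M f (pull u)"
    by (simp_all add: P_def)
qed

text \<open>The characterization determines \<open>P f\<close>: the difference of two candidates belongs to the subspace
  and is orthogonal to it.\<close>

lemma P_eqI:
  assumes f: "f \<in> L2 M" and v: "v \<in> borel_measurable M" and pv: "pull v \<in> L2 M"
    and eq: "\<And>u. u \<in> borel_measurable M \<Longrightarrow> pull u \<in> L2 M \<Longrightarrow> L2_inner M f (pull u) = L2_inner M (pull v) (pull u)"
  shows "AE x in M. P f x = pull v x"
proof -
  let ?u = "\<lambda>x. 1 * factor f x + (-1) * v x"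
  have um: "?u \<in> borel_measurable M" using factor_measurable[OF f] v by measurable
  have pu: "pull ?u = (\<lambda>x. P f x - pull v x)" unfolding pull_lin P_def by simp
  have L: "pull ?u \<in> L2 M" unfolding pu by (rule L2_diff[OF P_in_L2[OF f] pv])
  have "L2_inner M (\<lambda>x. P f x - pull v x) (pull ?u) = L2_inner M (P f) (pull ?u) - L2_inner M (pull v) (pull ?u)"
    by (rule L2_inner_diff_left[OF P_in_L2[OF f] pv L])
  also have "\<dots> = 0" using inner_P_pull[OF f um L] eq[OF um L] by simp
  finally have "L2_inner M (pull ?u) (pull ?u) = 0" by (simp only: pu)
  from L2_inner_self_eq_0D[OF L this] show ?thesis unfolding pu by simp
qed

lemma P_pull:
  assumes "v \<in> borel_measurable M" "pull v \<in> L2 M"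
  shows "AE x in M. P (pull v) x = pull v x"
  using assms by (intro P_eqI) auto

lemma P_projection: "orthogonal_projection M P"
  unfolding orthogonal_projection_def
proof (intro conjI ballI allI)
  fix f assume f: "f \<in> L2 M"
  show "P f \<in> L2 M" by (rule P_in_L2[OF f])
  show "AE x in M. P (P f) x = P f x"
    using P_pull[OF factor_measurable[OF f]] P_in_L2[OF f] unfolding P_def by blast
  fix g assume g: "g \<in> L2 M"
  note Pf = P_in_L2[OF f] note Pg = P_in_L2[OF g]
  show "AE x in M. P (\<lambda>x. a * f x + b * g x) x = a * P f x + b * P g x" for a b
  proof -
    let ?v = "\<lambda>x. a * factor f x + b * factor g x"
    have pv: "pull ?v = (\<lambda>x. a * P f x + b * P g x)" unfolding pull_lin P_def ..
    have "AE x in M. P (\<lambda>x. a * f x + b * g x) x = pull ?v x"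
    proof (rule P_eqI)
      show "(\<lambda>x. a * f x + b * g x) \<in> L2 M" by (rule L2_lin[OF f g])
      show "?v \<in> borel_measurable M" using factor_measurable[OF f] factor_measurable[OF g] by measurable
      show "pull ?v \<in> L2 M" unfolding pv by (rule L2_lin[OF Pf Pg])
      fix u assume u: "u \<in> borel_measurable M" "pull u \<in> L2 M"
      show "L2_inner M (\<lambda>x. a * f x + b * g x) (pull u) = L2_inner M (pull ?v) (pull u)"
        unfolding pv L2_inner_lin_left[OF f g u(2)] L2_inner_lin_left[OF Pf Pg u(2)]
          inner_P_pull[OF f u] inner_P_pull[OF g u] ..
    qed
    then show ?thesis unfolding pv .
  qed
  have 1: "L2_inner M (P f) (P g) = L2_inner M f (P g)"
    using inner_P_pull[OF f factor_measurable[OF g]] Pg unfolding P_def by blast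
  have 2: "L2_inner M (P g) (P f) = L2_inner M g (P f)"
    using inner_P_pull[OF g factor_measurable[OF f]] Pf unfolding P_def by blast
  have "L2_inner M (P f) g = cnj (L2_inner M g (P f))" by (rule L2_inner_cnj)
  also have "\<dots> = cnj (L2_inner M (P g) (P f))" unfolding 2 ..
  also have "\<dots> = L2_inner M (P f) (P g)" by (rule L2_inner_cnj[symmetric])
  finally show "L2_inner M (P f) g = L2_inner M f (P g)" unfolding 1 .
qed

lemma compressed_range: "compressed_multiplication M P (\<lambda>x. r (\<phi> x))"
proof
  show "orthogonal_projection M P" by (rule P_projection)
  show "(\<lambda>x. r (\<phi> x)) \<in> borel_measurable M" by measurable
  fix s :: "real \<Rightarrow> real" and f assume s [measurable]: "s \<in> borel_measurable borel" and f: "f \<in> L2 M"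
    and L: "(\<lambda>x. complex_of_real (s (r (\<phi> x))) * P f x) \<in> L2 M"
  have [measurable]: "factor f \<in> borel_measurable M" by (rule factor_measurable[OF f])
  have e: "(\<lambda>x. complex_of_real (s (r (\<phi> x))) * P f x) = pull (\<lambda>y. complex_of_real (s (r y)) * factor f y)"
    by (simp add: fun_eq_iff P_def pull_def)
  show "AE x in M. P (\<lambda>x. complex_of_real (s (r (\<phi> x))) * P f x) x = complex_of_real (s (r (\<phi> x))) * P f x"
    using P_pull[of "\<lambda>y. complex_of_real (s (r y)) * factor f y"] L unfolding e by (simp add: fun_cong[OF e])
qed

lemma compressed_id: "compressed_multiplication M (\<lambda>f. f) r"
  by unfold_locales (auto simp: orthogonal_projection_def)

lemma adjoint_iff_factor:
  assumes f: "f \<in> L2 M"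
  shows "(f, k) \<in> L2_adjoint M T \<longleftrightarrow> k \<in> L2 M \<and> (AE x in M. k x = of_real (r x) * factor f x)"
proof (rule adjoint_iff[OF f factor_measurable[OF f]])
  show L: "pull (factor f) \<in> L2 M" using P_in_L2[OF f] by (simp add: P_def)
  fix v assume v: "v \<in> L2 M" "pull v \<in> L2 M"
  have "L2_inner M f (pull v) = L2_inner M (pull (factor f)) (pull v)"
    using inner_P_pull[OF f L2_measurable[OF v(1)] v(2)] by (simp add: P_def)
  then show "L2_inner M (pull v) f = L2_inner M (pull v) (pull (factor f))"
    by (subst L2_inner_cnj, subst (2) L2_inner_cnj) simp
qed

text \<open>As \<open>T\<^sup>* f = r y\<close> for \<open>P f = w (y \<circ> \<phi>)\<close>, applying \<open>T\<close> yields \<open>w ((r y) \<circ> \<phi>) = (r \<circ> \<phi>) P f\<close>. The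
  condition \<open>r y \<in> L2 M\<close> from the domain of \<open>T\<^sup>*\<close> follows from the other two because
  \<open>r\<^sup>2 \<le> r + r\<^sup>3\<close>.\<close>

lemma T_T_adjoint:
  "L2_adjoint M T O T = {(f, g). f \<in> L2 M \<and> (\<lambda>x. complex_of_real (r (\<phi> x)) * P f x) \<in> L2 M \<and> g \<in> L2 M \<and>
     (AE x in M. g x = complex_of_real (r (\<phi> x)) * P f x)}"
proof (intro set_eqI, clarify)
  fix f g
  have e: "(\<lambda>x. complex_of_real (r (\<phi> x)) * P f x) = pull (\<lambda>y. of_real (r y) * factor f y)"
    by (simp add: fun_eq_iff P_def pull_def)
  show "(f, g) \<in> L2_adjoint M T O T \<longleftrightarrow> (f, g) \<in> {(f, g). f \<in> L2 M \<and> (\<lambda>x. complex_of_real (r (\<phi> x)) * P f x) \<in> L2 M \<and> g \<in> L2 M \<and>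
     (AE x in M. g x = complex_of_real (r (\<phi> x)) * P f x)}"
  proof
    assume "(f, g) \<in> L2_adjoint M T O T"
    then obtain k where fk: "(f, k) \<in> L2_adjoint M T" and kg: "(k, g) \<in> T" by blast
    have f: "f \<in> L2 M" using fk by (simp add: L2_adjoint_def)
    have [measurable]: "factor f \<in> borel_measurable M" by (rule factor_measurable[OF f])
    have k: "k \<in> L2 M" "AE x in M. k x = of_real (r x) * factor f x"
      using fk by (simp_all add: adjoint_iff_factor[OF f])
    have g: "g \<in> L2 M" "pull k \<in> L2 M" "AE x in M. g x = pull k x" using kg by (simp_all add: T_iff)
    have ae: "AE x in M. pull k x = pull (\<lambda>y. of_real (r y) * factor f y) x" by (rule pull_cong_AE[OF k(2)])
    have "AE x in M. g x = pull (\<lambda>y. of_real (r y) * factor f y) x" using g(3) ae by eventually_elim simp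
    moreover have "pull (\<lambda>y. of_real (r y) * factor f y) \<in> L2 M"
      by (rule L2_cong_AE[OF g(2)]) (use ae in auto)
    ultimately show "(f, g) \<in> {(f, g). f \<in> L2 M \<and> (\<lambda>x. complex_of_real (r (\<phi> x)) * P f x) \<in> L2 M \<and> g \<in> L2 M \<and>
     (AE x in M. g x = complex_of_real (r (\<phi> x)) * P f x)}" using f g(1) unfolding e[symmetric] by (simp add: fun_cong[OF e])
  next
    assume "(f, g) \<in> {(f, g). f \<in> L2 M \<and> (\<lambda>x. complex_of_real (r (\<phi> x)) * P f x) \<in> L2 M \<and> g \<in> L2 M \<and>
     (AE x in M. g x = complex_of_real (r (\<phi> x)) * P f x)}"
    then have f: "f \<in> L2 M" and g: "g \<in> L2 M" and L: "pull (\<lambda>y. of_real (r y) * factor f y) \<in> L2 M"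
      and ae: "AE x in M. g x = pull (\<lambda>y. of_real (r y) * factor f y) x" unfolding e[symmetric] by (simp_all add: fun_cong[OF e])
    let ?k = "\<lambda>y. complex_of_real (r y) * factor f y"
    have [measurable]: "factor f \<in> borel_measurable M" by (rule factor_measurable[OF f])
    have i1: "integrable M (\<lambda>x. r x * (cmod (factor f x))\<^sup>2)"
      using P_in_L2[OF f] by (simp add: P_def pull_L2_iff_integrable)
    have i2: "integrable M (\<lambda>x. r x * (cmod (?k x))\<^sup>2)"
      using L by (simp add: pull_L2_iff_integrable)
    have "integrable M (\<lambda>x. (cmod (?k x))\<^sup>2)"
    proof (rule Bochner_Integration.integrable_bound)
      show "integrable M (\<lambda>x. r x * (cmod (factor f x))\<^sup>2 + r x * (cmod (?k x))\<^sup>2)" using i1 i2 by simp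
      have "norm ((cmod (?k x))\<^sup>2) \<le> norm (r x * (cmod (factor f x))\<^sup>2 + r x * (cmod (?k x))\<^sup>2)" for x
      proof -
        have "r x \<le> 1 + (r x)\<^sup>2"
          using sum_squares_bound[of "r x" 1] r_nonneg[of x] unfolding power_one by linarith
        then have "r x * (r x * (cmod (factor f x))\<^sup>2) \<le> (1 + (r x)\<^sup>2) * (r x * (cmod (factor f x))\<^sup>2)"
          by (intro mult_right_mono) auto
        moreover have "(cmod (?k x))\<^sup>2 = r x * (r x * (cmod (factor f x))\<^sup>2)"
          by (simp add: norm_mult power_mult_distrib power2_eq_square)
        moreover have "r x * (cmod (factor f x))\<^sup>2 + r x * (cmod (?k x))\<^sup>2 = (1 + (r x)\<^sup>2) * (r x * (cmod (factor f x))\<^sup>2)"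
          by (simp add: norm_mult power_mult_distrib power2_eq_square algebra_simps)
        moreover have "0 \<le> (1 + (r x)\<^sup>2) * (r x * (cmod (factor f x))\<^sup>2)" by simp
        ultimately show ?thesis by simp
      qed
      then show "AE x in M. norm ((cmod (?k x))\<^sup>2) \<le> norm (r x * (cmod (factor f x))\<^sup>2 + r x * (cmod (?k x))\<^sup>2)" by simp
    qed measurable
    then have k: "?k \<in> L2 M" by (intro L2I) measurable
    have "(f, ?k) \<in> L2_adjoint M T" by (simp add: adjoint_iff_factor[OF f] k)
    moreover have "(?k, g) \<in> T" using k g L ae by (simp add: T_iff)
    ultimately show "(f, g) \<in> L2_adjoint M T O T" by blast
  qed
qed

end

section \<open>The equivalence\<close>

text \<open>The factorization lemma of Doob and Dynkin, by induction over measurable functions.\<close>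

lemma measurable_vimage_algebra_factor:
  fixes e :: "'a \<Rightarrow> ennreal"
  assumes phi: "\<phi> \<in> X \<rightarrow> space M" and e: "e \<in> borel_measurable (vimage_algebra X \<phi> M)"
  shows "\<exists>s\<in>borel_measurable M. \<forall>x\<in>X. e x = s (\<phi> x)"
  using e
proof (induction rule: borel_measurable_induct)
  case (cong f g)
  then show ?case by simp
next
  case (set A)
  then obtain B where B: "B \<in> sets M" "A = \<phi> -` B \<inter> X"
    unfolding sets_vimage_algebra2[OF phi] by blast
  then show ?case by (intro bexI[of _ "indicator B"]) (auto simp: indicator_def)
next
  case (mult u c)
  then obtain s where "s \<in> borel_measurable M" "\<forall>x\<in>X. u x = s (\<phi> x)" by blast
  then show ?case by (intro bexI[of _ "\<lambda>y. c * s y"]) auto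
next
  case (add u v)
  obtain s t where "s \<in> borel_measurable M" "\<forall>x\<in>X. u x = s (\<phi> x)"
    "t \<in> borel_measurable M" "\<forall>x\<in>X. v x = t (\<phi> x)" using add.IH by blast
  then show ?case by (intro bexI[of _ "\<lambda>y. t y + s y"]) auto
next
  case (seq U)
  have "\<forall>i. \<exists>s. s \<in> borel_measurable M \<and> (\<forall>x\<in>X. U i x = s (\<phi> x))" using seq.IH by blast
  from choice[OF this] obtain s where s: "\<And>i. s i \<in> borel_measurable M" "\<And>i x. x \<in> X \<Longrightarrow> U i x = s i (\<phi> x)"
    by blast
  show ?case
  proof (intro bexI[of _ "\<lambda>y. SUP i. s i y"] ballI)
    show "(\<lambda>y. SUP i. s i y) \<in> borel_measurable M" by (intro borel_measurable_SUP) (use s in auto)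
    show "(SUP i. U i) x = (SUP i. s i (\<phi> x))" if "x \<in> X" for x
      using s(2)[OF that] by (simp add: image_comp)
  qed
qed

context weighted_composition
begin

abbreviation pullback_algebra :: "'a measure" where
  "pullback_algebra \<equiv> vimage_algebra (space M) \<phi> M"

lemma phi_space: "\<phi> \<in> space M \<rightarrow> space M"
  using measurable_space[OF phi] by blast

lemma pullback_sigma_finite: "sigma_finite_subalgebra N pullback_algebra"
proof
  show sub: "subalgebra N pullback_algebra"
    unfolding subalgebra_def sets_vimage_algebra2[OF phi_space] by auto
  interpret \<nu>: sigma_finite_measure \<nu>\<phi> by (rule distr_sigma_finite)
  obtain B :: "nat \<Rightarrow> 'a set" where B: "range B \<subseteq> sets \<nu>\<phi>" "(\<Union>i. B i) = space \<nu>\<phi>" "\<And>i. emeasure \<nu>\<phi> (B i) \<noteq> \<infinity>"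
    using \<nu>.sigma_finite_incseq by metis
  have Bs [measurable]: "B i \<in> sets M" for i using B(1) by auto
  let ?A = "\<lambda>i. \<phi> -` B i \<inter> space M"
  have A: "?A i \<in> sets pullback_algebra" for i by (rule in_vimage_algebra[OF Bs])
  show "\<exists>A. countable A \<and> A \<subseteq> sets (restr_to_subalg N pullback_algebra) \<and>
      \<Union> A = space (restr_to_subalg N pullback_algebra) \<and>
      (\<forall>a\<in>A. emeasure (restr_to_subalg N pullback_algebra) a \<noteq> \<infinity>)"
  proof (intro exI[of _ "range ?A"] conjI ballI)
    show "range ?A \<subseteq> sets (restr_to_subalg N pullback_algebra)"
      using A by (auto simp: sets_restr_to_subalg[OF sub])
    have "\<Union> (range ?A) = \<phi> -` (\<Union>i. B i) \<inter> space M" by blast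
    then show "\<Union> (range ?A) = space (restr_to_subalg N pullback_algebra)"
      using B(2) phi_space by (auto simp: space_restr_to_subalg)
    fix a assume "a \<in> range ?A"
    then obtain i where a: "a = ?A i" by blast
    have "emeasure (restr_to_subalg N pullback_algebra) a = emeasure N (?A i)"
      unfolding a by (rule emeasure_restr_to_subalg[OF sub A])
    also have "\<dots> = emeasure \<nu>\<phi> (B i)" by (subst emeasure_distr) auto
    finally show "emeasure (restr_to_subalg N pullback_algebra) a \<noteq> \<infinity>" using B(3)[of i] by simp
  qed auto
qed

lemma E_wco_eq: "E_wco M \<phi> w h = nn_cond_exp N pullback_algebra h"
  by (simp add: E_wco_def)

text \<open>The conditional expectation is measurable with respect to the preimages and so factors through
  \<open>\<phi>\<close>; conversely it fixes every function that factors through \<open>\<phi>\<close>.\<close>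

lemma h_eq_cond_exp_iff:
  "(AE x in N. h x = E_wco M \<phi> w h x) \<longleftrightarrow>
    (\<exists>s\<in>borel_measurable M. AE x in M. w x \<noteq> 0 \<longrightarrow> r x = s (\<phi> x))"
proof
  assume *: "AE x in N. h x = E_wco M \<phi> w h x"
  have "nn_cond_exp N pullback_algebra h \<in> borel_measurable pullback_algebra" by simp
  from measurable_vimage_algebra_factor[OF phi_space this]
  obtain s where s [measurable]: "s \<in> borel_measurable M" and e: "\<forall>x\<in>space M. nn_cond_exp N pullback_algebra h x = s (\<phi> x)"
    by blast
  have "AE x in M. w x \<noteq> 0 \<longrightarrow> r x = enn2real (s (\<phi> x))"
    using *[unfolded AE_N_iff E_wco_eq] AE_space by eventually_elim (use e in \<open>auto simp: r_def\<close>)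
  then show "\<exists>s\<in>borel_measurable M. AE x in M. w x \<noteq> 0 \<longrightarrow> r x = s (\<phi> x)"
    by (intro bexI[of _ "\<lambda>y. enn2real (s y)"]) auto
next
  assume "\<exists>s\<in>borel_measurable M. AE x in M. w x \<noteq> 0 \<longrightarrow> r x = s (\<phi> x)"
  then obtain s :: "'a \<Rightarrow> real" where s [measurable]: "s \<in> borel_measurable M" and e: "AE x in M. w x \<noteq> 0 \<longrightarrow> r x = s (\<phi> x)" by blast
  interpret sigma_finite_subalgebra N pullback_algebra by (rule pullback_sigma_finite)
  let ?k = "\<lambda>x. ennreal (s (\<phi> x))"
  have "\<phi> \<in> pullback_algebra \<rightarrow>\<^sub>M M" by (rule measurable_vimage_algebra1[OF phi_space])
  then have km: "?k \<in> borel_measurable pullback_algebra" by measurable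
  have hk: "AE x in N. h x = ?k x"
    unfolding AE_N_iff using e h_eq_r by eventually_elim auto
  have "AE x in N. nn_cond_exp N pullback_algebra h x = nn_cond_exp N pullback_algebra ?k x"
    by (rule nn_cond_exp_cong[OF hk]) auto
  with hk nn_cond_exp_F_meas[OF km] show "AE x in N. h x = E_wco M \<phi> w h x"
    unfolding E_wco_eq by eventually_elim simp
qed

text \<open>On the subspace of all \<open>w (v \<circ> \<phi>)\<close> the function \<open>r\<close> can be replaced by \<open>s \<circ> \<phi>\<close>, so that multiplication
  by \<open>1\<^sub>\<sigma> \<circ> r\<close> leaves the subspace invariant; being symmetric, it commutes with the projection.\<close>

lemma P_commutes_if_factors:
  assumes s [measurable]: "s \<in> borel_measurable M" and rs: "AE x in M. w x \<noteq> 0 \<longrightarrow> r x = s (\<phi> x)"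
    and \<sigma>: "\<sigma> \<in> sets borel" and f: "f \<in> L2 M"
  shows "AE x in M. P (\<lambda>x. indicator \<sigma> (complex_of_real (r x)) * f x) x
    = indicator \<sigma> (complex_of_real (r x)) * P f x"
proof -
  let ?c = "\<lambda>x. indicator \<sigma> (complex_of_real (r x)) :: complex"
  let ?d = "\<lambda>y. indicator \<sigma> (complex_of_real (s y)) :: complex"
  have c_real: "?c x = complex_of_real (indicator \<sigma> (complex_of_real (r x)))" for x by (simp add: indicator_def)
  have ind: "(\<lambda>x. indicator \<sigma> (complex_of_real (k x)) :: complex) \<in> borel_measurable M"
    if [measurable]: "k \<in> borel_measurable M" for k
  proof -
    have "(\<lambda>x. complex_of_real (k x)) \<in> borel_measurable M" by measurable
    from measurable_compose[OF this borel_measurable_indicator[OF \<sigma>]] show ?thesis .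
  qed
  note [measurable] = ind[OF r_measurable] ind[OF s]
  have cL: "(\<lambda>x. ?c x * g x) \<in> L2 M" if "g \<in> L2 M" for g
  proof (rule L2_mult_bounded[OF that])
    show "?c \<in> borel_measurable M" by (rule ind[OF r_measurable])
    show "cmod (?c x) \<le> 1" for x by (simp add: indicator_def)
  qed
  have cd: "AE x in M. ?c x * pull u x = pull (\<lambda>y. ?d y * u y) x" for u
    using rs by eventually_elim (auto simp: pull_def)
  have pd: "pull (\<lambda>y. ?d y * u y) \<in> L2 M" if [measurable]: "u \<in> borel_measurable M" and "pull u \<in> L2 M" for u
    by (rule L2_cong_AE[OF cL[OF \<open>pull u \<in> L2 M\<close>]]) (use cd[of u] in auto)
  have [measurable]: "factor f \<in> borel_measurable M" by (rule factor_measurable[OF f])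
  note Pf = P_in_L2[OF f]
  let ?v = "\<lambda>y. ?d y * factor f y"
  have v: "AE x in M. ?c x * P f x = pull ?v x" unfolding P_def by (rule cd)
  have pv: "pull ?v \<in> L2 M" by (rule pd) (use Pf in \<open>simp_all add: P_def\<close>)
  have "AE x in M. P (\<lambda>x. ?c x * f x) x = pull ?v x"
  proof (rule P_eqI[OF cL[OF f] _ pv])
    show "?v \<in> borel_measurable M" by measurable
    fix u assume u [measurable]: "u \<in> borel_measurable M" and pu: "pull u \<in> L2 M"
    have du: "(\<lambda>y. ?d y * u y) \<in> borel_measurable M" by measurable
    have "L2_inner M (\<lambda>x. ?c x * f x) (pull u) = L2_inner M f (\<lambda>x. ?c x * pull u x)"
      unfolding c_real by (rule L2_inner_mult_real)
    also have "\<dots> = L2_inner M f (pull (\<lambda>y. ?d y * u y))"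
      by (rule L2_inner_cong_right[OF cL[OF pu] pd[OF u pu] f cd])
    also have "\<dots> = L2_inner M (P f) (pull (\<lambda>y. ?d y * u y))"
      by (rule inner_P_pull[OF f du pd[OF u pu], symmetric])
    also have "\<dots> = L2_inner M (P f) (\<lambda>x. ?c x * pull u x)"
      by (rule L2_inner_cong_right[OF cL[OF pu] pd[OF u pu] Pf cd, symmetric])
    also have "\<dots> = L2_inner M (\<lambda>x. ?c x * P f x) (pull u)"
      unfolding c_real by (rule L2_inner_mult_real[symmetric])
    also have "\<dots> = L2_inner M (pull ?v) (pull u)"
      by (rule L2_inner_cong_left[OF cL[OF Pf] pv pu v])
    finally show "L2_inner M (\<lambda>x. ?c x * f x) (pull u) = L2_inner M (pull ?v) (pull u)" .
  qed
  then show ?thesis using v by eventually_elim simp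
qed

lemma weakly_centered_if_factors:
  assumes s: "s \<in> borel_measurable M" and rs: "AE x in M. w x \<noteq> 0 \<longrightarrow> r x = s (\<phi> x)"
  shows "spectrally_weakly_centered M T"
proof -
  interpret id: compressed_multiplication M "\<lambda>f. f" r by (rule compressed_id)
  interpret ran: compressed_multiplication M P "\<lambda>x. r (\<phi> x)" by (rule compressed_range)
  let ?E = "compressed_pvm (\<lambda>f. f) r" and ?F = "compressed_pvm P (\<lambda>x. r (\<phi> x))"
  have "is_spectral_measure_of M ?E (T O L2_adjoint M T)"
    unfolding is_spectral_measure_of_def T_adjoint_T using id.spectral_measure_compressed_pvm id.pvm_integral_compressed by simp
  moreover have "is_spectral_measure_of M ?F (L2_adjoint M T O T)"
    unfolding is_spectral_measure_of_def T_T_adjoint using ran.spectral_measure_compressed_pvm ran.pvm_integral_compressed by simp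
  moreover have "AE x in M. ?E \<sigma> (?F \<omega> f) x = ?F \<omega> (?E \<sigma> f) x"
    if "\<sigma> \<in> sets borel" "\<omega> \<in> sets borel" "f \<in> L2 M" for \<sigma> \<omega> f
  proof -
    have E: "?E \<sigma> g = (\<lambda>x. indicator \<sigma> (complex_of_real (r x)) * g x)" for g
      by (simp add: compressed_pvm_def)
    show ?thesis
      unfolding E using P_commutes_if_factors[OF s rs that(1,3)]
      by eventually_elim (simp add: compressed_pvm_def algebra_simps)
  qed
  ultimately show ?thesis
    unfolding spectrally_weakly_centered_def using T_closed dense by blast
qed

lemma kernel_T_T_adjoint:
  "(y, \<lambda>x. 0) \<in> L2_adjoint M T O T \<longleftrightarrow> y \<in> L2 M \<and> (AE x in M. P y x = 0)"
proof (cases "y \<in> L2 M")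
  case True
  have [measurable]: "P y \<in> borel_measurable M" by (rule L2_measurable[OF P_in_L2[OF True]])
  have "(AE x in M. 0 = complex_of_real (r (\<phi> x)) * P y x) \<longleftrightarrow> (AE x in M. P y x = 0)"
  proof
    assume "AE x in M. 0 = complex_of_real (r (\<phi> x)) * P y x"
    with r_phi_pos show "AE x in M. P y x = 0"
      by eventually_elim (auto simp: P_def pull_def)
  qed (auto elim!: eventually_mono)
  moreover have "(\<lambda>x. complex_of_real (r (\<phi> x)) * P y x) \<in> L2 M" if "AE x in M. P y x = 0"
    by (rule L2_cong_AE[OF L2_zero]) (use that in auto)
  ultimately show ?thesis using True by (auto simp: T_T_adjoint)
qed (auto simp: T_T_adjoint)

text \<open>\<open>F({0})\<close> fixes \<open>f - P f\<close>, a vector of the kernel. Its value \<open>y\<close> at \<open>P f\<close> lies in the kernel as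
  well, so that \<open>P y = 0\<close> and \<open>\<parallel>y\<parallel>\<^sup>2 = \<langle>y, P f\<rangle> = \<langle>P y, f\<rangle> = 0\<close>.\<close>

lemma null_projection:
  assumes "is_spectral_measure_of M F (L2_adjoint M T O T)" and f: "f \<in> L2 M"
  shows "AE x in M. F {0} f x = f x - P f x"
proof -
  interpret F: L2_spectral_measure M F
    using assms(1) by unfold_locales (simp add: is_spectral_measure_of_def)
  have int: "pvm_integral M F = L2_adjoint M T O T" using assms(1) by (simp add: is_spectral_measure_of_def)
  note z = borel_singleton_zero note proj = F.proj[OF z]
  note Pf = P_in_L2[OF f]
  have d: "(\<lambda>x. f x - P f x) \<in> L2 M" by (rule L2_diff[OF f Pf])
  have "AE x in M. P (\<lambda>x. f x - P f x) x = 0"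
    using orthogonal_projection_diff[OF P_projection f Pf] orthogonal_projection_idem[OF P_projection f]
    by eventually_elim simp
  then have "(\<lambda>x. f x - P f x, \<lambda>x. 0) \<in> pvm_integral M F"
    unfolding int kernel_T_T_adjoint using d by blast
  from F.fixed_if_kernel[OF this] have 1: "AE x in M. F {0} (\<lambda>x. f x - P f x) x = f x - P f x" .
  let ?y = "F {0} (P f)"
  have y: "?y \<in> L2 M" by (rule F.E_L2[OF z Pf])
  have "(?y, \<lambda>x. 0) \<in> pvm_integral M F"
    by (rule F.kernel_if_fixed[OF y F.E_idem[OF z Pf]])
  then have Py: "AE x in M. P ?y x = 0" unfolding int kernel_T_T_adjoint by blast
  have "L2_inner M ?y ?y = L2_inner M ?y (P f)" by (rule orthogonal_projection_inner[OF proj Pf Pf])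
  also have "\<dots> = L2_inner M (P ?y) f" by (rule orthogonal_projection_sym[OF P_projection y f, symmetric])
  also have "\<dots> = L2_inner M (\<lambda>x. 0) f" by (rule L2_inner_cong_left[OF P_in_L2[OF y] L2_zero f Py])
  finally have "AE x in M. ?y x = 0" by (intro L2_inner_self_eq_0D[OF y]) simp
  then show ?thesis
    using 1 orthogonal_projection_diff[OF proj f Pf] by eventually_elim simp
qed

text \<open>Commutation gives \<open>P (r f) = r P f\<close>. Comparing both sides for a vector \<open>f = w u\<close> with \<open>u > 0\<close>
  expresses \<open>r\<close> as a quotient of two functions composed with \<open>\<phi>\<close>.\<close>

lemma factors_if_weakly_centered:
  assumes "spectrally_weakly_centered M T"
  shows "\<exists>s\<in>borel_measurable M. AE x in M. w x \<noteq> 0 \<longrightarrow> r x = s (\<phi> x)"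
proof -
  obtain E F where E: "is_spectral_measure_of M E (T O L2_adjoint M T)"
    and F: "is_spectral_measure_of M F (L2_adjoint M T O T)"
    and comm: "\<And>\<sigma> \<omega> f. \<sigma> \<in> sets borel \<Longrightarrow> \<omega> \<in> sets borel \<Longrightarrow> f \<in> L2 M \<Longrightarrow> AE x in M. E \<sigma> (F \<omega> f) x = F \<omega> (E \<sigma> f) x"
    using assms unfolding spectrally_weakly_centered_def by blast
  interpret E: L2_spectral_measure M E
    using E by unfold_locales (simp add: is_spectral_measure_of_def)
  interpret F: L2_spectral_measure M F
    using F by unfold_locales (simp add: is_spectral_measure_of_def)
  have intE: "pvm_integral M E = T O L2_adjoint M T" using E by (simp add: is_spectral_measure_of_def)
  note z = borel_singleton_zero
  have P_r: "AE x in M. P (\<lambda>x. complex_of_real (r x) * f x) x = complex_of_real (r x) * P f x"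
    if f: "f \<in> L2 M" and rf: "(\<lambda>x. complex_of_real (r x) * f x) \<in> L2 M" for f
  proof -
    have "(f, \<lambda>x. complex_of_real (r x) * f x) \<in> pvm_integral M E"
      unfolding intE T_adjoint_T using f rf by simp
    from E.pvm_integral_commute[OF F.proj[OF z] comm[OF _ z] this]
    have "AE x in M. F {0} (\<lambda>x. complex_of_real (r x) * f x) x = complex_of_real (r x) * F {0} f x"
      unfolding intE T_adjoint_T by simp
    then show ?thesis
      using null_projection[OF F f] null_projection[OF F rf]
    proof eventually_elim
      case (elim x)
      have "complex_of_real (r x) * f x - P (\<lambda>x. complex_of_real (r x) * f x) x
          = complex_of_real (r x) * f x - complex_of_real (r x) * P f x"
        unfolding elim(3)[symmetric] elim(1) elim(2) by (rule right_diff_distrib)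
      then show ?case by simp
    qed
  qed
  obtain p0 where p0m [measurable]: "p0 \<in> borel_measurable M" and p0: "(\<integral>\<^sup>+x. p0 x \<partial>M) \<noteq> \<infinity>"
    "\<And>x. x \<in> space M \<Longrightarrow> 0 < p0 x \<and> p0 x < \<infinity>"
    using Ex_finite_integrable_function by blast
  define p where "p x = sqrt (enn2real (p0 x))" for x
  have pm [measurable]: "p \<in> borel_measurable M" unfolding p_def[abs_def] by measurable
  have p_pos: "0 < p x" if "x \<in> space M" for x
    using p0(2)[OF that] by (simp add: p_def enn2real_positive_iff)
  have p_nn: "0 \<le> p x" for x by (simp add: p_def)
  have pL: "(\<lambda>x. complex_of_real (p x)) \<in> L2 M"
  proof -
    have "(\<integral>\<^sup>+x. ennreal ((cmod (complex_of_real (p x)))\<^sup>2) \<partial>M) = (\<integral>\<^sup>+x. p0 x \<partial>M)"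
      using p0(2) by (intro nn_integral_cong) (simp add: p_def)
    then show ?thesis using p0(1) by (subst L2_iff_nn) (auto simp: less_top)
  qed
  \<comment> \<open>\<open>u\<close> is positive and so small that both \<open>w u\<close> and \<open>r w u\<close> are bounded by \<open>p\<close>.\<close>
  define u where "u x = p x / (1 + (1 + r x) * cmod (w x))" for x
  have um [measurable]: "u \<in> borel_measurable M" unfolding u_def[abs_def] by measurable
  have den: "1 \<le> 1 + (1 + r x) * cmod (w x)" for x by simp
  have u_pos: "0 < u x" if "x \<in> space M" for x
    unfolding u_def using p_pos[OF that] den[of x] by (intro divide_pos_pos) linarith+
  have u_nn: "0 \<le> u x" for x unfolding u_def using p_nn[of x] den[of x] by (intro divide_nonneg_nonneg) linarith+
  have u_le: "c * cmod (w x) * u x \<le> p x" if "c \<le> 1 + r x" for c x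
  proof -
    have "c * cmod (w x) \<le> 1 + (1 + r x) * cmod (w x)"
      using mult_right_mono[OF that, of "cmod (w x)"] by simp
    then have "c * cmod (w x) * u x \<le> (1 + (1 + r x) * cmod (w x)) * u x"
      by (rule mult_right_mono[OF _ u_nn])
    also have "\<dots> = p x"
    proof -
      have "1 + (1 + r x) * cmod (w x) \<noteq> 0" using den[of x] by linarith
      then show ?thesis unfolding u_def by simp
    qed
    finally show ?thesis .
  qed
  define f where "f x = w x * complex_of_real (u x)" for x
  have [measurable]: "f \<in> borel_measurable M" unfolding f_def[abs_def] by measurable
  have fL: "f \<in> L2 M"
  proof (rule L2_bound[OF pL, of _ 1])
    show "AE x in M. cmod (f x) \<le> 1 * cmod (complex_of_real (p x))"
      using u_le[of 1] by (simp add: f_def norm_mult p_nn u_nn)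
  qed measurable
  have rfL: "(\<lambda>x. complex_of_real (r x) * f x) \<in> L2 M"
  proof (rule L2_bound[OF pL, of _ 1])
    show "AE x in M. cmod (complex_of_real (r x) * f x) \<le> 1 * cmod (complex_of_real (p x))"
      using u_le[of "r x" x for x] by (simp add: f_def norm_mult p_nn u_nn mult.assoc)
  qed measurable
  let ?v = "factor f" and ?v' = "factor (\<lambda>x. complex_of_real (r x) * f x)"
  have [measurable]: "?v \<in> borel_measurable M" "?v' \<in> borel_measurable M"
    by (rule factor_measurable[OF fL], rule factor_measurable[OF rfL])
  have eq: "AE x in M. w x \<noteq> 0 \<longrightarrow> ?v' (\<phi> x) = complex_of_real (r x) * ?v (\<phi> x)"
    using P_r[OF fL rfL] by eventually_elim (auto simp: P_def pull_def)
  have nz: "AE x in M. w x \<noteq> 0 \<longrightarrow> ?v (\<phi> x) \<noteq> 0"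
  proof -
    \<comment> \<open>\<open>t\<close> is positive exactly at the zeros of \<open>v\<close> and small enough for \<open>w (t \<circ> \<phi>)\<close> to be
      square-integrable. Its inner product with \<open>P f\<close> vanishes, while that with \<open>f\<close> is the integral
      of the nonnegative function \<open>|w|\<^sup>2 u (t \<circ> \<phi>)\<close>.\<close>
    define t where "t y = of_bool (?v y = 0) * (p y / (1 + r y))" for y
    have [measurable]: "t \<in> borel_measurable M" unfolding t_def[abs_def] by measurable
    have t_nn: "0 \<le> t y" for y by (simp add: t_def p_nn)
    have tp: "t y \<le> p y" "r y * t y \<le> p y" for y
    proof -
      have "c * (p y / (1 + r y)) \<le> p y" if "c \<le> 1 + r y" for c
      proof -
        have "0 < 1 + r y" using r_nonneg[of y] by linarith
        with mult_right_mono[OF that p_nn[of y]] show ?thesis by (simp add: pos_divide_le_eq mult.commute)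
      qed
      from this[of 1] this[of "r y"] show "t y \<le> p y" "r y * t y \<le> p y"
        by (auto simp: t_def p_nn)
    qed
    have pt: "pull (\<lambda>y. complex_of_real (t y)) \<in> L2 M"
    proof -
      have "integrable M (\<lambda>y. r y * (cmod (complex_of_real (t y)))\<^sup>2)"
      proof (rule Bochner_Integration.integrable_bound[OF L2_integrable[OF pL]])
        have "norm (r y * (cmod (complex_of_real (t y)))\<^sup>2) \<le> norm ((cmod (complex_of_real (p y)))\<^sup>2)" for y
          using mult_mono[OF tp(2) tp(1) p_nn t_nn, of y y] by (simp add: power2_eq_square t_nn p_nn mult.assoc)
        then show "AE y in M. norm (r y * (cmod (complex_of_real (t y)))\<^sup>2) \<le> norm ((cmod (complex_of_real (p y)))\<^sup>2)" by simp
      qed measurable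
      then show ?thesis by (simp add: pull_L2_iff_integrable)
    qed
    let ?i = "\<lambda>x. (cmod (w x))\<^sup>2 * (u x * t (\<phi> x))"
    have f_t: "f x * cnj (pull (\<lambda>y. complex_of_real (t y)) x) = complex_of_real (?i x)" for x
    proof -
      have "f x * cnj (pull (\<lambda>y. complex_of_real (t y)) x) = (w x * cnj (w x)) * complex_of_real (u x * t (\<phi> x))"
        by (simp add: f_def pull_def)
      then show ?thesis unfolding complex_norm_square[symmetric] by simp
    qed
    have "L2_inner M f (pull (\<lambda>y. complex_of_real (t y))) = L2_inner M (P f) (pull (\<lambda>y. complex_of_real (t y)))"
      by (rule inner_P_pull[OF fL _ pt, symmetric]) measurable
    also have "\<dots> = 0"
    proof -
      have 0: "P f x * cnj (pull (\<lambda>y. complex_of_real (t y)) x) = 0" for x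
        by (simp add: P_def pull_def t_def)
      show ?thesis unfolding L2_inner_def 0 by simp
    qed
    finally have "complex_of_real (integral\<^sup>L M ?i) = 0"
      unfolding L2_inner_def f_t by (simp only: integral_complex_of_real)
    then have 0: "integral\<^sup>L M ?i = 0" by (simp only: of_real_eq_0_iff)
    have "integrable M (\<lambda>x. complex_of_real (?i x))"
      using L2_integrable_inner[OF fL pt] unfolding f_t .
    then have "integrable M ?i" by (simp only: complex_of_real_integrable_eq)
    then have "AE x in M. ?i x = 0"
      using integral_nonneg_eq_0_iff_AE[of M ?i] 0 u_nn t_nn by simp
    then show ?thesis
      using AE_space
    proof eventually_elim
      case (elim x)
      have "\<phi> x \<in> space M" using elim(2) phi_space by blast
      moreover have "0 < 1 + r (\<phi> x)" using r_nonneg[of "\<phi> x"] by linarith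
      ultimately have "0 < p (\<phi> x) / (1 + r (\<phi> x))" by (intro divide_pos_pos p_pos)
      with elim(1) u_pos[OF elim(2)] show ?case by (auto simp: t_def)
    qed
  qed
  have "AE x in M. w x \<noteq> 0 \<longrightarrow> r x = Re (?v' (\<phi> x) / ?v (\<phi> x))"
    using eq nz by eventually_elim auto
  moreover have "(\<lambda>y. Re (?v' y / ?v y)) \<in> borel_measurable M" by measurable
  ultimately show ?thesis by (intro bexI[of _ "\<lambda>y. Re (?v' y / ?v y)"])
qed

end


theorem theorem17:
  fixes M :: "'a measure" and \<phi> :: "'a \<Rightarrow> 'a" and w :: "'a \<Rightarrow> complex"
  assumes "sigma_finite_measure M"
    and "\<phi> \<in> M \<rightarrow>\<^sub>M M"
    and "w \<in> borel_measurable M"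
    and "absolutely_continuous M (distr (weighted_measure M w) M \<phi>)"
    and "densely_defined M (weighted_comp_op M \<phi> w)"
  shows "(AE x in weighted_measure M w. h_wco M \<phi> w x = E_wco M \<phi> w (h_wco M \<phi> w) x) \<longleftrightarrow>
         spectrally_weakly_centered M (weighted_comp_op M \<phi> w)"
  proof -
  interpret weighted_composition M \<phi> w
    by (rule weighted_composition.intro[OF assms(1)]) (unfold_locales; fact assms)
  show ?thesis
    unfolding h_eq_cond_exp_iff
    using weakly_centered_if_factors factors_if_weakly_centered by blast
qed

end
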